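(* Let $R\ge\frac12$ and $z\in\mathbb{K}$. Then the Weyl algebra $\mathcal{W}_R(V,\star_{z\Lambda})$ as well as its completion $\widehat{\mathcal{W}}_R(V,\star_{z\Lambda})$ depend functorially on $(V,\Lambda)$ with respect to continuous Poisson maps. That is: if $A\colon(V,\Lambda_V)\to(W,\Lambda_W)$ is a continuous Poisson map, then the induced unital algebra homomorphism $A\colon \mathrm{S}^\bullet(V)\to \mathrm{S}^\bullet(W)$ extending $A\colon V\to W$ is a continuous unital algebra homomorphism $\mathcal{W}_R(V,\star_{z\Lambda_V})\to\mathcal{W}_R(W,\star_{z\Lambda_W})$, it extends to a continuous unital algebra homomorphism $\widehat{\mathcal{W}}_R(V,\star_{z\Lambda_V})\to\widehat{\mathcal{W}}_R(W,\star_{z\Lambda_W})$, and these assignments respect identities and compositions.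
   Context: $\mathbb{K}=\mathbb{R}$ or $\mathbb{C}$. All spaces $V=V_{\mathbf 0}\oplus V_{\mathbf 1}$ (and $W$) are $\mathbb{Z}_2$-graded Hausdorff locally convex $\mathbb{K}$-vector spaces with continuous projections onto even and odd parts, and $\Lambda=\Lambda_V\colon V\times V\to\mathbb{K}$ (and $\Lambda_W$) are continuous even bilinear forms (even: vanishing on pairs of homogeneous vectors of different parity). A Poisson map is an even (parity preserving) linear map $A\colon V\to W$ with $\Lambda_W(A(v),A(v'))=\Lambda_V(v,v')$ for all $v,v'\in V$. In exponents of $-1$ a homogeneous vector denotes its parity. Symmetric algebra: $S_n$ acts from the right on $V^{\otimes n}$ by $(v_1\otimes\cdots\otimes v_n)\triangleleft\sigma=\pm\, v_{\sigma(1)}\otimes\cdots\otimes v_{\sigma(n)}$ for homogeneous $v_i$, where $\pm$ is the Koszul sign ($-1$ to the number of pairs $i<j$ with $\sigma(i)>\sigma(j)$ and $v_{\sigma(i)},v_{\sigma(j)}$ both odd). $\mathcal{S}_n(v)=\frac1{n!}\sum_{\sigma} v\triangleleft\sigma$, $\mathrm{S}^n(V)=\operatorname{im}\mathcal{S}_n\subseteq V^{\otimes n}$, $\mathrm{S}^0(V)=\mathbb{K}$, $\mathrm{S}^\bullet(V)=\bigoplus_n \mathrm{S}^n(V)$, with product $\mu(v\otimes w)=vw=\mathcal{S}(v\otimes w)$, $\mathcal{S}=\bigoplus_n\mathcal{S}_n$. Star product: $P_\Lambda$ is the linear extension of $$P_\Lambda(v_1\cdots v_n\otimes w_1\cdots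 w_m)=\sum_{k=1}^n\sum_{\ell=1}^m(-1)^{v_k(v_{k+1}+\cdots+v_n)+w_\ell(w_1+\cdots+w_{\ell-1})}\Lambda(v_k,w_\ell)\,v_1\cdots\widehat{v_k}\cdots v_n\otimes w_1\cdots\widehat{w_\ell}\cdots w_m$$ on $\mathrm{S}^\bullet(V)\otimes \mathrm{S}^\bullet(V)$ (homogeneous vectors; hats denote omission; $P_\Lambda$ vanishes if one factor is in $\mathrm{S}^0(V)$), and $a\star_{z\Lambda}b=\sum_{k\ge0}\frac{z^k}{k!}\mu(P_\Lambda^k(a\otimes b))$. Topology: for a continuous seminorm $p$ on $V$ let $p^n$ be the projective tensor seminorm on $V^{\otimes n}$ ($p^0=|\cdot|$) and $p_R(v)=\sum_np^n(v_n)\,n!^R$ for $v=\sum_nv_n$. $\mathcal{W}_R(V,\star_{z\Lambda})$ is $\mathrm{S}^\bullet(V)$ with product $\star_{z\Lambda}$ and the topology of all $p_R$ ($p$ a continuous seminorm on $V$). For $R\ge\frac12$ the product is continuous and extends to the completion $\widehat{\mathcal{W}}_R(V,\star_{z\Lambda})$. *)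

theory Defs
  imports "HOL-Analysis.Analysis" "HOL-Combinatorics.Permutations"
    "HOL-Library.Function_Algebras" "HOL-Algebra.Module"
begin

section \<open>Graded locally convex spaces with an even bilinear form\<close>

text \<open>
  The scalars range over a type \<open>'k\<close> of class \<^class>\<open>real_normed_field\<close>, whose norm is
  multiplicative. By the theorems of Gelfand--Mazur and Ostrowski the only such fields are the
  real and the complex numbers with their usual absolute value.

  \<open>part V e\<close> is the projection onto the even (\<open>e = False\<close>) or odd (\<open>e = True\<close>) part, so that
  the homogeneous vectors of parity \<open>e\<close> form the set \<open>range (part V e)\<close>.
\<close>

record ('k, 'v) graded_space =
  scl :: "'k \<Rightarrow> 'v \<Rightarrow> 'v"
  part :: "bool \<Rightarrow> 'v \<Rightarrow> 'v"
  form :: "'v \<Rightarrow> 'v \<Rightarrow> 'k"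

definition homogeneous :: "('k, 'v) graded_space \<Rightarrow> bool \<Rightarrow> 'v set" where
  "homogeneous V e = range (part V e)"

locale poisson_space = vector_space "scl V"
  for V :: "('k::real_normed_field, 'v::{topological_ab_group_add, t2_space}) graded_space" +
  assumes continuous_scl: "continuous_on UNIV (\<lambda>(c, v). scl V c v)"
    and locally_convex: "open U \<Longrightarrow> 0 \<in> U \<Longrightarrow>
      \<exists>C\<subseteq>U. 0 \<in> interior C \<and>
        (\<forall>x\<in>C. \<forall>y\<in>C. \<forall>t\<in>{0..1}. scl V (of_real t) x + scl V (of_real (1 - t)) y \<in> C)"
    and part_linear: "Vector_Spaces.linear (scl V) (scl V) (part V e)"
    and part_continuous: "continuous_on UNIV (part V e)"
    and part_part: "part V e (part V e' v) = (if e = e' then part V e v else 0)"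
    and part_sum: "part V False v + part V True v = v"
    and form_linear1: "Vector_Spaces.linear (scl V) (*) (\<lambda>v. form V v w)"
    and form_linear2: "Vector_Spaces.linear (scl V) (*) (\<lambda>w. form V v w)"
    and form_continuous: "continuous_on UNIV (\<lambda>(v, w). form V v w)"
    and form_even: "v \<in> homogeneous V e \<Longrightarrow> w \<in> homogeneous V e' \<Longrightarrow> e \<noteq> e' \<Longrightarrow> form V v w = 0"

definition continuous_poisson_map ::
    "('k::real_normed_field, 'v::{topological_ab_group_add, t2_space}) graded_space \<Rightarrow>
     ('k, 'w::{topological_ab_group_add, t2_space}) graded_space \<Rightarrow> ('v \<Rightarrow> 'w) \<Rightarrow> bool" where
  "continuous_poisson_map V W A \<longleftrightarrow>
     Vector_Spaces.linear (scl V) (scl W) A \<and>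
     (\<forall>e. A ` homogeneous V e \<subseteq> homogeneous W e) \<and>
     (\<forall>v v'. form W (A v) (A v') = form V v v') \<and>
     continuous_on UNIV A"

definition continuous_seminorm ::
    "('k::real_normed_field, 'v::{topological_ab_group_add, t2_space}) graded_space \<Rightarrow>
     ('v \<Rightarrow> real) \<Rightarrow> bool" where
  "continuous_seminorm V p \<longleftrightarrow>
     (\<forall>v. 0 \<le> p v) \<and> (\<forall>v w. p (v + w) \<le> p v + p w) \<and>
     (\<forall>c v. p (scl V c v) = norm c * p v) \<and> continuous_on UNIV p"


section \<open>The tensor algebra\<close>

text \<open>
  \<open>multilinear_form V f\<close> says that, for every \<open>n\<close>, \<open>f\<close> restricted to lists of length \<open>n\<close> is an
  \<open>n\<close>-linear form. The tensor \<open>v\<^sub>1 \<otimes> \<dots> \<otimes> v\<^sub>n\<close> is represented by the functional evaluating such an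
  \<open>f\<close> at \<open>[v\<^sub>1, \<dots>, v\<^sub>n]\<close>. As multilinear forms separate the points of an algebraic tensor product
  of vector spaces, the span of these functionals is the direct sum of all tensor powers of \<open>V\<close>
  (with \<open>[]\<close> spanning the scalars in degree zero). The same is done for pairs of
  lists to obtain the tensor product of the tensor algebra with itself.
\<close>

type_synonym ('k, 'i) tensor = "('i \<Rightarrow> 'k) \<Rightarrow> 'k"

definition tscale :: "'k::times \<Rightarrow> ('x \<Rightarrow> 'k) \<Rightarrow> ('x \<Rightarrow> 'k)" where
  "tscale c t = (\<lambda>x. c * t x)"

definition multilinear_form ::
    "('k::real_normed_field, 'v::ab_group_add) graded_space \<Rightarrow> ('v list \<Rightarrow> 'k) \<Rightarrow> bool" where
  "multilinear_form V f \<longleftrightarrow>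
     (\<forall>us ws. Vector_Spaces.linear (scl V) (*) (\<lambda>v. f (us @ v # ws)))"

definition multilinear_form2 ::
    "('k::real_normed_field, 'v::ab_group_add) graded_space \<Rightarrow> ('v list \<times> 'v list \<Rightarrow> 'k) \<Rightarrow> bool" where
  "multilinear_form2 V f \<longleftrightarrow>
     (\<forall>ys. multilinear_form V (\<lambda>xs. f (xs, ys))) \<and> (\<forall>xs. multilinear_form V (\<lambda>ys. f (xs, ys)))"

definition pure ::
    "('k::real_normed_field, 'v::ab_group_add) graded_space \<Rightarrow> 'v list \<Rightarrow> ('k, 'v list) tensor" where
  "pure V xs = (\<lambda>f. if multilinear_form V f then f xs else 0)"

definition pure2 ::
    "('k::real_normed_field, 'v::ab_group_add) graded_space \<Rightarrow> 'v list \<Rightarrow> 'v list \<Rightarrow>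
     ('k, 'v list \<times> 'v list) tensor" where
  "pure2 V xs ys = (\<lambda>f. if multilinear_form2 V f then f (xs, ys) else 0)"

definition tensor_algebra ::
    "('k::real_normed_field, 'v::ab_group_add) graded_space \<Rightarrow> ('k, 'v list) tensor set" where
  "tensor_algebra V = Modules.module.span tscale (range (pure V))"

text \<open>
  The linear extension of a map \<open>\<Phi>\<close> that is multilinear in the entries of its list argument(s):
  it sends \<open>pure V xs\<close> to \<open>\<Phi> xs\<close>, and \<open>pure2 V xs ys\<close> to \<open>\<Phi> (xs, ys)\<close>.
\<close>

definition lin_extend :: "('i \<Rightarrow> 'x \<Rightarrow> 'k) \<Rightarrow> ('k, 'i) tensor \<Rightarrow> 'x \<Rightarrow> 'k" where
  "lin_extend \<Phi> t = (\<lambda>x. t (\<lambda>i. \<Phi> i x))"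

definition degree_part ::
    "('k::real_normed_field, 'v::ab_group_add) graded_space \<Rightarrow> nat \<Rightarrow> ('k, 'v list) tensor \<Rightarrow> ('k, 'v list) tensor"
  where
  "degree_part V n = lin_extend (\<lambda>xs. if length xs = n then pure V xs else 0)"

definition tensor_pair ::
    "('k::real_normed_field, 'v::ab_group_add) graded_space \<Rightarrow> ('k, 'v list) tensor \<Rightarrow> ('k, 'v list) tensor \<Rightarrow>
     ('k, 'v list \<times> 'v list) tensor" where
  "tensor_pair V a b = lin_extend (\<lambda>xs. lin_extend (\<lambda>ys. pure2 V xs ys) b) a"


section \<open>The symmetric algebra\<close>

text \<open>
  Formulas given for homogeneous vectors are extended multilinearly by summing over the parities
  of the homogeneous components of all arguments.
\<close>

definition parities :: "nat \<Rightarrow> bool list set" where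
  "parities n = {d. length d = n}"

definition components :: "('k, 'v) graded_space \<Rightarrow> bool list \<Rightarrow> 'v list \<Rightarrow> 'v list" where
  "components V d xs = map2 (part V) d xs"

definition koszul_sign :: "bool list \<Rightarrow> (nat \<Rightarrow> nat) \<Rightarrow> 'k::ring_1" where
  "koszul_sign d \<sigma> =
     (-1) ^ card {(i, j). i < j \<and> j < length d \<and> \<sigma> i > \<sigma> j \<and> d ! \<sigma> i \<and> d ! \<sigma> j}"

definition permute_tensor ::
    "('k::real_normed_field, 'v::ab_group_add) graded_space \<Rightarrow> (nat \<Rightarrow> nat) \<Rightarrow> 'v list \<Rightarrow> ('k, 'v list) tensor"
  where
  "permute_tensor V \<sigma> xs =
     (\<Sum>d\<in>parities (length xs).
        tscale (koszul_sign d \<sigma>) (pure V (permute_list \<sigma> (components V d xs))))"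

definition symmetrize ::
    "('k::real_normed_field, 'v::ab_group_add) graded_space \<Rightarrow> ('k, 'v list) tensor \<Rightarrow> ('k, 'v list) tensor"
  where
  "symmetrize V = lin_extend (\<lambda>xs. tscale (1 / fact (length xs))
     (\<Sum>\<sigma> | \<sigma> permutes {..<length xs}. permute_tensor V \<sigma> xs))"

definition symmetric_algebra ::
    "('k::real_normed_field, 'v::ab_group_add) graded_space \<Rightarrow> ('k, 'v list) tensor set" where
  "symmetric_algebra V = symmetrize V ` tensor_algebra V"

definition sym_mult ::
    "('k::real_normed_field, 'v::ab_group_add) graded_space \<Rightarrow> ('k, 'v list \<times> 'v list) tensor \<Rightarrow>
     ('k, 'v list) tensor" where
  "sym_mult V t = symmetrize V (lin_extend (\<lambda>(xs, ys). pure V (xs @ ys)) t)"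

text \<open>The symmetric product \<open>v\<^sub>1 \<cdots> v\<^sub>n\<close> of vectors.\<close>

definition sym_prod ::
    "('k::real_normed_field, 'v::ab_group_add) graded_space \<Rightarrow> 'v list \<Rightarrow> ('k, 'v list) tensor" where
  "sym_prod V xs = symmetrize V (pure V xs)"


section \<open>The star product\<close>

definition omit :: "nat \<Rightarrow> 'a list \<Rightarrow> 'a list" where
  "omit k xs = take k xs @ drop (Suc k) xs"

text \<open>The sign picked up by contracting homogeneous factors of parities \<open>d\<close> and \<open>e\<close>.\<close>

definition contraction_sign :: "bool list \<Rightarrow> nat \<Rightarrow> bool list \<Rightarrow> nat \<Rightarrow> 'k::ring_1" where
  "contraction_sign d k e l =
     (-1) ^ (of_bool (d ! k) * (\<Sum>i\<in>{k<..<length d}. of_bool (d ! i)) +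
             of_bool (e ! l) * (\<Sum>j<l. of_bool (e ! j)))"

text \<open>
  The contraction is defined on the tensor product of the tensor algebra with itself. It
  restricts to symmetric tensors, where it is given by the usual formula for symmetric
  products of homogeneous vectors: see \<open>contraction_sym_prod\<close> below.
\<close>

definition contraction ::
    "('k::real_normed_field, 'v::ab_group_add) graded_space \<Rightarrow> ('k, 'v list \<times> 'v list) tensor \<Rightarrow>
     ('k, 'v list \<times> 'v list) tensor" where
  "contraction V = lin_extend (\<lambda>(xs, ys).
     \<Sum>d\<in>parities (length xs). \<Sum>e\<in>parities (length ys).
     \<Sum>k<length xs. \<Sum>l<length ys.
       tscale (contraction_sign d k e l *
               form V (components V d xs ! k) (components V e ys ! l))
         (pure2 V (omit k (components V d xs)) (omit l (components V e ys))))"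

text \<open>The sum is finite, as each contraction lowers both degrees.\<close>

definition star ::
    "('k::real_normed_field, 'v::ab_group_add) graded_space \<Rightarrow> 'k \<Rightarrow>
     ('k, 'v list) tensor \<Rightarrow> ('k, 'v list) tensor \<Rightarrow> ('k, 'v list) tensor" where
  "star V z a b =
     (\<Sum>k | (contraction V ^^ k) (tensor_pair V a b) \<noteq> 0.
        tscale (z ^ k / fact k) (sym_mult V ((contraction V ^^ k) (tensor_pair V a b))))"


section \<open>Algebras with a uniform structure and their completions\<close>

text \<open>
  The topology and the uniform structure are given by a family of pseudometrics; for a locally
  convex topology these are the \<open>\<lambda>x y. p (x - y)\<close> for a defining family of seminorms \<open>p\<close>.
\<close>

record ('k, 'a) gauged_algebra = "('k, 'a) module" +
  gauge :: "('a \<Rightarrow> 'a \<Rightarrow> real) set"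

definition gauge_topology :: "('k, 'a) gauged_algebra \<Rightarrow> 'a topology" where
  "gauge_topology M = topology_generated_by
     {{y \<in> carrier M. d x y < \<epsilon>} | d x \<epsilon>. d \<in> gauge M \<and> x \<in> carrier M \<and> 0 < \<epsilon>}"

definition continuous_unital_hom ::
    "('k, 'a) gauged_algebra \<Rightarrow> ('k, 'b) gauged_algebra \<Rightarrow> ('a \<Rightarrow> 'b) \<Rightarrow> bool" where
  "continuous_unital_hom M N h \<longleftrightarrow>
     h \<in> ring_hom M N \<and>
     (\<forall>c. \<forall>x\<in>carrier M. h (c \<odot>\<^bsub>M\<^esub> x) = c \<odot>\<^bsub>N\<^esub> h x) \<and>
     continuous_map (gauge_topology M) (gauge_topology N) h"

text \<open>
  The Hausdorff completion is the set of Cauchy filters modulo equivalence. Points are embedded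
  as constant Cauchy filters, and maps (in particular the algebraic operations) are
  extended by taking images of Cauchy filters.
\<close>

definition close_filters :: "('k, 'a) gauged_algebra \<Rightarrow> 'a filter \<Rightarrow> 'a filter \<Rightarrow> bool" where
  "close_filters M F G \<longleftrightarrow>
     (\<forall>d\<in>gauge M. \<forall>\<epsilon>>0. \<forall>\<^sub>F (x, y) in F \<times>\<^sub>F G. d x y < \<epsilon>)"

definition cauchy_filters :: "('k, 'a) gauged_algebra \<Rightarrow> 'a filter set" where
  "cauchy_filters M = {F. F \<noteq> bot \<and> F \<le> principal (carrier M) \<and> close_filters M F F}"

definition cauchy_equiv :: "('k, 'a) gauged_algebra \<Rightarrow> 'a filter rel" where
  "cauchy_equiv M =
     {(F, G). F \<in> cauchy_filters M \<and> G \<in> cauchy_filters M \<and> close_filters M F G}"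

definition cauchy_class :: "('k, 'a) gauged_algebra \<Rightarrow> 'a filter \<Rightarrow> 'a filter set" where
  "cauchy_class M F = cauchy_equiv M `` {F}"

definition completion_embed :: "('k, 'a) gauged_algebra \<Rightarrow> 'a \<Rightarrow> 'a filter set" where
  "completion_embed M x = cauchy_class M (principal {x})"

definition completion_map ::
    "('k, 'b) gauged_algebra \<Rightarrow> ('a \<Rightarrow> 'b) \<Rightarrow> 'a filter set \<Rightarrow> 'b filter set" where
  "completion_map N h X = (\<Union>F\<in>X. cauchy_class N (filtermap h F))"

definition completion_map2 ::
    "('k, 'b) gauged_algebra \<Rightarrow> ('a \<Rightarrow> 'a \<Rightarrow> 'b) \<Rightarrow>
     'a filter set \<Rightarrow> 'a filter set \<Rightarrow> 'b filter set" where
  "completion_map2 N h X Y =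
     (\<Union>F\<in>X. \<Union>G\<in>Y. cauchy_class N (filtermap (\<lambda>(x, y). h x y) (F \<times>\<^sub>F G)))"

definition completion_dist ::
    "('a \<Rightarrow> 'a \<Rightarrow> real) \<Rightarrow> 'a filter set \<Rightarrow> 'a filter set \<Rightarrow> real" where
  "completion_dist d X Y =
     (THE r. \<forall>F\<in>X. \<forall>G\<in>Y. ((\<lambda>(x, y). d x y) \<longlongrightarrow> r) (F \<times>\<^sub>F G))"

definition gauge_completion :: "('k, 'a) gauged_algebra \<Rightarrow> ('k, 'a filter set) gauged_algebra" where
  "gauge_completion M =
     \<lparr>carrier = cauchy_filters M // cauchy_equiv M,
      mult = completion_map2 M (mult M),
      one = completion_embed M (one M),
      zero = completion_embed M (zero M),
      add = completion_map2 M (add M),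
      smult = (\<lambda>c. completion_map M (Module.smult M c)),
      gauge = completion_dist ` gauge M\<rparr>"


section \<open>The Weyl algebra\<close>

text \<open>
  The projective seminorm of degree \<open>n\<close>. Because of the scalar coefficients in the
  representations, it is the absolute value for \<open>n = 0\<close>.
\<close>

definition projective_seminorm ::
    "('k::real_normed_field, 'v::ab_group_add) graded_space \<Rightarrow> ('v \<Rightarrow> real) \<Rightarrow> nat \<Rightarrow>
     ('k, 'v list) tensor \<Rightarrow> real" where
  "projective_seminorm V p n t =
     Inf {(\<Sum>(c, xs)\<leftarrow>L. norm c * prod_list (map p xs)) | L.
            (\<forall>(c, xs)\<in>set L. length xs = n) \<and> t = (\<Sum>(c, xs)\<leftarrow>L. tscale c (pure V xs))}"

definition weyl_seminorm ::
    "('k::real_normed_field, 'v::ab_group_add) graded_space \<Rightarrow> real \<Rightarrow> ('v \<Rightarrow> real) \<Rightarrow>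
     ('k, 'v list) tensor \<Rightarrow> real" where
  "weyl_seminorm V R p t =
     (\<Sum>n | degree_part V n t \<noteq> 0. projective_seminorm V p n (degree_part V n t) * fact n powr R)"

definition weyl_algebra ::
    "('k::real_normed_field, 'v::{topological_ab_group_add, t2_space}) graded_space \<Rightarrow> real \<Rightarrow> 'k \<Rightarrow>
     ('k, ('k, 'v list) tensor) gauged_algebra" where
  "weyl_algebra V R z =
     \<lparr>carrier = symmetric_algebra V,
      mult = star V z,
      one = pure V [],
      zero = 0,
      add = (+),
      smult = tscale,
      gauge = {\<lambda>a b. weyl_seminorm V R p (a - b) | p. continuous_seminorm V p}\<rparr>"

definition induced_map ::
    "('k::real_normed_field, 'w::ab_group_add) graded_space \<Rightarrow> ('v \<Rightarrow> 'w) \<Rightarrow>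
     ('k, 'v list) tensor \<Rightarrow> ('k, 'w list) tensor" where
  "induced_map W A = lin_extend (\<lambda>xs. pure W (map A xs))"


section \<open>The contraction on symmetric products of homogeneous vectors\<close>

subsection \<open>Removing one entry of a permutation\<close>

definition skip :: "nat \<Rightarrow> nat \<Rightarrow> nat" where
  "skip k i = (if i < k then i else Suc i)"

definition unskip :: "nat \<Rightarrow> nat \<Rightarrow> nat" where
  "unskip k i = (if i \<le> k then i else i - 1)"

definition del_perm :: "nat \<Rightarrow> (nat \<Rightarrow> nat) \<Rightarrow> nat \<Rightarrow> nat" where
  "del_perm j \<sigma> = (\<lambda>i. unskip (\<sigma> j) (\<sigma> (skip j i)))"

definition ins_perm :: "nat \<Rightarrow> nat \<Rightarrow> (nat \<Rightarrow> nat) \<Rightarrow> nat \<Rightarrow> nat" where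
  "ins_perm k j \<tau> = (\<lambda>i. if i = j then k else skip k (\<tau> (unskip j i)))"

lemma unskip_skip [simp]: "unskip k (skip k i) = i"
  by (auto simp: skip_def unskip_def)

lemma skip_unskip: "i \<noteq> k \<Longrightarrow> skip k (unskip k i) = i"
  by (auto simp: skip_def unskip_def)

lemma skip_neq [simp]: "skip k i \<noteq> k" "k \<noteq> skip k i"
  by (auto simp: skip_def)

lemma skip_less_iff [simp]: "skip k i < skip k j \<longleftrightarrow> i < j"
  by (auto simp: skip_def)

lemma skip_eq_iff [simp]: "skip k i = skip k j \<longleftrightarrow> i = j"
  by (auto simp: skip_def split: if_splits)

lemma skip_less: "k < n \<Longrightarrow> skip k i < n \<longleftrightarrow> i < n - 1"
  by (auto simp: skip_def)

lemma length_omit: "k < length xs \<Longrightarrow> length (omit k xs) = length xs - 1"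
  by (simp add: omit_def min_def)

lemma nth_omit: "k < length xs \<Longrightarrow> i < length xs - 1 \<Longrightarrow> omit k xs ! i = xs ! skip k i"
  by (auto simp: omit_def skip_def nth_append min_def)

lemma permutes_less: "\<sigma> permutes {..<n} \<Longrightarrow> \<sigma> i < n \<longleftrightarrow> i < n"
  using permutes_in_image[of \<sigma> "{..<n}" i] by simp

lemma permutes_eq_iff: "\<sigma> permutes S \<Longrightarrow> \<sigma> i = \<sigma> j \<longleftrightarrow> i = j"
  using permutes_inj[of \<sigma> S] by (auto dest: injD)

lemma skip_del_perm:
  assumes "\<sigma> permutes {..<n}"
  shows "skip (\<sigma> j) (del_perm j \<sigma> i) = \<sigma> (skip j i)"
  unfolding del_perm_def by (rule skip_unskip) (simp add: permutes_eq_iff[OF assms])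

lemma permutes_if_inverse:
  fixes p :: "nat \<Rightarrow> nat"
  assumes "\<And>i. i \<ge> m \<Longrightarrow> p i = i" "\<And>i. q (p i) = i" "\<And>i. p (q i) = i"
  shows "p permutes {..<m}"
  unfolding permutes_def using assms by (metis lessThan_iff not_less)

lemma del_perm_permutes:
  assumes "\<sigma> permutes {..<n}" "j < n"
  shows "del_perm j \<sigma> permutes {..<n - 1}"
proof -
  define \<pi> where "\<pi> = inv_into UNIV \<sigma>"
  have r: "\<pi> permutes {..<n}" unfolding \<pi>_def by (rule permutes_inv[OF assms(1)])
  have rs: "\<pi> (\<sigma> i) = i" "\<sigma> (\<pi> i) = i" for i
    unfolding \<pi>_def using permutes_inverses[OF assms(1)] by auto
  show ?thesis
  proof (rule permutes_if_inverse[where q = "del_perm (\<sigma> j) \<pi>"])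
    fix i
    show "del_perm (\<sigma> j) \<pi> (del_perm j \<sigma> i) = i"
      by (simp add: del_perm_def[of "\<sigma> j"] skip_del_perm[OF assms(1)] rs)
    show "del_perm j \<sigma> (del_perm (\<sigma> j) \<pi> i) = i"
      using skip_del_perm[OF r, of "\<sigma> j" i] by (simp add: del_perm_def[of j] rs)
    assume "n - 1 \<le> i"
    with assms(2) have "skip j i = Suc i" "n \<le> Suc i" by (auto simp: skip_def)
    moreover have "\<sigma> j < n" using assms by (simp add: permutes_less)
    moreover have "\<sigma> (Suc i) = Suc i"
      using permutes_not_in[OF assms(1)] \<open>n \<le> Suc i\<close> by simp
    ultimately show "del_perm j \<sigma> i = i"
      by (auto simp: del_perm_def unskip_def)
  qed
qed

lemma ins_perm_permutes:
  assumes "\<tau> permutes {..<n - 1}" "j < n" "k < n"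
  shows "ins_perm k j \<tau> permutes {..<n}"
proof -
  define \<pi> where "\<pi> = inv_into UNIV \<tau>"
  have r: "\<pi> (\<tau> i) = i" "\<tau> (\<pi> i) = i" for i
    unfolding \<pi>_def using permutes_inverses[OF assms(1)] by auto
  show ?thesis
  proof (rule permutes_if_inverse[where q = "ins_perm j k \<pi>"])
    fix i
    show "ins_perm j k \<pi> (ins_perm k j \<tau> i) = i"
      by (auto simp: ins_perm_def r skip_unskip)
    show "ins_perm k j \<tau> (ins_perm j k \<pi> i) = i"
      by (auto simp: ins_perm_def r skip_unskip)
    assume i: "n \<le> i"
    with assms have "\<tau> (i - 1) = i - 1"
      using permutes_not_in[OF assms(1), of "i - 1"] by simp
    with i assms show "ins_perm k j \<tau> i = i"
      by (auto simp: ins_perm_def unskip_def skip_def)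
  qed
qed

lemma ins_del_perm:
  assumes "\<sigma> permutes {..<n}"
  shows "ins_perm (\<sigma> j) j (del_perm j \<sigma>) = \<sigma>"
  by (auto simp: fun_eq_iff ins_perm_def skip_del_perm[OF assms] skip_unskip)

lemma del_ins_perm: "del_perm j (ins_perm k j \<tau>) = \<tau>" "ins_perm k j \<tau> j = k"
  by (auto simp: fun_eq_iff ins_perm_def del_perm_def)

lemma omit_permute_list:
  assumes s: "\<sigma> permutes {..<length xs}" and j: "j < length xs"
  shows "omit j (permute_list \<sigma> xs) = permute_list (del_perm j \<sigma>) (omit (\<sigma> j) xs)"
proof (rule nth_equalityI)
  have sj: "\<sigma> j < length xs" using s j by (simp add: permutes_less)
  show "length (omit j (permute_list \<sigma> xs)) =
      length (permute_list (del_perm j \<sigma>) (omit (\<sigma> j) xs))"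
    using j sj by (simp add: length_omit)
  fix i assume "i < length (omit j (permute_list \<sigma> xs))"
  hence i: "i < length xs - 1" using j by (simp add: length_omit)
  have d: "del_perm j \<sigma> permutes {..<length xs - 1}"
    by (rule del_perm_permutes[OF s j])
  have sk: "skip j i < length xs" using i j by (simp add: skip_less)
  have "omit j (permute_list \<sigma> xs) ! i = xs ! \<sigma> (skip j i)"
    using i j sk by (simp add: nth_omit permute_list_nth[OF s])
  also have "\<dots> = permute_list (del_perm j \<sigma>) (omit (\<sigma> j) xs) ! i"
    using i sj d
    by (simp add: permute_list_nth length_omit nth_omit permutes_less skip_del_perm[OF s])
  finally show "omit j (permute_list \<sigma> xs) ! i =
      permute_list (del_perm j \<sigma>) (omit (\<sigma> j) xs) ! i" .
qed

lemma card_koszul_split: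
  assumes s: "\<sigma> permutes {..<length d}" and j: "j < length d"
  defines "n \<equiv> length d"
  shows "card {(a, b). a < b \<and> b < n \<and> \<sigma> a > \<sigma> b \<and> d ! \<sigma> a \<and> d ! \<sigma> b} =
    card {(a, b). a < b \<and> b < n - 1 \<and> del_perm j \<sigma> a > del_perm j \<sigma> b \<and>
            omit (\<sigma> j) d ! del_perm j \<sigma> a \<and> omit (\<sigma> j) d ! del_perm j \<sigma> b} +
    of_bool (d ! \<sigma> j) * (card {a. a < j \<and> \<sigma> a > \<sigma> j \<and> d ! \<sigma> a} +
      card {b. j < b \<and> b < n \<and> \<sigma> b < \<sigma> j \<and> d ! \<sigma> b})"
proof -
  let ?I = "{(a, b). a < b \<and> b < n \<and> \<sigma> a > \<sigma> b \<and> d ! \<sigma> a \<and> d ! \<sigma> b}"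
  let ?J = "{(a, b). a < b \<and> b < n - 1 \<and> del_perm j \<sigma> a > del_perm j \<sigma> b \<and>
            omit (\<sigma> j) d ! del_perm j \<sigma> a \<and> omit (\<sigma> j) d ! del_perm j \<sigma> b}"
  let ?A = "{a. a < j \<and> \<sigma> a > \<sigma> j \<and> d ! \<sigma> a}"
  let ?B = "{b. j < b \<and> b < n \<and> \<sigma> b < \<sigma> j \<and> d ! \<sigma> b}"
  have sj: "\<sigma> j < n" using s j by (simp add: n_def permutes_less)
  have jn: "j < n" using j by (simp add: n_def)
  have fin: "finite ?I" by (rule finite_subset[of _ "{..<n} \<times> {..<n}"]) auto
  have nth: "omit (\<sigma> j) d ! del_perm j \<sigma> a = d ! \<sigma> (skip j a)" if "a < n - 1" for a
    using that sj del_perm_permutes[OF s j]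
    by (simp add: nth_omit permutes_less n_def skip_del_perm[OF s])
  have less: "del_perm j \<sigma> a > del_perm j \<sigma> b \<longleftrightarrow> \<sigma> (skip j a) > \<sigma> (skip j b)" for a b
    by (metis skip_del_perm[OF s] skip_less_iff)
  have J: "map_prod (skip j) (skip j) ` ?J = {(a, b) \<in> ?I. a \<noteq> j \<and> b \<noteq> j}" (is "?L = ?R")
  proof (intro subset_antisym subsetI)
    fix x assume "x \<in> ?L"
    thus "x \<in> ?R" using jn by (auto simp: nth less skip_less)
  next
    fix x assume "x \<in> ?R"
    then obtain a b where x: "x = (a, b)" "(a, b) \<in> ?I" "a \<noteq> j" "b \<noteq> j" by auto
    define a' b' where "a' = unskip j a" and "b' = unskip j b"
    have ab: "a = skip j a'" "b = skip j b'" using x by (auto simp: a'_def b'_def skip_unskip)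
    have "(a', b') \<in> ?J" using x(2) jn unfolding ab by (auto simp: nth less skip_less)
    thus "x \<in> ?L" unfolding x ab by (auto simp: image_iff map_prod_def)
  qed
  have inj: "inj_on (map_prod (skip j) (skip j)) ?J" by (auto simp: inj_on_def)
  have cJ: "card ?J = card {(a, b) \<in> ?I. a \<noteq> j \<and> b \<noteq> j}"
    using card_image[OF inj] unfolding J by simp
  let ?I1 = "{(a, b) \<in> ?I. a \<noteq> j \<and> b \<noteq> j}" and ?I2 = "{(a, b) \<in> ?I. a = j \<or> b = j}"
  have "card ?I = card (?I1 \<union> ?I2)" by (rule arg_cong[where f = card]) blast
  also have "\<dots> = card ?I1 + card ?I2"
  proof (rule card_Un_disjoint)
    show "finite ?I1" "finite ?I2" by (rule finite_subset[OF _ fin], blast)+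
  qed blast
  finally have "card ?I = card ?I1 + card ?I2" .
  moreover have "card {(a, b) \<in> ?I. a = j \<or> b = j} = of_bool (d ! \<sigma> j) * (card ?A + card ?B)"
  proof (cases "d ! \<sigma> j")
    case True
    have "{(a, b) \<in> ?I. a = j \<or> b = j} = (\<lambda>a. (a, j)) ` ?A \<union> (\<lambda>b. (j, b)) ` ?B"
      using True jn by auto
    moreover have "card \<dots> = card ?A + card ?B"
    proof (subst card_Un_disjoint)
      have "finite ?A" "finite ?B" by (rule finite_subset[of _ "{..<n}"], use jn in auto)+
      thus "finite ((\<lambda>a. (a, j)) ` ?A)" "finite ((\<lambda>b. (j, b)) ` ?B)" by blast+
    qed (auto simp: card_image inj_on_def)
    ultimately show ?thesis using True by simp
  next
    case False
    hence *: "{(a, b) \<in> ?I. a = j \<or> b = j} = {}" by auto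
    show ?thesis unfolding * using False by simp
  qed
  ultimately show ?thesis using cJ by simp
qed

definition right_sign :: "bool list \<Rightarrow> nat \<Rightarrow> 'k::ring_1" where
  "right_sign d k = (-1) ^ (of_bool (d ! k) * (\<Sum>i\<in>{k<..<length d}. of_bool (d ! i)))"

definition left_sign :: "bool list \<Rightarrow> nat \<Rightarrow> 'k::ring_1" where
  "left_sign d k = (-1) ^ (of_bool (d ! k) * (\<Sum>i<k. of_bool (d ! i)))"

lemma contraction_sign_eq: "contraction_sign d k e l = right_sign d k * left_sign e l"
  by (simp add: contraction_sign_def right_sign_def left_sign_def power_add)

lemma card_permuted:
  assumes "\<sigma> permutes {..<n}"
  shows "card {i. i < n \<and> P (\<sigma> i)} = card {i. i < n \<and> P i}"
proof -
  have "{i. i < n \<and> P i} = \<sigma> ` {i. i < n \<and> P (\<sigma> i)}"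
  proof (intro subset_antisym subsetI)
    fix i assume "i \<in> {i. i < n \<and> P i}"
    moreover have "i = \<sigma> (inv_into UNIV \<sigma> i)" using permutes_inverses[OF assms] by simp
    ultimately show "i \<in> \<sigma> ` {i. i < n \<and> P (\<sigma> i)}"
      using permutes_less[OF assms] by (metis (mono_tags, lifting) image_eqI mem_Collect_eq)
  qed (auto simp: permutes_less[OF assms])
  moreover have "inj_on \<sigma> X" for X using permutes_inj_on[OF assms] .
  ultimately show ?thesis by (simp add: card_image)
qed

lemma sum_of_bool_card: "finite S \<Longrightarrow> (\<Sum>i\<in>S. of_bool (P i)) = card {i\<in>S. P i}"
  by (simp add: of_bool_def sum.If_cases Int_def)

lemma minus_one_power_cong:
  "even a = even b \<Longrightarrow> (-1) ^ a = ((-1) ^ b :: 'k::ring_1)"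
  by (simp add: minus_one_power_iff)

lemma koszul_right_sign:
  assumes s: "\<sigma> permutes {..<length d}" and j: "j < length d"
  shows "koszul_sign d \<sigma> * right_sign (permute_list \<sigma> d) j =
    (right_sign d (\<sigma> j) * koszul_sign (omit (\<sigma> j) d) (del_perm j \<sigma>) :: 'k::comm_ring_1)"
proof -
  let ?n = "length d"
  have sj: "\<sigma> j < ?n" using s j by (simp add: permutes_less)
  let ?A = "{a. a < j \<and> \<sigma> a > \<sigma> j \<and> d ! \<sigma> a}"
  let ?B = "{b. j < b \<and> b < ?n \<and> \<sigma> b < \<sigma> j \<and> d ! \<sigma> b}"
  have ne: "i < j \<Longrightarrow> \<sigma> i < \<sigma> j \<or> \<sigma> j < \<sigma> i" "j < i \<Longrightarrow> \<sigma> i < \<sigma> j \<or> \<sigma> j < \<sigma> i"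
    "\<sigma> i < \<sigma> j \<Longrightarrow> i < j \<or> j < i" "\<sigma> j < \<sigma> i \<Longrightarrow> i < j \<or> j < i" for i
    using permutes_eq_iff[OF s, of i j] by (metis nat_neq_iff)+
  let ?D = "{b. j < b \<and> b < ?n \<and> \<sigma> b > \<sigma> j \<and> d ! \<sigma> b}"
  have 1: "(\<Sum>i\<in>{j<..<?n}. of_bool (permute_list \<sigma> d ! i)) = card ?B + card ?D"
  proof -
    have "(\<Sum>i\<in>{j<..<?n}. of_bool (permute_list \<sigma> d ! i)) =
        (\<Sum>i\<in>{j<..<?n}. of_bool (d ! \<sigma> i))"
      by (rule sum.cong) (auto simp: permute_list_nth[OF s])
    also have "\<dots> = card {i\<in>{j<..<?n}. d ! \<sigma> i}" by (rule sum_of_bool_card) simp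
    also have "{i\<in>{j<..<?n}. d ! \<sigma> i} = ?B \<union> ?D"
      by (auto dest: ne)
    also have "card (?B \<union> ?D) = card ?B + card ?D"
      by (rule card_Un_disjoint) auto
    finally show ?thesis .
  qed
  have 2: "(\<Sum>i\<in>{\<sigma> j<..<?n}. of_bool (d ! i)) = card ?A + card ?D"
  proof -
    have "(\<Sum>i\<in>{\<sigma> j<..<?n}. of_bool (d ! i)) = card {i. i < ?n \<and> \<sigma> j < i \<and> d ! i}"
      by (subst sum_of_bool_card) (auto intro!: arg_cong[where f = card])
    also have "\<dots> = card {i. i < ?n \<and> \<sigma> j < \<sigma> i \<and> d ! \<sigma> i}"
      by (rule card_permuted[OF s, symmetric])
    also have "{i. i < ?n \<and> \<sigma> j < \<sigma> i \<and> d ! \<sigma> i} = ?A \<union> ?D"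
      using j by (auto dest: ne)
    also have "card (?A \<union> ?D) = card ?A + card ?D"
      by (rule card_Un_disjoint) auto
    finally show ?thesis .
  qed
  show ?thesis
    unfolding koszul_sign_def right_sign_def power_add[symmetric]
    by (rule minus_one_power_cong)
      (use 1 2 j sj in \<open>auto simp: card_koszul_split[OF s j] length_omit permute_list_nth[OF s]\<close>)
qed

lemma koszul_left_sign:
  assumes s: "\<sigma> permutes {..<length d}" and j: "j < length d"
  shows "koszul_sign d \<sigma> * left_sign (permute_list \<sigma> d) j =
    (left_sign d (\<sigma> j) * koszul_sign (omit (\<sigma> j) d) (del_perm j \<sigma>) :: 'k::comm_ring_1)"
proof -
  let ?n = "length d"
  have sj: "\<sigma> j < ?n" using s j by (simp add: permutes_less)
  let ?A = "{a. a < j \<and> \<sigma> a > \<sigma> j \<and> d ! \<sigma> a}"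
  let ?B = "{b. j < b \<and> b < ?n \<and> \<sigma> b < \<sigma> j \<and> d ! \<sigma> b}"
  have ne: "i < j \<Longrightarrow> \<sigma> i < \<sigma> j \<or> \<sigma> j < \<sigma> i" "j < i \<Longrightarrow> \<sigma> i < \<sigma> j \<or> \<sigma> j < \<sigma> i"
    "\<sigma> i < \<sigma> j \<Longrightarrow> i < j \<or> j < i" "\<sigma> j < \<sigma> i \<Longrightarrow> i < j \<or> j < i" for i
    using permutes_eq_iff[OF s, of i j] by (metis nat_neq_iff)+
  let ?E = "{a. a < j \<and> \<sigma> a < \<sigma> j \<and> d ! \<sigma> a}"
  have 1: "(\<Sum>i<j. of_bool (permute_list \<sigma> d ! i)) = card ?A + card ?E"
  proof -
    have "(\<Sum>i<j. of_bool (permute_list \<sigma> d ! i)) = (\<Sum>i<j. of_bool (d ! \<sigma> i))"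
      by (rule sum.cong) (use j in \<open>auto simp: permute_list_nth[OF s]\<close>)
    also have "\<dots> = card {i\<in>{..<j}. d ! \<sigma> i}" by (rule sum_of_bool_card) simp
    also have "{i\<in>{..<j}. d ! \<sigma> i} = ?A \<union> ?E"
      by (auto dest: ne)
    also have "card (?A \<union> ?E) = card ?A + card ?E"
      by (rule card_Un_disjoint) auto
    finally show ?thesis .
  qed
  have 2: "(\<Sum>i<\<sigma> j. of_bool (d ! i)) = card ?B + card ?E"
  proof -
    have "(\<Sum>i<\<sigma> j. of_bool (d ! i)) = card {i. i < ?n \<and> i < \<sigma> j \<and> d ! i}"
      using sj by (subst sum_of_bool_card) (auto intro!: arg_cong[where f = card])
    also have "\<dots> = card {i. i < ?n \<and> \<sigma> i < \<sigma> j \<and> d ! \<sigma> i}"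
      by (rule card_permuted[OF s, symmetric])
    also have "{i. i < ?n \<and> \<sigma> i < \<sigma> j \<and> d ! \<sigma> i} = ?B \<union> ?E"
      using j by (auto dest: ne)
    also have "card (?B \<union> ?E) = card ?B + card ?E"
      by (rule card_Un_disjoint) auto
    finally show ?thesis .
  qed
  show ?thesis
    unfolding koszul_sign_def left_sign_def power_add[symmetric]
    by (rule minus_one_power_cong)
      (use 1 2 j sj in \<open>auto simp: card_koszul_split[OF s j] length_omit permute_list_nth[OF s]\<close>)
qed

lemma sum_permutes_remove:
  fixes s :: "bool list \<Rightarrow> nat \<Rightarrow> 'k::field_char_0"
  assumes sign: "\<And>\<sigma> j. \<sigma> permutes {..<length d} \<Longrightarrow> j < length d \<Longrightarrow>
      koszul_sign d \<sigma> * s (permute_list \<sigma> d) j =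
      s d (\<sigma> j) * koszul_sign (omit (\<sigma> j) d) (del_perm j \<sigma>)"
    and len: "length vs = length d"
  defines "n \<equiv> length d"
  shows "(\<Sum>\<sigma> | \<sigma> permutes {..<n}. koszul_sign d \<sigma> *
      (\<Sum>j<n. s (permute_list \<sigma> d) j * G (permute_list \<sigma> vs ! j) (omit j (permute_list \<sigma> vs))))
      / fact n =
    (\<Sum>k<n. s d k * ((\<Sum>\<tau> | \<tau> permutes {..<n - 1}.
      koszul_sign (omit k d) \<tau> * G (vs ! k) (permute_list \<tau> (omit k vs))) / fact (n - 1)))"
proof -
  let ?H = "\<lambda>k \<tau>. s d k * koszul_sign (omit k d) \<tau> * G (vs ! k) (permute_list \<tau> (omit k vs))"
  let ?P = "\<lambda>m. {\<sigma>. \<sigma> permutes {..<m::nat}}"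
  have fin: "finite (?P m)" for m by (simp add: finite_permutations)
  have "(\<Sum>\<sigma>\<in>?P n. koszul_sign d \<sigma> *
      (\<Sum>j<n. s (permute_list \<sigma> d) j * G (permute_list \<sigma> vs ! j) (omit j (permute_list \<sigma> vs)))) =
    (\<Sum>\<sigma>\<in>?P n. \<Sum>j<n. ?H (\<sigma> j) (del_perm j \<sigma>))"
    unfolding sum_distrib_left
  proof (intro sum.cong refl)
    fix \<sigma> j assume *: "\<sigma> \<in> ?P n" "j \<in> {..<n}"
    hence s': "\<sigma> permutes {..<length d}" "j < length d" by (auto simp: n_def)
    hence s'': "\<sigma> permutes {..<length vs}" "j < length vs" using len by auto
    show "koszul_sign d \<sigma> * (s (permute_list \<sigma> d) j *
        G (permute_list \<sigma> vs ! j) (omit j (permute_list \<sigma> vs))) = ?H (\<sigma> j) (del_perm j \<sigma>)"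
      using sign[OF s'] s''
      by (simp add: omit_permute_list permute_list_nth flip: mult.assoc)
  qed
  also have "\<dots> = (\<Sum>(\<sigma>, j)\<in>?P n \<times> {..<n}. ?H (\<sigma> j) (del_perm j \<sigma>))"
    by (simp add: sum.cartesian_product)
  also have "\<dots> = (\<Sum>(k, \<tau>, j)\<in>(SIGMA k:{..<n}. ?P (n - 1) \<times> {..<n}). ?H k \<tau>)"
  proof (rule sum.reindex_bij_witness[where i = "\<lambda>(k, \<tau>, j). (ins_perm k j \<tau>, j)"
        and j = "\<lambda>(\<sigma>, j). (\<sigma> j, del_perm j \<sigma>, j)"], goal_cases)
    case (1 a) thus ?case by (auto simp: ins_del_perm)
  next
    case (2 a) thus ?case by (auto simp: del_perm_permutes[unfolded One_nat_def] permutes_less)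
  next
    case (3 b) thus ?case by (auto simp: del_ins_perm)
  next
    case (4 b) thus ?case by (auto intro!: ins_perm_permutes)
  next
    case (5 a) thus ?case by auto
  qed
  also have "\<dots> = (\<Sum>k<n. \<Sum>\<tau>\<in>?P (n - 1). \<Sum>j<n. ?H k \<tau>)"
    by (simp only: sum.cartesian_product)
  also have "\<dots> = of_nat n * (\<Sum>k<n. \<Sum>\<tau>\<in>?P (n - 1). ?H k \<tau>)"
    by (simp add: sum_distrib_left)
  finally have eq: "(\<Sum>\<sigma>\<in>?P n. koszul_sign d \<sigma> *
      (\<Sum>j<n. s (permute_list \<sigma> d) j * G (permute_list \<sigma> vs ! j) (omit j (permute_list \<sigma> vs)))) =
      of_nat n * (\<Sum>k<n. \<Sum>\<tau>\<in>?P (n - 1). ?H k \<tau>)" .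
  show ?thesis
  proof (cases n)
    case 0
    thus ?thesis unfolding eq by simp
  next
    case (Suc m)
    have "of_nat n * x / fact n = x / fact (n - 1)" for x :: 'k
    proof -
      have "fact n = (of_nat n * fact m :: 'k)" unfolding Suc by simp
      moreover have "of_nat n \<noteq> (0 :: 'k)" unfolding Suc by (simp del: of_nat_Suc)
      ultimately show ?thesis unfolding Suc by simp
    qed
    thus ?thesis unfolding eq
      by (simp add: sum_divide_distrib sum_distrib_left mult.assoc)
  qed
qed


subsection \<open>Multilinear forms and symmetric products\<close>

context poisson_space
begin

definition multilinear_on :: "nat \<Rightarrow> ('v list \<Rightarrow> 'k) \<Rightarrow> bool" where
  "multilinear_on n f \<longleftrightarrow>
     (\<forall>xs i. length xs = n \<longrightarrow> i < n \<longrightarrow> Vector_Spaces.linear (scl V) (*) (\<lambda>v. f (xs[i := v])))"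

lemma linear_form_iff:
  fixes g :: "'v \<Rightarrow> 'k"
  shows "Vector_Spaces.linear (scl V) (*) g \<longleftrightarrow>
    (\<forall>v w. g (v + w) = g v + g w) \<and> (\<forall>c v. g (scl V c v) = c * g v)"
  by (simp add: Vector_Spaces.linear_iff vector_space_axioms vector_space_over_itself.vector_space_axioms)

lemma multilinear_form_iff: "multilinear_form V f \<longleftrightarrow> (\<forall>n. multilinear_on n f)"
proof
  assume f: "multilinear_form V f"
  show "\<forall>n. multilinear_on n f"
    unfolding multilinear_on_def
  proof (intro allI impI)
    fix n :: nat and xs :: "'v list" and i assume "length xs = n" "i < n"
    thus "Vector_Spaces.linear (scl V) (*) (\<lambda>v. f (xs[i := v]))"
      using f by (simp add: multilinear_form_def upd_conv_take_nth_drop)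
  qed
next
  assume f: "\<forall>n. multilinear_on n f"
  show "multilinear_form V f"
    unfolding multilinear_form_def
  proof (intro allI)
    fix us ws :: "'v list"
    have "length us < length (us @ 0 # ws)" by simp
    with f have "Vector_Spaces.linear (scl V) (*) (\<lambda>v. f ((us @ 0 # ws)[length us := v]))"
      unfolding multilinear_on_def by blast
    thus "Vector_Spaces.linear (scl V) (*) (\<lambda>v. f (us @ v # ws))" by simp
  qed
qed

lemma multilinear_on_cong:
  assumes "multilinear_on n g" "\<And>xs. length xs = n \<Longrightarrow> f xs = g xs"
  shows "multilinear_on n f"
  using assms unfolding multilinear_on_def by simp

lemma multilinear_on_sum:
  assumes "\<And>x. x \<in> X \<Longrightarrow> multilinear_on n (g x)"
  shows "multilinear_on n (\<lambda>xs. \<Sum>x\<in>X. g x xs)"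
  using assms unfolding multilinear_on_def linear_form_iff
  by (auto simp: sum.distrib sum_distrib_left)

lemma multilinear_on_cmult: "multilinear_on n g \<Longrightarrow> multilinear_on n (\<lambda>xs. c * g xs)"
  unfolding multilinear_on_def linear_form_iff by (auto simp: algebra_simps)

lemma multilinear_on_0: "multilinear_on n (\<lambda>xs. 0)"
  unfolding multilinear_on_def linear_form_iff by simp

lemma multilinear_on_zero_entry:
  assumes "multilinear_on n f" "length xs = n" "i < n" "xs ! i = 0"
  shows "f xs = 0"
proof -
  have "f (xs[i := scl V 0 0]) = 0 * f (xs[i := 0])"
    using assms unfolding multilinear_on_def linear_form_iff by blast
  with assms show ?thesis by (metis list_update_id mult_zero_left scale_zero_right)
qed

lemma part_add: "part V e (v + w) = part V e v + part V e w"
  and part_scl: "part V e (scl V c v) = scl V c (part V e v)"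
  using part_linear[of e] by (simp_all add: Vector_Spaces.linear_iff)

lemma components_update:
  "length d = length xs \<Longrightarrow> i < length xs \<Longrightarrow>
     components V d (xs[i := v]) = (components V d xs)[i := part V (d ! i) v]"
  unfolding components_def by (intro nth_equalityI) (auto simp: nth_list_update)

lemma length_components [simp]: "length d = length xs \<Longrightarrow> length (components V d xs) = length xs"
  by (simp add: components_def)

lemma multilinear_on_components:
  assumes "multilinear_on n f" "length d = n"
  shows "multilinear_on n (\<lambda>xs. f (components V d xs))"
  using assms unfolding multilinear_on_def linear_form_iff
  by (auto simp: components_update part_add part_scl)

lemma nth_update_iff: "xs[i := x] ! j = (if i = j \<and> i < length xs then x else xs ! j)"
  by (cases "i < length xs") (auto simp: nth_list_update list_update_beyond)

lemma unskip_eq_iff: "i \<noteq> k \<Longrightarrow> unskip k i = j \<longleftrightarrow> i = skip k j"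
  by (auto simp: skip_unskip)

lemma permute_list_update:
  assumes "\<sigma> permutes {..<length xs}" "i < length xs"
  shows "permute_list \<sigma> (xs[i := v]) = (permute_list \<sigma> xs)[inv_into UNIV \<sigma> i := v]"
  by (rule nth_equalityI)
    (use assms(2) in \<open>auto simp: permute_list_nth assms(1) nth_update_iff permutes_less[OF assms(1)]
      permutes_inverses[OF assms(1)] permutes_inv_eq[OF assms(1)]\<close>)

lemma multilinear_on_permute:
  assumes "multilinear_on n f" "\<sigma> permutes {..<n}"
  shows "multilinear_on n (\<lambda>xs. f (permute_list \<sigma> xs))"
  using assms permutes_less[OF permutes_inv[OF assms(2)]]
  unfolding multilinear_on_def by (auto simp: permute_list_update)

lemma omit_update:
  "k < length xs \<Longrightarrow> i < length xs \<Longrightarrow>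
   omit k (xs[i := v]) = (if i = k then omit k xs else (omit k xs)[unskip k i := v])"
  by (rule nth_equalityI)
    (auto simp: length_omit nth_omit nth_update_iff skip_less unskip_eq_iff)

lemma multilinear_on_contract:
  assumes f: "multilinear_on (n - 1) f" and k: "k < n"
    and \<phi>: "Vector_Spaces.linear (scl V) (*) \<phi>"
  shows "multilinear_on n (\<lambda>xs. \<phi> (xs ! k) * f (omit k xs))"
  unfolding multilinear_on_def
proof (intro allI impI)
  fix xs :: "'v list" and i assume *: "length xs = n" "i < n"
  show "Vector_Spaces.linear (scl V) (*) (\<lambda>v. \<phi> (xs[i := v] ! k) * f (omit k (xs[i := v])))"
  proof (cases "i = k")
    case True
    thus ?thesis using * \<phi> by (auto simp: linear_form_iff omit_update algebra_simps)
  next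
    case False
    hence "unskip k i < n - 1" using * k by (auto simp: unskip_def)
    thus ?thesis using * k False f
      by (simp add: linear_form_iff omit_update multilinear_on_def length_omit algebra_simps)
  qed
qed

abbreviation homogeneous_list :: "bool list \<Rightarrow> 'v list \<Rightarrow> bool" where
  "homogeneous_list d vs \<equiv> list_all2 (\<lambda>e v. v \<in> homogeneous V e) d vs"

lemma part_homogeneous:
  "v \<in> homogeneous V e \<Longrightarrow> part V e' v = (if e = e' then v else 0)"
  by (auto simp: homogeneous_def part_part)

lemma finite_parities [simp]: "finite (parities n)"
  using finite_lists_length_eq[of "UNIV :: bool set" n] by (simp add: parities_def)

lemma sum_parities_homogeneous:
  assumes vs: "homogeneous_list d vs" and n: "length d = n"
    and F: "\<And>d'. d' \<in> parities n \<Longrightarrow> multilinear_on n (F d')"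
  shows "(\<Sum>d'\<in>parities n. F d' (components V d' vs)) = F d vs"
proof -
  have len: "length vs = n" using list_all2_lengthD[OF vs] n by simp
  have "F d' (components V d' vs) = (if d' = d then F d vs else 0)" if d': "d' \<in> parities n" for d'
  proof (cases "d' = d")
    case True
    have "components V d vs = vs"
      using vs n len unfolding components_def
      by (intro nth_equalityI) (auto simp: list_all2_conv_all_nth part_homogeneous)
    thus ?thesis using True by simp
  next
    case False
    have ld: "length d' = n" using d' by (simp add: parities_def)
    then obtain i where i: "i < n" "d' ! i \<noteq> d ! i"
      using False n by (auto simp: list_eq_iff_nth_eq)
    have "components V d' vs ! i = 0"
      using i n ld len vs
      by (auto simp: components_def list_all2_conv_all_nth part_homogeneous)
    hence "F d' (components V d' vs) = 0"
      using multilinear_on_zero_entry[OF F[OF d']] i ld len by simp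
    with False show ?thesis by simp
  qed
  hence "(\<Sum>d'\<in>parities n. F d' (components V d' vs)) =
      (\<Sum>d'\<in>parities n. if d' = d then F d vs else 0)" by (intro sum.cong) auto
  also have "\<dots> = F d vs" using n by (simp add: parities_def[of n] finite_parities[unfolded parities_def])
  finally show ?thesis .
qed

lemma sum_tensor_apply: "(\<Sum>x\<in>X. T x) y = (\<Sum>x\<in>X. T x y)"
  by (induction X rule: infinite_finite_induct) auto

lemma pure_apply: "multilinear_form V f \<Longrightarrow> pure V xs f = f xs"
  and pure_apply_not: "\<not> multilinear_form V f \<Longrightarrow> pure V xs f = 0"
  by (simp_all add: pure_def)

lemma permute_tensor_homogeneous:
  assumes vs: "homogeneous_list d vs" and s: "\<sigma> permutes {..<length vs}"
  shows "permute_tensor V \<sigma> vs = tscale (koszul_sign d \<sigma>) (pure V (permute_list \<sigma> vs))"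
proof
  fix f
  have len: "length d = length vs" using list_all2_lengthD[OF vs] .
  show "permute_tensor V \<sigma> vs f = tscale (koszul_sign d \<sigma>) (pure V (permute_list \<sigma> vs)) f"
  proof (cases "multilinear_form V f")
    case True
    have "(\<Sum>d'\<in>parities (length vs). (\<lambda>xs. koszul_sign d' \<sigma> * f (permute_list \<sigma> xs)) (components V d' vs)) =
        koszul_sign d \<sigma> * f (permute_list \<sigma> vs)"
      by (rule sum_parities_homogeneous[OF vs len])
        (use True s in \<open>auto intro!: multilinear_on_cmult multilinear_on_permute simp: multilinear_form_iff\<close>)
    thus ?thesis using True
      by (simp add: permute_tensor_def sum_tensor_apply tscale_def pure_apply)
  next
    case False
    thus ?thesis by (simp add: permute_tensor_def sum_tensor_apply tscale_def pure_apply_not)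
  qed
qed

lemma multilinear_symmetrize:
  assumes "multilinear_form V f"
  shows "multilinear_form V (\<lambda>xs. 1 / fact (length xs) *
     (\<Sum>\<sigma> | \<sigma> permutes {..<length xs}. \<Sum>d\<in>parities (length xs).
        koszul_sign d \<sigma> * f (permute_list \<sigma> (components V d xs))))" (is "multilinear_form V ?g")
  unfolding multilinear_form_iff
proof
  fix n
  show "multilinear_on n ?g"
  proof (rule multilinear_on_cong)
    show "multilinear_on n (\<lambda>xs. 1 / fact n * (\<Sum>\<sigma> | \<sigma> permutes {..<n}. \<Sum>d\<in>parities n.
        koszul_sign d \<sigma> * f (permute_list \<sigma> (components V d xs))))"
    proof (intro multilinear_on_cmult multilinear_on_sum)
      fix \<sigma> d assume "\<sigma> \<in> {\<sigma>. \<sigma> permutes {..<n}}" "d \<in> parities n"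
      hence *: "\<sigma> permutes {..<n}" "length d = n" by (auto simp: parities_def)
      show "multilinear_on n (\<lambda>xs. f (permute_list \<sigma> (components V d xs)))"
        by (rule multilinear_on_components[OF multilinear_on_permute[OF _ *(1)] *(2)])
          (use assms in \<open>simp add: multilinear_form_iff\<close>)
    qed
  qed simp
qed

lemma sym_prod_apply:
  assumes vs: "homogeneous_list d vs"
  shows "sym_prod V vs f = (if multilinear_form V f
    then (\<Sum>\<sigma> | \<sigma> permutes {..<length d}. koszul_sign d \<sigma> * f (permute_list \<sigma> vs)) / fact (length d)
    else 0)"
proof -
  have len: "length d = length vs" using list_all2_lengthD[OF vs] .
  let ?g = "\<lambda>xs. tscale (1 / fact (length xs))
     (\<Sum>\<sigma> | \<sigma> permutes {..<length xs}. permute_tensor V \<sigma> xs) f"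
  have *: "?g vs = (\<Sum>\<sigma> | \<sigma> permutes {..<length d}.
      koszul_sign d \<sigma> * pure V (permute_list \<sigma> vs) f) / fact (length d)"
    by (simp add: sum_tensor_apply tscale_def permute_tensor_homogeneous[OF vs] len)
  show ?thesis
  proof (cases "multilinear_form V f")
    case True
    have "?g = (\<lambda>xs. 1 / fact (length xs) *
     (\<Sum>\<sigma> | \<sigma> permutes {..<length xs}. \<Sum>d\<in>parities (length xs).
        koszul_sign d \<sigma> * f (permute_list \<sigma> (components V d xs))))"
      using True by (simp add: fun_eq_iff sum_tensor_apply tscale_def permute_tensor_def pure_apply)
    hence "multilinear_form V ?g" using multilinear_symmetrize[OF True] by simp
    thus ?thesis using True *
      by (simp add: sym_prod_def symmetrize_def lin_extend_def pure_apply)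
  next
    case False
    hence g: "?g = (\<lambda>xs. 0)"
      by (simp add: fun_eq_iff sum_tensor_apply tscale_def permute_tensor_def pure_apply_not)
    show ?thesis unfolding sym_prod_def symmetrize_def lin_extend_def g
      using False by (simp add: pure_def)
  qed
qed

lemma multilinear_form_sum:
  "(\<And>x. x \<in> X \<Longrightarrow> multilinear_form V (g x)) \<Longrightarrow> multilinear_form V (\<lambda>xs. \<Sum>x\<in>X. g x xs)"
  by (simp add: multilinear_form_iff multilinear_on_sum)

lemma multilinear_form_cmult: "multilinear_form V g \<Longrightarrow> multilinear_form V (\<lambda>xs. c * g xs)"
  by (simp add: multilinear_form_iff multilinear_on_cmult)

lemma multilinear_form_0: "multilinear_form V (\<lambda>xs. 0)"
  by (simp add: multilinear_form_iff multilinear_on_0)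

lemma multilinear_form2_0: "multilinear_form2 V (\<lambda>xs. 0)"
  by (simp add: multilinear_form2_def multilinear_form_0)

lemma tensor_pair_sym_prod_apply:
  assumes vs: "homogeneous_list d vs" and ws: "homogeneous_list e ws"
  shows "tensor_pair V (sym_prod V vs) (sym_prod V ws) f = (if multilinear_form2 V f
    then (\<Sum>\<sigma> | \<sigma> permutes {..<length d}. koszul_sign d \<sigma> *
      ((\<Sum>\<tau> | \<tau> permutes {..<length e}. koszul_sign e \<tau> *
        f (permute_list \<sigma> vs, permute_list \<tau> ws)) / fact (length e))) / fact (length d)
    else 0)"
proof (cases "multilinear_form2 V f")
  case True
  let ?g = "\<lambda>xs. (\<Sum>\<tau> | \<tau> permutes {..<length e}.
      koszul_sign e \<tau> * f (xs, permute_list \<tau> ws)) / fact (length e)"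
  have "sym_prod V ws (\<lambda>ys. f (xs, ys)) = ?g xs" for xs
    using True by (simp add: sym_prod_apply[OF ws] multilinear_form2_def)
  hence "tensor_pair V (sym_prod V vs) (sym_prod V ws) f = sym_prod V vs ?g"
    using True by (simp add: tensor_pair_def lin_extend_def pure2_def)
  moreover have g: "?g = (\<lambda>xs. (1 / fact (length e)) * (\<Sum>\<tau> | \<tau> permutes {..<length e}.
      koszul_sign e \<tau> * f (xs, permute_list \<tau> ws)))" by simp
  have "multilinear_form V ?g"
    unfolding g by (intro multilinear_form_cmult multilinear_form_sum)
      (use True in \<open>simp add: multilinear_form2_def\<close>)
  ultimately show ?thesis using True by (simp add: sym_prod_apply[OF vs])
next
  case False
  thus ?thesis using multilinear_form_0
    by (simp add: tensor_pair_def lin_extend_def pure2_def sym_prod_apply[OF ws] sym_prod_apply[OF vs])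
qed

lemma multilinear_on_form2:
  assumes "multilinear_form2 V f"
  shows "multilinear_on n (\<lambda>xs. f (xs, ys))" "multilinear_on n (\<lambda>ys. f (xs, ys))"
  using assms by (simp_all add: multilinear_form2_def multilinear_form_iff)

definition contraction_term ::
    "('v list \<times> 'v list \<Rightarrow> 'k) \<Rightarrow> bool list \<Rightarrow> bool list \<Rightarrow> 'v list \<Rightarrow> 'v list \<Rightarrow> 'k" where
  "contraction_term f d e xs ys = (\<Sum>k<length d. \<Sum>l<length e.
     contraction_sign d k e l * (form V (xs ! k) (ys ! l) * f (omit k xs, omit l ys)))"

lemma multilinear_contraction_term:
  assumes "multilinear_form2 V f"
  shows "length d = n \<Longrightarrow> multilinear_on n (\<lambda>xs. contraction_term f d e xs ys)"
    and "length e = n \<Longrightarrow> multilinear_on n (\<lambda>ys. contraction_term f d e xs ys)"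
  unfolding contraction_term_def
  by (intro multilinear_on_sum multilinear_on_cmult multilinear_on_contract
      multilinear_on_form2[OF assms] form_linear1 form_linear2; simp)+

lemma contraction_apply:
  assumes f: "multilinear_form2 V f"
  defines "g \<equiv> \<lambda>(xs, ys). \<Sum>d\<in>parities (length xs). \<Sum>e\<in>parities (length ys).
     contraction_term f d e (components V d xs) (components V e ys)"
  shows "contraction V t f = t g" and "multilinear_form2 V g"
proof -
  have "(\<lambda>i. (case i of (xs, ys) \<Rightarrow>
     \<Sum>d\<in>parities (length xs). \<Sum>e\<in>parities (length ys).
     \<Sum>k<length xs. \<Sum>l<length ys.
       tscale (contraction_sign d k e l *
               form V (components V d xs ! k) (components V e ys ! l))
         (pure2 V (omit k (components V d xs)) (omit l (components V e ys)))) f) = g"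
    using f unfolding g_def
    by (auto simp: fun_eq_iff sum_tensor_apply tscale_def pure2_def contraction_term_def
        parities_def mult.assoc intro!: sum.cong)
  thus "contraction V t f = t g" by (simp add: contraction_def lin_extend_def)
  show "multilinear_form2 V g"
    unfolding multilinear_form2_def multilinear_form_iff
  proof (intro conjI allI)
    fix n ys
    show "multilinear_on n (\<lambda>xs. g (xs, ys))"
    proof (rule multilinear_on_cong)
      show "multilinear_on n (\<lambda>xs. \<Sum>d\<in>parities n. \<Sum>e\<in>parities (length ys).
          contraction_term f d e (components V d xs) (components V e ys))"
        by (intro multilinear_on_sum multilinear_on_components multilinear_contraction_term f)
          (auto simp: parities_def)
    qed (simp add: g_def)
  next
    fix n xs
    show "multilinear_on n (\<lambda>ys. g (xs, ys))"
    proof (rule multilinear_on_cong)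
      show "multilinear_on n (\<lambda>ys. \<Sum>d\<in>parities (length xs). \<Sum>e\<in>parities n.
          contraction_term f d e (components V d xs) (components V e ys))"
        by (intro multilinear_on_sum multilinear_on_components multilinear_contraction_term f)
          (auto simp: parities_def)
    qed (simp add: g_def)
  qed
qed

lemma contraction_term_homogeneous:
  assumes f: "multilinear_form2 V f"
    and vs: "homogeneous_list d vs" and ws: "homogeneous_list e ws"
  shows "(\<Sum>d\<in>parities (length vs). \<Sum>e\<in>parities (length ws).
     contraction_term f d e (components V d vs) (components V e ws)) = contraction_term f d e vs ws"
proof -
  have len: "length d = length vs" "length e = length ws"
    using list_all2_lengthD[OF vs] list_all2_lengthD[OF ws] by auto
  have "(\<Sum>e'\<in>parities (length ws). contraction_term f d' e' xs (components V e' ws)) =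
      contraction_term f d' e xs ws" for d' xs
    by (rule sum_parities_homogeneous[OF ws len(2)])
      (auto simp: parities_def intro!: multilinear_contraction_term f)
  moreover have "(\<Sum>d'\<in>parities (length vs). contraction_term f d' e (components V d' vs) ws) =
      contraction_term f d e vs ws"
    by (rule sum_parities_homogeneous[OF vs len(1)])
      (auto simp: parities_def intro!: multilinear_contraction_term f)
  ultimately show ?thesis by simp
qed

lemma homogeneous_list_permute:
  assumes "homogeneous_list d vs" "\<sigma> permutes {..<length d}"
  shows "homogeneous_list (permute_list \<sigma> d) (permute_list \<sigma> vs)"
  using assms by (auto simp: list_all2_conv_all_nth permute_list_nth permutes_less)

lemma homogeneous_list_omit:
  assumes "homogeneous_list d vs"
  shows "homogeneous_list (omit k d) (omit k vs)"
  using assms unfolding omit_def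
  by (intro list_all2_appendI list_all2_takeI list_all2_dropI)

lemma contraction_sym_prod:
  assumes vs: "list_all2 (\<lambda>e v. v \<in> homogeneous V e) d vs"
    and ws: "list_all2 (\<lambda>e w. w \<in> homogeneous V e) e ws"
  shows "contraction V (tensor_pair V (sym_prod V vs) (sym_prod V ws)) =
    (\<Sum>k<length vs. \<Sum>l<length ws.
       tscale (contraction_sign d k e l * form V (vs ! k) (ws ! l))
         (tensor_pair V (sym_prod V (omit k vs)) (sym_prod V (omit l ws))))"
    (is "?L = ?R")
proof
  fix f
  define n m where "n = length d" and "m = length e"
  have len: "length vs = n" "length ws = m"
    using list_all2_lengthD[OF vs] list_all2_lengthD[OF ws] by (auto simp: n_def m_def)
  let ?P = "\<lambda>m. {\<sigma>. \<sigma> permutes {..<m::nat}}"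
  show "?L f = ?R f"
  proof (cases "multilinear_form2 V f")
    case True
    have homog: "(\<Sum>d'\<in>parities n. \<Sum>e'\<in>parities m. contraction_term f d' e'
          (components V d' (permute_list \<sigma> vs)) (components V e' (permute_list \<tau> ws))) =
        contraction_term f (permute_list \<sigma> d) (permute_list \<tau> e)
          (permute_list \<sigma> vs) (permute_list \<tau> ws)"
      if "\<sigma> \<in> ?P n" "\<tau> \<in> ?P m" for \<sigma> \<tau>
      using contraction_term_homogeneous[OF True homogeneous_list_permute[OF vs]
          homogeneous_list_permute[OF ws], of \<sigma> \<tau>] that len by (simp add: n_def m_def)
    have "?L f = (\<Sum>\<sigma>\<in>?P n. koszul_sign d \<sigma> * ((\<Sum>\<tau>\<in>?P m. koszul_sign e \<tau> *
        contraction_term f (permute_list \<sigma> d) (permute_list \<tau> e)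
          (permute_list \<sigma> vs) (permute_list \<tau> ws)) / fact m)) / fact n"
      unfolding contraction_apply(1)[OF True]
        tensor_pair_sym_prod_apply[OF vs ws] if_P[OF contraction_apply(2)[OF True]]
      using homog by (simp add: len flip: n_def m_def)
    also have "\<dots> = (\<Sum>\<sigma>\<in>?P n. koszul_sign d \<sigma> * ((\<Sum>\<tau>\<in>?P m. koszul_sign e \<tau> *
        (\<Sum>l<m. left_sign (permute_list \<tau> e) l *
          (\<Sum>k<n. right_sign (permute_list \<sigma> d) k *
            (form V (permute_list \<sigma> vs ! k) (permute_list \<tau> ws ! l) *
              f (omit k (permute_list \<sigma> vs), omit l (permute_list \<tau> ws)))))) / fact m)) / fact n"
      unfolding contraction_term_def contraction_sign_eq
      by (simp add: sum_distrib_left mult_ac flip: n_def m_def)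
        (subst sum.swap, rule refl)
    also have "\<dots> = (\<Sum>\<sigma>\<in>?P n. koszul_sign d \<sigma> *
        (\<Sum>l<m. left_sign e l * ((\<Sum>\<tau>\<in>?P (m - 1). koszul_sign (omit l e) \<tau> *
          (\<Sum>k<n. right_sign (permute_list \<sigma> d) k *
            (form V (permute_list \<sigma> vs ! k) (ws ! l) *
              f (omit k (permute_list \<sigma> vs), permute_list \<tau> (omit l ws))))) / fact (m - 1)))) / fact n"
      using sum_permutes_remove[of e left_sign ws, OF koszul_left_sign,
          where G = "\<lambda>w zs. \<Sum>k<n. right_sign (permute_list \<sigma> d) k *
            (form V (permute_list \<sigma> vs ! k) w * f (omit k (permute_list \<sigma> vs), zs))" for \<sigma>] len
      by (simp flip: m_def)
    also have "\<dots> = (\<Sum>\<sigma>\<in>?P n. koszul_sign d \<sigma> *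
        (\<Sum>k<n. right_sign (permute_list \<sigma> d) k *
          (\<Sum>l<m. left_sign e l * ((\<Sum>\<tau>\<in>?P (m - 1). koszul_sign (omit l e) \<tau> *
            (form V (permute_list \<sigma> vs ! k) (ws ! l) *
              f (omit k (permute_list \<sigma> vs), permute_list \<tau> (omit l ws)))) / fact (m - 1))))) / fact n"
    proof -
      have swap: "(\<Sum>l<m. a l * ((\<Sum>\<tau>\<in>X. b l \<tau> * (\<Sum>k<n. c k * h k l \<tau>)) / w)) =
          (\<Sum>k<n. c k * (\<Sum>l<m. a l * ((\<Sum>\<tau>\<in>X. b l \<tau> * h k l \<tau>) / w)))"
        for a :: "nat \<Rightarrow> 'k" and b c h and X :: "(nat \<Rightarrow> nat) set" and w
      proof -
        define S where "S k l = (\<Sum>\<tau>\<in>X. b l \<tau> * h k l \<tau>)" for k l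
        have S: "(\<Sum>\<tau>\<in>X. b l \<tau> * (\<Sum>k<n. c k * h k l \<tau>)) = (\<Sum>k<n. c k * S k l)" for l
          unfolding S_def sum_distrib_left by (subst sum.swap) (simp add: mult_ac)
        have "(\<Sum>l<m. a l * ((\<Sum>k<n. c k * S k l) / w)) = (\<Sum>l<m. \<Sum>k<n. c k * (a l * (S k l / w)))"
          by (simp add: sum_distrib_left sum_divide_distrib mult_ac)
        also have "\<dots> = (\<Sum>k<n. c k * (\<Sum>l<m. a l * (S k l / w)))"
          by (subst sum.swap) (simp add: sum_distrib_left)
        finally show ?thesis unfolding S by (simp only: S_def)
      qed
      show ?thesis unfolding swap ..
    qed
    also have "\<dots> = (\<Sum>k<n. right_sign d k * ((\<Sum>\<sigma>\<in>?P (n - 1). koszul_sign (omit k d) \<sigma> *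
          (\<Sum>l<m. left_sign e l * ((\<Sum>\<tau>\<in>?P (m - 1). koszul_sign (omit l e) \<tau> *
            (form V (vs ! k) (ws ! l) *
              f (permute_list \<sigma> (omit k vs), permute_list \<tau> (omit l ws)))) / fact (m - 1)))) / fact (n - 1)))"
      using sum_permutes_remove[of d right_sign vs, OF koszul_right_sign,
          where G = "\<lambda>v zs. \<Sum>l<m. left_sign e l * ((\<Sum>\<tau>\<in>?P (m - 1). koszul_sign (omit l e) \<tau> *
            (form V v (ws ! l) * f (zs, permute_list \<tau> (omit l ws)))) / fact (m - 1))"] len
      by (simp flip: n_def)
    also have "\<dots> = (\<Sum>k<n. \<Sum>l<m. contraction_sign d k e l * form V (vs ! k) (ws ! l) *
        ((\<Sum>\<sigma>\<in>?P (n - 1). koszul_sign (omit k d) \<sigma> *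
          ((\<Sum>\<tau>\<in>?P (m - 1). koszul_sign (omit l e) \<tau> *
              f (permute_list \<sigma> (omit k vs), permute_list \<tau> (omit l ws))) / fact (m - 1))) / fact (n - 1)))"
    proof (rule sum.cong[OF refl])
      fix k
      show "right_sign d k * ((\<Sum>\<sigma>\<in>?P (n - 1). koszul_sign (omit k d) \<sigma> *
          (\<Sum>l<m. left_sign e l * ((\<Sum>\<tau>\<in>?P (m - 1). koszul_sign (omit l e) \<tau> *
            (form V (vs ! k) (ws ! l) *
              f (permute_list \<sigma> (omit k vs), permute_list \<tau> (omit l ws)))) / fact (m - 1)))) / fact (n - 1)) =
        (\<Sum>l<m. contraction_sign d k e l * form V (vs ! k) (ws ! l) *
        ((\<Sum>\<sigma>\<in>?P (n - 1). koszul_sign (omit k d) \<sigma> *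
          ((\<Sum>\<tau>\<in>?P (m - 1). koszul_sign (omit l e) \<tau> *
              f (permute_list \<sigma> (omit k vs), permute_list \<tau> (omit l ws))) / fact (m - 1))) / fact (n - 1)))"
        unfolding contraction_sign_eq sum_distrib_left sum_divide_distrib
        by (subst sum.swap) (simp add: mult_ac)
    qed
    also have "\<dots> = ?R f"
      using True len
      by (simp add: sum_tensor_apply tscale_def length_omit n_def m_def
          tensor_pair_sym_prod_apply[OF homogeneous_list_omit[OF vs] homogeneous_list_omit[OF ws]])
    finally show ?thesis .
  next
    case False
    have "tensor_pair V (sym_prod V vs) (sym_prod V ws) (\<lambda>i. 0) = 0"
      by (simp add: tensor_pair_sym_prod_apply[OF vs ws])
    moreover have "?L f = tensor_pair V (sym_prod V vs) (sym_prod V ws) (\<lambda>i. 0)"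
      unfolding contraction_def lin_extend_def
      by (rule arg_cong[where f = "tensor_pair V (sym_prod V vs) (sym_prod V ws)"])
        (use False in \<open>auto simp: fun_eq_iff sum_tensor_apply tscale_def pure2_def\<close>)
    moreover have "?R f = 0"
      using False by (simp add: sum_tensor_apply tscale_def
          tensor_pair_sym_prod_apply[OF homogeneous_list_omit[OF vs] homogeneous_list_omit[OF ws]])
    ultimately show ?thesis by simp
  qed
qed

end

end

theory Submission
  imports Defs
begin

text \<open>
  The induced map sends \<open>v\<^sub>1 \<otimes> \<dots> \<otimes> v\<^sub>n\<close> to \<open>A v\<^sub>1 \<otimes> \<dots> \<otimes> A v\<^sub>n\<close>. As \<open>A\<close> preserves parities and the form, it
  commutes with the symmetrization and with the contraction, hence with the star product; as
  \<open>p \<circ> A\<close> is a continuous seminorm whenever \<open>p\<close> is, it does not increase the corresponding Weyl seminorms.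
  Passing to the completions additionally requires that the star product maps pairs of Cauchy
  filters to Cauchy filters, and this is where \<open>R \<ge> 1/2\<close> is used. Every continuous seminorm is dominated by a
  continuous \<open>q\<close> with \<open>|\<Lambda>(v, w)| \<le> q v q w\<close> and \<open>q v = q v\<^sub>0 + q v\<^sub>1\<close>. On tensors of degrees \<open>n\<close> and
  \<open>m\<close> the \<open>k\<close>-th power of the contraction then has norm at most
  \<open>n! m! / ((n - k)! (m - k)!)\<close>, and the estimate
  \<open>n! m! / ((n - k)! (m - k)! k!) (n + m - 2 k)!\<^sup>R \<le> C\<^sup>n\<^sup>+\<^sup>m n!\<^sup>R m!\<^sup>R\<close> bounds \<open>q\<^sub>R (a \<star> b)\<close> by the product of
  the seminorms \<open>p\<^sub>R\<close> of \<open>a\<close> and \<open>b\<close> for a multiple \<open>p\<close> of \<open>q\<close>.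
\<close>

section \<open>Cauchy filters of a gauged algebra\<close>

text \<open>A pure tensor is an evaluation, set to 0 at functions that are not multilinear. A
  general functional need not be additive, so linearity of \<open>tensor_pair\<close> in its second
  argument is available only on the span of the pure tensors. Hence identities are proved there, by
  comparing linear maps on generators. The projective seminorm is an infimum that need not be
  attained. \<open>rep_bound\<close> replaces it by a representation of cost at most
  \<open>r\<close>; such bounds pass through linear maps once they hold on generators. With
  \<open>n!^R\<close> inside the weight all degrees are treated at once, and infima occur only in
  the passage between \<open>rep_bound\<close> and \<open>weyl_seminorm\<close>. Summing over the
  \<open>2^n\<close> parity patterns of a list would cost a factor in every contraction; seminorms
  that are additive on even and odd parts avoid it. The product is in general not uniformly
  continuous. It passes to the completion because Cauchy filters are eventually bounded, which is
  enough to send equivalent filters to equivalent ones. The induced map is Lipschitz with constant 1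
  for matching seminorms, and this property is inherited by its extension.\<close>

lemma eventually_carrier: "F \<le> principal S \<Longrightarrow> (\<forall>\<^sub>F x in F. x \<in> S)"
  by (auto simp: le_principal)

lemma prod_filtermap: "filtermap f F \<times>\<^sub>F filtermap g G = filtermap (map_prod f g) (F \<times>\<^sub>F G)"
  by (simp add: prod_filtermap1 prod_filtermap2 filtermap_filtermap)
    (simp add: map_prod_def case_prod_unfold)

text \<open>Pseudometrics suffice, as points at distance zero are merged by
  \<open>cauchy_equiv\<close>. The axioms are asked on the carrier alone because Weyl seminorms are
  controlled only on the span of the pure tensors. A nonempty gauge makes the generated topology
  exhaust the carrier.\<close>

locale gauged_space =
  fixes M :: "('k, 'a) gauged_algebra"
  assumes gauge_nonempty: "gauge M \<noteq> {}"
    and gauge_refl: "d \<in> gauge M \<Longrightarrow> x \<in> carrier M \<Longrightarrow> d x x = 0"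
    and gauge_nonneg: "d \<in> gauge M \<Longrightarrow> x \<in> carrier M \<Longrightarrow> y \<in> carrier M \<Longrightarrow> 0 \<le> d x y"
    and gauge_commute: "d \<in> gauge M \<Longrightarrow> x \<in> carrier M \<Longrightarrow> y \<in> carrier M \<Longrightarrow> d x y = d y x"
    and gauge_triangle: "d \<in> gauge M \<Longrightarrow> x \<in> carrier M \<Longrightarrow> y \<in> carrier M \<Longrightarrow> z \<in> carrier M \<Longrightarrow>
      d x z \<le> d x y + d y z"
begin

text \<open>Two triangle inequalities bound either difference. The distance is thus uniformly
  continuous on pairs, which is what extends it to the completion.\<close>

lemma gauge_quadrangle:
  assumes d: "d \<in> gauge M"
    and "x \<in> carrier M" "y \<in> carrier M" "x' \<in> carrier M" "y' \<in> carrier M"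
  shows "\<bar>d x y - d x' y'\<bar> \<le> d x x' + d y y'"
  using gauge_triangle[OF d, of x x' y] gauge_triangle[OF d, of x' y' y]
    gauge_triangle[OF d, of x' x y'] gauge_triangle[OF d, of x y y']
    gauge_commute[OF d, of x x'] gauge_commute[OF d, of y y'] assms by linarith

text \<open>A set of the product filter is traded for one predicate per factor, each cut down to the
  carrier so that the pseudometric axioms apply.\<close>

lemma close_filtersE:
  assumes "close_filters M F G" "d \<in> gauge M" "0 < \<epsilon>"
    and "F \<le> principal (carrier M)" "G \<le> principal (carrier M)"
  obtains P Q where "eventually P F" "eventually Q G"
    "\<And>x. P x \<Longrightarrow> x \<in> carrier M" "\<And>y. Q y \<Longrightarrow> y \<in> carrier M" "\<And>x y. P x \<Longrightarrow> Q y \<Longrightarrow> d x y < \<epsilon>"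
proof -
  from assms(1-3) obtain P Q where "eventually P F" "eventually Q G"
      "\<And>x y. P x \<Longrightarrow> Q y \<Longrightarrow> d x y < \<epsilon>"
    unfolding close_filters_def eventually_prod_filter by fastforce
  with assms(4,5)[THEN eventually_carrier] show ?thesis
    by (intro that[of "\<lambda>x. P x \<and> x \<in> carrier M" "\<lambda>y. Q y \<and> y \<in> carrier M"])
      (auto intro: eventually_conj)
qed

lemma close_filtersI:
  assumes "\<And>d \<epsilon>. d \<in> gauge M \<Longrightarrow> 0 < \<epsilon> \<Longrightarrow>
    \<exists>P Q. eventually P F \<and> eventually Q G \<and> (\<forall>x y. P x \<longrightarrow> Q y \<longrightarrow> d x y < \<epsilon>)"
  shows "close_filters M F G"
  using assms unfolding close_filters_def eventually_prod_filter by auto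

lemma cauchy_equivD:
  assumes "(F, G) \<in> cauchy_equiv M"
  shows "F \<noteq> bot" "G \<noteq> bot" "F \<le> principal (carrier M)" "G \<le> principal (carrier M)"
    "close_filters M F F" "close_filters M G G" "close_filters M F G"
  using assms by (auto simp: cauchy_equiv_def cauchy_filters_def)

lemma cauchy_equiv_refl: "F \<in> cauchy_filters M \<Longrightarrow> (F, F) \<in> cauchy_equiv M"
  by (simp add: cauchy_equiv_def cauchy_filters_def)

lemma close_filters_sym:
  assumes "close_filters M F G" "F \<le> principal (carrier M)" "G \<le> principal (carrier M)"
  shows "close_filters M G F"
proof (rule close_filtersI)
  fix d and \<epsilon> :: real assume d: "d \<in> gauge M" "0 < \<epsilon>"
  from close_filtersE[OF assms(1) d assms(2,3)] obtain P Q where "eventually P F" "eventually Q G"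
    "\<And>x. P x \<Longrightarrow> x \<in> carrier M" "\<And>y. Q y \<Longrightarrow> y \<in> carrier M" "\<And>x y. P x \<Longrightarrow> Q y \<Longrightarrow> d x y < \<epsilon>" by blast
  thus "\<exists>P Q. eventually P G \<and> eventually Q F \<and> (\<forall>x y. P x \<longrightarrow> Q y \<longrightarrow> d x y < \<epsilon>)"
    using gauge_commute[OF d(1)] by (metis (no_types, lifting))
qed

lemma close_filters_trans:
  assumes "close_filters M F G" "close_filters M G H" "G \<noteq> bot"
    and "F \<le> principal (carrier M)" "G \<le> principal (carrier M)" "H \<le> principal (carrier M)"
  shows "close_filters M F H"
proof (rule close_filtersI)
  fix d and \<epsilon> :: real assume d: "d \<in> gauge M" "0 < \<epsilon>"
  hence e: "0 < \<epsilon> / 2" by simp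
  from close_filtersE[OF assms(1) d(1) e assms(4,5)] obtain P Q where PQ: "eventually P F" "eventually Q G"
    "\<And>x. P x \<Longrightarrow> x \<in> carrier M" "\<And>y. Q y \<Longrightarrow> y \<in> carrier M" "\<And>x y. P x \<Longrightarrow> Q y \<Longrightarrow> d x y < \<epsilon> / 2"
    by blast
  from close_filtersE[OF assms(2) d(1) e assms(5,6)] obtain Q' R where QR: "eventually Q' G" "eventually R H"
    "\<And>x. Q' x \<Longrightarrow> x \<in> carrier M" "\<And>y. R y \<Longrightarrow> y \<in> carrier M" "\<And>x y. Q' x \<Longrightarrow> R y \<Longrightarrow> d x y < \<epsilon> / 2"
    by blast
  \<comment> \<open>\<open>G\<close> is proper, so the two sets found in it meet; a common point
    \<open>y\<close> links \<open>x\<close> to \<open>z\<close>.\<close>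
  from eventually_happens'[OF assms(3) eventually_conj[OF PQ(2) QR(1)]]
  obtain y where y: "Q y" "Q' y" by blast
  have "d x z < \<epsilon>" if "P x" "R z" for x z
    using gauge_triangle[OF d(1), of x y z] PQ(3,4,5)[of x] PQ(4,5) QR(4,5) y that
    by (smt (verit, best) field_sum_of_halves)
  with PQ(1) QR(2) show "\<exists>P R. eventually P F \<and> eventually R H \<and> (\<forall>x z. P x \<longrightarrow> R z \<longrightarrow> d x z < \<epsilon>)"
    by blast
qed

lemma equiv_cauchy: "equiv (cauchy_filters M) (cauchy_equiv M)"
proof (rule equivI)
  show "sym (cauchy_equiv M)"
    by (rule symI) (auto simp: cauchy_equiv_def cauchy_filters_def intro: close_filters_sym)
  show "trans (cauchy_equiv M)"
    by (rule transI) (auto simp: cauchy_equiv_def cauchy_filters_def intro: close_filters_trans)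
qed (auto simp: cauchy_equiv_def cauchy_filters_def refl_on_def)

lemma cauchy_class_eq: "(F, G) \<in> cauchy_equiv M \<Longrightarrow> cauchy_class M F = cauchy_class M G"
  unfolding cauchy_class_def by (rule equiv_class_eq[OF equiv_cauchy])

lemma mem_cauchy_class: "G \<in> cauchy_class M F \<longleftrightarrow> (F, G) \<in> cauchy_equiv M"
  by (simp add: cauchy_class_def)

lemma cauchy_class_self: "F \<in> cauchy_filters M \<Longrightarrow> F \<in> cauchy_class M F"
  by (simp add: mem_cauchy_class cauchy_equiv_refl)

lemma principal_cauchy: "x \<in> carrier M \<Longrightarrow> principal {x} \<in> cauchy_filters M"
  unfolding cauchy_filters_def close_filters_def
  by (auto simp: principal_prod_principal eventually_principal gauge_refl principal_eq_bot_iff)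

lemma carrier_completion:
  "X \<in> carrier (gauge_completion M) \<longleftrightarrow> (\<exists>F\<in>cauchy_filters M. X = cauchy_class M F)"
  by (auto simp: gauge_completion_def quotient_def cauchy_class_def)

text \<open>The image of the product filter under \<open>d\<close> is a Cauchy filter of reals,
  hence converges, and equivalent filters give the same limit. So the description in
  \<open>completion_dist\<close> is well defined and does not depend on representatives.\<close>

lemma completion_dist_tendsto:
  assumes d: "d \<in> gauge M" and F: "F \<in> cauchy_filters M" and G: "G \<in> cauchy_filters M"
  shows "((\<lambda>(x, y). d x y) \<longlongrightarrow> completion_dist d (cauchy_class M F) (cauchy_class M G)) (F \<times>\<^sub>F G)"
proof -
  note FD = cauchy_equivD[OF cauchy_equiv_refl[OF F]]
  note GD = cauchy_equivD[OF cauchy_equiv_refl[OF G]]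
  let ?d = "\<lambda>(x, y). d x y"
  have "cauchy_filter (filtermap ?d (F \<times>\<^sub>F G))"
    unfolding cauchy_filter_metric_filtermap
  proof (intro allI impI)
    fix e :: real assume "0 < e"
    hence e: "0 < e / 2" by simp
    from close_filtersE[OF FD(5) d e FD(3,3)] obtain P P' where P: "eventually P F" "eventually P' F"
      "\<And>x. P x \<Longrightarrow> x \<in> carrier M" "\<And>x. P' x \<Longrightarrow> x \<in> carrier M" "\<And>x y. P x \<Longrightarrow> P' y \<Longrightarrow> d x y < e / 2" by blast
    from close_filtersE[OF GD(5) d e GD(3,3)] obtain Q Q' where Q: "eventually Q G" "eventually Q' G"
      "\<And>x. Q x \<Longrightarrow> x \<in> carrier M" "\<And>x. Q' x \<Longrightarrow> x \<in> carrier M" "\<And>x y. Q x \<Longrightarrow> Q' y \<Longrightarrow> d x y < e / 2" by blast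
    let ?R = "\<lambda>(x, y). (P x \<and> P' x) \<and> (Q y \<and> Q' y)"
    have "eventually ?R (F \<times>\<^sub>F G)"
      using eventually_conj[OF P(1,2)] eventually_conj[OF Q(1,2)]
      unfolding eventually_prod_filter by blast
    moreover have "dist (?d u) (?d v) < e" if "?R u" "?R v" for u v
      using that gauge_quadrangle[OF d, of "fst u" "snd u" "fst v" "snd v"]
        P(3)[of "fst u"] P(3)[of "fst v"] Q(3)[of "snd u"] Q(3)[of "snd v"]
        P(5)[of "fst u" "fst v"] Q(5)[of "snd u" "snd v"]
      by (auto simp: dist_real_def split: prod.splits)
    ultimately show "\<exists>P. eventually P (F \<times>\<^sub>F G) \<and> (\<forall>x y. P x \<and> P y \<longrightarrow> dist (?d x) (?d y) < e)"
      by blast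
  qed
  then obtain r where r: "filtermap ?d (F \<times>\<^sub>F G) \<le> nhds r"
    using cauchy_filter_complete_converges[of "filtermap ?d (F \<times>\<^sub>F G)" UNIV] FD(1) GD(1)
    by (auto simp: complete_UNIV filtermap_bot_iff prod_filter_eq_bot)
  \<comment> \<open>The distance at one pair from the old filters is within \<open>e / 3\<close> of
    \<open>r\<close> and, by the quadrangle inequality, within \<open>2 * e / 3\<close> of the
    distance at any pair from the new ones.\<close>
  have lim: "(?d \<longlongrightarrow> r) (F' \<times>\<^sub>F G')" if F': "(F, F') \<in> cauchy_equiv M" and G': "(G, G') \<in> cauchy_equiv M" for F' G'
  proof (rule tendstoI)
    fix e :: real assume "0 < e"
    hence e: "0 < e / 3" by simp
    from close_filtersE[OF cauchy_equivD(7)[OF F'] d e cauchy_equivD(3,4)[OF F']] obtain P P' where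
      P: "eventually P F" "eventually P' F'" "\<And>x. P x \<Longrightarrow> x \<in> carrier M" "\<And>x. P' x \<Longrightarrow> x \<in> carrier M"
      "\<And>x y. P x \<Longrightarrow> P' y \<Longrightarrow> d x y < e / 3" by blast
    from close_filtersE[OF cauchy_equivD(7)[OF G'] d e cauchy_equivD(3,4)[OF G']] obtain Q Q' where
      Q: "eventually Q G" "eventually Q' G'" "\<And>x. Q x \<Longrightarrow> x \<in> carrier M" "\<And>x. Q' x \<Longrightarrow> x \<in> carrier M"
      "\<And>x y. Q x \<Longrightarrow> Q' y \<Longrightarrow> d x y < e / 3" by blast
    have "\<forall>\<^sub>F u in F \<times>\<^sub>F G. dist (?d u) r < e / 3"
      by (rule tendstoD[OF _ e]) (use r in \<open>simp add: filterlim_def\<close>)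
    moreover have "\<forall>\<^sub>F u in F \<times>\<^sub>F G. P (fst u) \<and> Q (snd u)"
      using P(1) Q(1) unfolding eventually_prod_filter by force
    ultimately have "\<forall>\<^sub>F u in F \<times>\<^sub>F G. dist (?d u) r < e / 3 \<and> P (fst u) \<and> Q (snd u)"
      by (rule eventually_conj)
    hence "\<exists>u. dist (?d u) r < e / 3 \<and> P (fst u) \<and> Q (snd u)"
      by (rule eventually_happens'[rotated]) (use FD(1) GD(1) in \<open>simp add: prod_filter_eq_bot\<close>)
    then obtain x y where xy: "dist (d x y) r < e / 3" "P x" "Q y" by auto
    have "dist (d x' y') r < e" if "P' x'" "Q' y'" for x' y'
      using gauge_quadrangle[OF d P(3)[OF xy(2)] Q(3)[OF xy(3)] P(4)[OF that(1)] Q(4)[OF that(2)]]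
        P(5)[OF xy(2) that(1)] Q(5)[OF xy(3) that(2)] xy(1)
      unfolding dist_real_def by linarith
    with P(2) Q(2) show "\<forall>\<^sub>F u in F' \<times>\<^sub>F G'. dist (?d u) r < e"
      unfolding eventually_prod_filter by (intro exI[of _ P'] exI[of _ Q']) auto
  qed
  have "completion_dist d (cauchy_class M F) (cauchy_class M G) = r"
    unfolding completion_dist_def
  proof (rule the_equality)
    show "\<forall>F'\<in>cauchy_class M F. \<forall>G'\<in>cauchy_class M G. (?d \<longlongrightarrow> r) (F' \<times>\<^sub>F G')"
      using lim by (simp add: mem_cauchy_class)
  next
    fix r' assume "\<forall>F'\<in>cauchy_class M F. \<forall>G'\<in>cauchy_class M G. (?d \<longlongrightarrow> r') (F' \<times>\<^sub>F G')"
    hence "(?d \<longlongrightarrow> r') (F \<times>\<^sub>F G)" using F G by (simp add: cauchy_class_self)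
    moreover have "(?d \<longlongrightarrow> r) (F \<times>\<^sub>F G)" using r by (simp add: filterlim_def)
    ultimately show "r' = r"
      using FD(1) GD(1) by (intro tendsto_unique[of "F \<times>\<^sub>F G"]) (simp_all add: prod_filter_eq_bot)
  qed
  with r show ?thesis by (simp add: filterlim_def)
qed

lemma completion_dist_approx:
  assumes d: "d \<in> gauge M" and F: "F \<in> cauchy_filters M" and G: "G \<in> cauchy_filters M" and e: "0 < e"
  obtains P Q where "eventually P F" "eventually Q G"
    "\<And>x. P x \<Longrightarrow> x \<in> carrier M" "\<And>y. Q y \<Longrightarrow> y \<in> carrier M"
    "\<And>x y. P x \<Longrightarrow> Q y \<Longrightarrow> \<bar>d x y - completion_dist d (cauchy_class M F) (cauchy_class M G)\<bar> < e"
proof -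
  from tendstoD[OF completion_dist_tendsto[OF d F G] e] obtain P Q where "eventually P F" "eventually Q G"
      "\<And>x y. P x \<Longrightarrow> Q y \<Longrightarrow> \<bar>d x y - completion_dist d (cauchy_class M F) (cauchy_class M G)\<bar> < e"
    unfolding eventually_prod_filter dist_real_def by auto
  moreover have "\<forall>\<^sub>F x in F. x \<in> carrier M" "\<forall>\<^sub>F y in G. y \<in> carrier M"
    using F G by (auto simp: cauchy_filters_def intro: eventually_carrier)
  ultimately show ?thesis
    by (intro that[of "\<lambda>x. P x \<and> x \<in> carrier M" "\<lambda>y. Q y \<and> y \<in> carrier M"])
      (auto intro: eventually_conj)
qed

text \<open>Apart from symmetry, which is uniqueness of limits, each axiom is read off at points of
  the filters where all distances involved are close to their limits, with an arbitrary error
  \<open>e\<close>.\<close>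

lemma gauged_space_completion: "gauged_space (gauge_completion M)"
proof
  have gauge: "gauge (gauge_completion M) = completion_dist ` gauge M"
    by (simp add: gauge_completion_def)
  show "gauge (gauge_completion M) \<noteq> {}" using gauge_nonempty by (simp add: gauge)
  fix D assume "D \<in> gauge (gauge_completion M)"
  then obtain d where d: "d \<in> gauge M" and D: "D = completion_dist d" by (auto simp: gauge)
  fix X assume "X \<in> carrier (gauge_completion M)"
  then obtain F where F: "F \<in> cauchy_filters M" and X: "X = cauchy_class M F"
    by (auto simp: carrier_completion)
  have ne: "F' \<noteq> bot" if "F' \<in> cauchy_filters M" for F' using that by (simp add: cauchy_filters_def)
  show "D X X = 0"
  proof (rule antisym; rule field_le_epsilon)
    fix e :: real assume e: "0 < e"
    from completion_dist_approx[OF d F F e] obtain P Q where PQ: "eventually P F" "eventually Q F"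
      "\<And>x. P x \<Longrightarrow> x \<in> carrier M" "\<And>y. Q y \<Longrightarrow> y \<in> carrier M" "\<And>x y. P x \<Longrightarrow> Q y \<Longrightarrow> \<bar>d x y - D X X\<bar> < e"
      unfolding D X by blast
    from eventually_happens'[OF ne[OF F] eventually_conj[OF PQ(1,2)]] obtain x where "P x" "Q x" by blast
    with PQ(3)[of x] PQ(5)[of x x] gauge_refl[OF d, of x] show "D X X \<le> 0 + e" "0 \<le> D X X + e"
      by fastforce+
  qed
  fix Y assume "Y \<in> carrier (gauge_completion M)"
  then obtain G where G: "G \<in> cauchy_filters M" and Y: "Y = cauchy_class M G"
    by (auto simp: carrier_completion)
  show "0 \<le> D X Y"
  proof (rule field_le_epsilon)
    fix e :: real assume e: "0 < e"
    from completion_dist_approx[OF d F G e] obtain P Q where PQ: "eventually P F" "eventually Q G"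
      "\<And>x. P x \<Longrightarrow> x \<in> carrier M" "\<And>y. Q y \<Longrightarrow> y \<in> carrier M" "\<And>x y. P x \<Longrightarrow> Q y \<Longrightarrow> \<bar>d x y - D X Y\<bar> < e"
      unfolding D X Y by blast
    obtain x y where "P x" "Q y"
      using eventually_happens'[OF ne[OF F] PQ(1)] eventually_happens'[OF ne[OF G] PQ(2)] by blast
    with PQ(3)[of x] PQ(4)[of y] PQ(5)[of x y] gauge_nonneg[OF d, of x y] show "0 \<le> D X Y + e" by force
  qed
  show "D X Y = D Y X"
    unfolding D X Y
  proof (rule tendsto_unique[OF _ completion_dist_tendsto[OF d F G]])
    show "F \<times>\<^sub>F G \<noteq> bot" using ne F G by (simp add: prod_filter_eq_bot)
    have "((\<lambda>(x, y). d y x) \<longlongrightarrow> completion_dist d (cauchy_class M G) (cauchy_class M F)) (F \<times>\<^sub>F G)"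
      using completion_dist_tendsto[OF d G F]
      by (subst prod_filter_commute) (simp add: filterlim_filtermap case_prod_unfold)
    moreover have "\<forall>\<^sub>F u in F \<times>\<^sub>F G. (case u of (x, y) \<Rightarrow> d y x) = (case u of (x, y) \<Rightarrow> d x y)"
    proof -
      have "\<forall>\<^sub>F x in F. x \<in> carrier M" "\<forall>\<^sub>F y in G. y \<in> carrier M"
        using F G by (auto simp: cauchy_filters_def intro: eventually_carrier)
      thus ?thesis unfolding eventually_prod_filter using gauge_commute[OF d] by fastforce
    qed
    ultimately show "((\<lambda>(x, y). d x y) \<longlongrightarrow> completion_dist d (cauchy_class M G) (cauchy_class M F)) (F \<times>\<^sub>F G)"
      by (rule Lim_transform_eventually)
  qed
  fix Z assume "Z \<in> carrier (gauge_completion M)"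
  then obtain H where H: "H \<in> cauchy_filters M" and Z: "Z = cauchy_class M H"
    by (auto simp: carrier_completion)
  show "D X Z \<le> D X Y + D Y Z"
  proof (rule field_le_epsilon)
    fix e :: real assume "0 < e"
    hence e: "0 < e / 3" by simp
    from completion_dist_approx[OF d F G e] obtain P Q where PQ: "eventually P F" "eventually Q G"
      "\<And>x. P x \<Longrightarrow> x \<in> carrier M" "\<And>y. Q y \<Longrightarrow> y \<in> carrier M" "\<And>x y. P x \<Longrightarrow> Q y \<Longrightarrow> \<bar>d x y - D X Y\<bar> < e / 3"
      unfolding D X Y by blast
    from completion_dist_approx[OF d G H e] obtain Q' R where QR: "eventually Q' G" "eventually R H"
      "\<And>x. Q' x \<Longrightarrow> x \<in> carrier M" "\<And>y. R y \<Longrightarrow> y \<in> carrier M" "\<And>x y. Q' x \<Longrightarrow> R y \<Longrightarrow> \<bar>d x y - D Y Z\<bar> < e / 3"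
      unfolding D Y Z by blast
    from completion_dist_approx[OF d F H e] obtain P' R' where PR: "eventually P' F" "eventually R' H"
      "\<And>x. P' x \<Longrightarrow> x \<in> carrier M" "\<And>y. R' y \<Longrightarrow> y \<in> carrier M" "\<And>x y. P' x \<Longrightarrow> R' y \<Longrightarrow> \<bar>d x y - D X Z\<bar> < e / 3"
      unfolding D X Z by blast
    obtain x y z where xyz: "P x" "P' x" "Q y" "Q' y" "R z" "R' z"
      using eventually_happens'[OF ne[OF F] eventually_conj[OF PQ(1) PR(1)]]
        eventually_happens'[OF ne[OF G] eventually_conj[OF PQ(2) QR(1)]]
        eventually_happens'[OF ne[OF H] eventually_conj[OF QR(2) PR(2)]] by blast
    with gauge_triangle[OF d PQ(3) QR(3) PR(4), of x y z] PQ(5)[of x y] QR(5)[of y z] PR(5)[of x z]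
    show "D X Z \<le> D X Y + D Y Z + e" by linarith
  qed
qed

text \<open>The gauge need not be directed, so this is only a sufficient condition; it is enough for
  preimages of subbasic balls under Lipschitz maps.\<close>

lemma openin_gauge_topologyI:
  assumes "S \<subseteq> carrier M"
    and "\<And>x. x \<in> S \<Longrightarrow> \<exists>d\<in>gauge M. \<exists>\<epsilon>>0. \<forall>y\<in>carrier M. d x y < \<epsilon> \<longrightarrow> y \<in> S"
  shows "openin (gauge_topology M) S"
proof (subst openin_subopen, intro ballI)
  fix x assume x: "x \<in> S"
  from assms(2)[OF x] obtain d \<epsilon> where d: "d \<in> gauge M" "\<epsilon> > 0"
    "\<forall>y\<in>carrier M. d x y < \<epsilon> \<longrightarrow> y \<in> S" by blast
  have xM: "x \<in> carrier M" using x assms(1) by blast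
  have "openin (gauge_topology M) {y \<in> carrier M. d x y < \<epsilon>}"
    unfolding gauge_topology_def by (rule topology_generated_by_Basis) (use d xM in blast)
  moreover have "x \<in> {y \<in> carrier M. d x y < \<epsilon>}" using d xM by (simp add: gauge_refl)
  ultimately show "\<exists>T. openin (gauge_topology M) T \<and> x \<in> T \<and> T \<subseteq> S" using d(3) by blast
qed

lemma topspace_gauge: "topspace (gauge_topology M) = carrier M"
  unfolding gauge_topology_def topology_generated_by_topspace
proof (intro subset_antisym subsetI)
  fix x assume x: "x \<in> carrier M"
  obtain d where "d \<in> gauge M" using gauge_nonempty by blast
  with x have "x \<in> {y \<in> carrier M. d x y < 1}" by (simp add: gauge_refl)
  with x \<open>d \<in> gauge M\<close> show "x \<in> \<Union>{{y \<in> carrier M. d x y < \<epsilon>} | d x \<epsilon>. d \<in> gauge M \<and> x \<in> carrier M \<and> 0 < \<epsilon>}"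
    using zero_less_one by blast
qed blast

end

section \<open>Lipschitz maps and Cauchy-continuous maps\<close>

text \<open>For linear maps and seminorms this is the usual continuity criterion of domination by
  one seminorm of the source. Stated for pseudometrics it is inherited by the completion with the
  same \<open>C\<close>; positivity of \<open>C\<close> allows division by it.\<close>

definition lipschitz_map :: "('k, 'a) gauged_algebra \<Rightarrow> ('k, 'b) gauged_algebra \<Rightarrow> ('a \<Rightarrow> 'b) \<Rightarrow> bool" where
  "lipschitz_map M N h \<longleftrightarrow> h ` carrier M \<subseteq> carrier N \<and>
     (\<forall>d\<in>gauge N. \<exists>d'\<in>gauge M. \<exists>C>0. \<forall>x\<in>carrier M. \<forall>y\<in>carrier M. d (h x) (h y) \<le> C * d' x y)"

definition cauchy_map :: "('k, 'a) gauged_algebra \<Rightarrow> ('k, 'b) gauged_algebra \<Rightarrow> ('a \<Rightarrow> 'b) \<Rightarrow> bool" where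
  "cauchy_map M N h \<longleftrightarrow>
     (\<forall>F G. (F, G) \<in> cauchy_equiv M \<longrightarrow> (filtermap h F, filtermap h G) \<in> cauchy_equiv N)"

text \<open>Weaker than uniform continuity, which a product lacks in general; it is just what makes
  \<open>completion_map2\<close> independent of representatives.\<close>

definition cauchy_map2 :: "('k, 'a) gauged_algebra \<Rightarrow> ('a \<Rightarrow> 'a \<Rightarrow> 'a) \<Rightarrow> bool" where
  "cauchy_map2 M h \<longleftrightarrow>
     (\<forall>F F' G G'. (F, F') \<in> cauchy_equiv M \<longrightarrow> (G, G') \<in> cauchy_equiv M \<longrightarrow>
        (filtermap (\<lambda>(x, y). h x y) (F \<times>\<^sub>F G), filtermap (\<lambda>(x, y). h x y) (F' \<times>\<^sub>F G')) \<in> cauchy_equiv M)"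

lemma lipschitz_mapE:
  assumes h: "lipschitz_map M N h" and d: "d \<in> gauge N"
  obtains d' C where "d' \<in> gauge M" "C > 0"
    "\<And>x y. x \<in> carrier M \<Longrightarrow> y \<in> carrier M \<Longrightarrow> d (h x) (h y) \<le> C * d' x y"
proof -
  from bspec[OF conjunct2[OF h[unfolded lipschitz_map_def]] d]
  obtain d' where d': "d' \<in> gauge M"
    and "\<exists>C>0. \<forall>x\<in>carrier M. \<forall>y\<in>carrier M. d (h x) (h y) \<le> C * d' x y" by (elim bexE)
  from this(2) obtain C where "C > 0" "\<forall>x\<in>carrier M. \<forall>y\<in>carrier M. d (h x) (h y) \<le> C * d' x y"
    by (elim exE conjE)
  with d' show ?thesis by (intro that[of d' C]) auto
qed

lemma cauchy_equiv_fields: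
  "(F, G) \<in> cauchy_equiv M \<Longrightarrow> F \<in> cauchy_filters M \<and> G \<in> cauchy_filters M"
  by (simp add: cauchy_equiv_def)

lemma continuous_map_lipschitz:
  assumes M: "gauged_space M" and N: "gauged_space N" and h: "lipschitz_map M N h"
  shows "continuous_map (gauge_topology M) (gauge_topology N) h"
proof -
  interpret M: gauged_space M by fact
  interpret N: gauged_space N by fact
  have hc: "h x \<in> carrier N" if "x \<in> carrier M" for x using h that by (auto simp: lipschitz_map_def)
  let ?B = "{{y \<in> carrier N. d x y < \<epsilon>} | d x \<epsilon>. d \<in> gauge N \<and> x \<in> carrier N \<and> 0 < \<epsilon>}"
  have "openin (gauge_topology M) (h -` S \<inter> carrier M)" if "S \<in> ?B" for S
  proof (rule M.openin_gauge_topologyI)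
    from that obtain d y \<epsilon> where S: "S = {z \<in> carrier N. d y z < \<epsilon>}" and
      d: "d \<in> gauge N" "y \<in> carrier N" "0 < \<epsilon>" by blast
    fix x assume x: "x \<in> h -` S \<inter> carrier M"
    from lipschitz_mapE[OF h d(1)] obtain d' C where d': "d' \<in> gauge M" "C > 0"
      "\<And>x y. x \<in> carrier M \<Longrightarrow> y \<in> carrier M \<Longrightarrow> d (h x) (h y) \<le> C * d' x y"
      by blast
    \<comment> \<open>The subbasic ball is centred at \<open>y\<close>, not at \<open>h x\<close>.
      What is left of its radius at \<open>h x\<close>, divided by \<open>C\<close>, is the radius
      needed in \<open>M\<close>.\<close>
    let ?e = "(\<epsilon> - d y (h x)) / C"
    have "0 < ?e" using x S d' by simp
    moreover have "h z \<in> S" if z: "z \<in> carrier M" "d' x z < ?e" for z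
    proof -
      have "d y (h z) \<le> d y (h x) + d (h x) (h z)"
        using N.gauge_triangle[OF d(1,2)] x z hc by simp
      also have "\<dots> \<le> d y (h x) + C * d' x z" using d'(3)[of x z] x z by simp
      also have "\<dots> < \<epsilon>" using z(2) d'(2) by (simp add: field_simps)
      finally show ?thesis using S hc z by simp
    qed
    ultimately show "\<exists>d\<in>gauge M. \<exists>\<epsilon>>0. \<forall>y\<in>carrier M. d x y < \<epsilon> \<longrightarrow> y \<in> h -` S \<inter> carrier M"
      using d'(1) by blast
  qed blast
  moreover have "h ` carrier M \<subseteq> \<Union>?B"
    using hc N.topspace_gauge unfolding gauge_topology_def topology_generated_by_topspace by auto
  ultimately show ?thesis
    unfolding gauge_topology_def[of N]
    by (intro continuous_on_generated_topo) (simp_all only: M.topspace_gauge)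
qed

lemma filtermap_carrier:
  "F \<le> principal S \<Longrightarrow> h ` S \<subseteq> T \<Longrightarrow> filtermap h F \<le> principal T"
  by (auto simp: le_principal eventually_filtermap elim!: eventually_mono)

lemma lipschitz_imp_cauchy_map:
  assumes M: "gauged_space M" and N: "gauged_space N" and h: "lipschitz_map M N h"
  shows "cauchy_map M N h"
proof -
  interpret M: gauged_space M by fact
  interpret N: gauged_space N by fact
  have hc: "h ` carrier M \<subseteq> carrier N" using h by (auto simp: lipschitz_map_def)
  have close: "close_filters N (filtermap h F) (filtermap h G)"
    if FG: "close_filters M F G" "F \<le> principal (carrier M)" "G \<le> principal (carrier M)" for F G
  proof (rule N.close_filtersI)
    fix d and \<epsilon> :: real assume d: "d \<in> gauge N" "0 < \<epsilon>"
    from lipschitz_mapE[OF h d(1)] obtain d' C where d': "d' \<in> gauge M" "C > 0"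
      "\<And>x y. x \<in> carrier M \<Longrightarrow> y \<in> carrier M \<Longrightarrow> d (h x) (h y) \<le> C * d' x y"
      by blast
    have "0 < \<epsilon> / C" using d d' by simp
    from M.close_filtersE[OF FG(1) d'(1) this FG(2,3)] obtain P Q where PQ: "eventually P F" "eventually Q G"
      "\<And>x. P x \<Longrightarrow> x \<in> carrier M" "\<And>y. Q y \<Longrightarrow> y \<in> carrier M" "\<And>x y. P x \<Longrightarrow> Q y \<Longrightarrow> d' x y < \<epsilon> / C"
      by blast
    have "d (h x) (h y) < \<epsilon>" if "P x" "Q y" for x y
    proof -
      have "d (h x) (h y) \<le> C * d' x y" using d'(3) PQ(3,4) that by blast
      also have "\<dots> < \<epsilon>" using PQ(5)[OF that] d'(2) by (simp add: field_simps)
      finally show ?thesis .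
    qed
    with PQ(1,2) show "\<exists>P Q. eventually P (filtermap h F) \<and> eventually Q (filtermap h G) \<and>
        (\<forall>x y. P x \<longrightarrow> Q y \<longrightarrow> d x y < \<epsilon>)"
      by (intro exI[of _ "\<lambda>z. \<exists>x. P x \<and> z = h x"] exI[of _ "\<lambda>z. \<exists>x. Q x \<and> z = h x"])
        (auto simp: eventually_filtermap elim: eventually_mono)
  qed
  show ?thesis
    unfolding cauchy_map_def
  proof (intro allI impI)
    fix F G assume "(F, G) \<in> cauchy_equiv M"
    note FG = M.cauchy_equivD[OF this]
    show "(filtermap h F, filtermap h G) \<in> cauchy_equiv N"
      using FG close filtermap_carrier[OF _ hc]
      by (simp add: cauchy_equiv_def cauchy_filters_def filtermap_bot_iff)
  qed
qed

text \<open>All representatives contribute the same class and \<open>F\<close> is one of them, so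
  the union in \<open>completion_map\<close> collapses.\<close>

lemma completion_map_class:
  assumes M: "gauged_space M" and N: "gauged_space N" and h: "cauchy_map M N h"
    and F: "F \<in> cauchy_filters M"
  shows "completion_map N h (cauchy_class M F) = cauchy_class N (filtermap h F)"
proof -
  interpret M: gauged_space M by fact
  interpret N: gauged_space N by fact
  have "cauchy_class N (filtermap h G) = cauchy_class N (filtermap h F)" if "G \<in> cauchy_class M F" for G
    using that h by (intro N.cauchy_class_eq[symmetric]) (simp add: M.mem_cauchy_class cauchy_map_def)
  with M.cauchy_class_self[OF F] show ?thesis unfolding completion_map_def by blast
qed

lemma completion_map2_class:
  assumes M: "gauged_space M" and h: "cauchy_map2 M h"
    and F: "F \<in> cauchy_filters M" and G: "G \<in> cauchy_filters M"
  shows "completion_map2 M h (cauchy_class M F) (cauchy_class M G) =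
    cauchy_class M (filtermap (\<lambda>(x, y). h x y) (F \<times>\<^sub>F G))"
proof -
  interpret M: gauged_space M by fact
  have "cauchy_class M (filtermap (\<lambda>(x, y). h x y) (F' \<times>\<^sub>F G')) =
      cauchy_class M (filtermap (\<lambda>(x, y). h x y) (F \<times>\<^sub>F G))"
    if "F' \<in> cauchy_class M F" "G' \<in> cauchy_class M G" for F' G'
    using that h by (intro M.cauchy_class_eq[symmetric]) (simp add: M.mem_cauchy_class cauchy_map2_def)
  with M.cauchy_class_self[OF F] M.cauchy_class_self[OF G] show ?thesis
    unfolding completion_map2_def by blast
qed

lemma completion_map_embed:
  assumes M: "gauged_space M" and N: "gauged_space N" and h: "cauchy_map M N h" and x: "x \<in> carrier M"
  shows "completion_map N h (completion_embed M x) = completion_embed N (h x)"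
  unfolding completion_embed_def
  using completion_map_class[OF M N h gauged_space.principal_cauchy[OF M x]] by simp

text \<open>The inequality for \<open>h\<close> holds eventually along
  \<open>F \<times>\<^sub>F G\<close> and both sides converge to completed distances, so it survives
  in the limit with the same constant.\<close>

lemma completion_map_lipschitz:
  assumes M: "gauged_space M" and N: "gauged_space N" and h: "lipschitz_map M N h"
  shows "lipschitz_map (gauge_completion M) (gauge_completion N) (completion_map N h)"
proof -
  interpret M: gauged_space M by fact
  interpret N: gauged_space N by fact
  have hc: "h ` carrier M \<subseteq> carrier N" using h by (auto simp: lipschitz_map_def)
  have ch: "cauchy_map M N h" by (rule lipschitz_imp_cauchy_map[OF assms])
  have ch1: "filtermap h F \<in> cauchy_filters N" if "F \<in> cauchy_filters M" for F
    using ch M.cauchy_equiv_refl[OF that] cauchy_equiv_fields unfolding cauchy_map_def by blast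
  show ?thesis
    unfolding lipschitz_map_def
  proof (intro conjI ballI)
    show "completion_map N h ` carrier (gauge_completion M) \<subseteq> carrier (gauge_completion N)"
      using completion_map_class[OF M N ch] ch1
      by (auto simp: M.carrier_completion N.carrier_completion intro!: bexI)
    fix D assume "D \<in> gauge (gauge_completion N)"
    hence "D \<in> completion_dist ` gauge N" by (simp add: gauge_completion_def)
    then obtain d where d: "d \<in> gauge N" and D: "D = completion_dist d" by blast
    from lipschitz_mapE[OF h d] obtain d' C where d': "d' \<in> gauge M" "C > 0"
      "\<And>x y. x \<in> carrier M \<Longrightarrow> y \<in> carrier M \<Longrightarrow> d (h x) (h y) \<le> C * d' x y"
      by blast
    have "D (completion_map N h X) (completion_map N h Y) \<le> C * completion_dist d' X Y"
      if "X \<in> carrier (gauge_completion M)" "Y \<in> carrier (gauge_completion M)" for X Y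
    proof -
      from that obtain F G where F: "F \<in> cauchy_filters M" "X = cauchy_class M F"
        and G: "G \<in> cauchy_filters M" "Y = cauchy_class M G" by (auto simp: M.carrier_completion)
      have hX: "completion_map N h X = cauchy_class N (filtermap h F)"
        "completion_map N h Y = cauchy_class N (filtermap h G)"
        unfolding F G by (rule completion_map_class[OF M N ch], fact)+
      have "((\<lambda>(x, y). d x y) \<longlongrightarrow> D (completion_map N h X) (completion_map N h Y))
          (filtermap h F \<times>\<^sub>F filtermap h G)"
        unfolding hX D by (rule N.completion_dist_tendsto[OF d ch1[OF F(1)] ch1[OF G(1)]])
      hence 1: "((\<lambda>(x, y). d (h x) (h y)) \<longlongrightarrow> D (completion_map N h X) (completion_map N h Y)) (F \<times>\<^sub>F G)"
        by (simp add: prod_filtermap filterlim_filtermap map_prod_def case_prod_unfold)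
      have 2: "((\<lambda>u. C * (case u of (x, y) \<Rightarrow> d' x y)) \<longlongrightarrow> C * completion_dist d' X Y) (F \<times>\<^sub>F G)"
        unfolding F G by (intro tendsto_mult_left M.completion_dist_tendsto d' F G)
      have "\<forall>\<^sub>F u in F \<times>\<^sub>F G. (case u of (x, y) \<Rightarrow> d (h x) (h y)) \<le> C * (case u of (x, y) \<Rightarrow> d' x y)"
      proof -
        have "\<forall>\<^sub>F x in F. x \<in> carrier M" "\<forall>\<^sub>F y in G. y \<in> carrier M"
          using F G by (auto simp: cauchy_filters_def intro: eventually_carrier)
        thus ?thesis unfolding eventually_prod_filter using d'(3) by fastforce
      qed
      from tendsto_le[OF _ 2 1 this] show ?thesis
        using F G by (simp add: prod_filter_eq_bot cauchy_filters_def)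
    qed
    moreover have "completion_dist d' \<in> gauge (gauge_completion M)"
      using d'(1) by (simp add: gauge_completion_def)
    ultimately show "\<exists>d'\<in>gauge (gauge_completion M). \<exists>C>0. \<forall>X\<in>carrier (gauge_completion M).
        \<forall>Y\<in>carrier (gauge_completion M). D (completion_map N h X) (completion_map N h Y) \<le> C * d' X Y"
      using d'(2) by (intro bexI[of _ "completion_dist d'"] exI[of _ C]) auto
  qed
qed

section \<open>Algebra operations and homomorphisms on the completion\<close>

locale topological_algebra = gauged_space +
  assumes one_carrier: "one M \<in> carrier M"
    and cauchy_mult: "cauchy_map2 M (mult M)"
    and cauchy_add: "cauchy_map2 M (add M)"
    and cauchy_smult: "cauchy_map M M (Module.smult M c)"

lemma filtermap_cong_carrier:
  assumes "F \<le> principal S" "\<And>x. x \<in> S \<Longrightarrow> f x = g x"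
  shows "filtermap f F = filtermap g F"
  using eventually_carrier[OF assms(1)] assms(2)
  by (intro filter_eqI) (auto simp: eventually_filtermap elim: eventually_elim2)

lemma prod_filter_carrier:
  "F \<le> principal S \<Longrightarrow> G \<le> principal T \<Longrightarrow> F \<times>\<^sub>F G \<le> principal (S \<times> T)"
  using prod_filter_mono[of F "principal S" G "principal T"] by (simp add: principal_prod_principal)

text \<open>Both sides are classes of image filters, and these filters coincide because
  \<open>F\<close> and \<open>G\<close> live on the carrier, where \<open>h\<close> intertwines
  \<open>f\<close> and \<open>g\<close>.\<close>

lemma completion_map_hom2:
  assumes M: "gauged_space M" and N: "gauged_space N" and h: "cauchy_map M N h"
    and f: "cauchy_map2 M f" and g: "cauchy_map2 N g"
    and hom: "\<And>x y. x \<in> carrier M \<Longrightarrow> y \<in> carrier M \<Longrightarrow> h (f x y) = g (h x) (h y)"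
    and X: "X \<in> carrier (gauge_completion M)" and Y: "Y \<in> carrier (gauge_completion M)"
  shows "completion_map N h (completion_map2 M f X Y) =
    completion_map2 N g (completion_map N h X) (completion_map N h Y)"
proof -
  interpret M: gauged_space M by fact
  interpret N: gauged_space N by fact
  from X Y obtain F G where F: "F \<in> cauchy_filters M" "X = cauchy_class M F"
    and G: "G \<in> cauchy_filters M" "Y = cauchy_class M G" by (auto simp: M.carrier_completion)
  have h1: "filtermap h F \<in> cauchy_filters N" if "F \<in> cauchy_filters M" for F
    using h M.cauchy_equiv_refl[OF that] cauchy_equiv_fields unfolding cauchy_map_def by blast
  have f1: "filtermap (\<lambda>(x, y). f x y) (F \<times>\<^sub>F G) \<in> cauchy_filters M"
    using f M.cauchy_equiv_refl[OF F(1)] M.cauchy_equiv_refl[OF G(1)] cauchy_equiv_fields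
    unfolding cauchy_map2_def by blast
  have "filtermap h (filtermap (\<lambda>(x, y). f x y) (F \<times>\<^sub>F G)) =
      filtermap (\<lambda>(x, y). g x y) (filtermap h F \<times>\<^sub>F filtermap h G)"
    unfolding prod_filtermap filtermap_filtermap
    by (rule filtermap_cong_carrier[OF prod_filter_carrier[of _ "carrier M" _ "carrier M"]])
      (use F(1) G(1) hom in \<open>auto simp: cauchy_filters_def\<close>)
  thus ?thesis
    unfolding F(2) G(2) completion_map2_class[OF M f F(1) G(1)] completion_map_class[OF M N h f1]
      completion_map_class[OF M N h F(1)] completion_map_class[OF M N h G(1)]
      completion_map2_class[OF N g h1[OF F(1)] h1[OF G(1)]]
    by simp
qed

lemma continuous_unital_hom_lipschitz:
  assumes M: "gauged_space M" and N: "gauged_space N" and h: "lipschitz_map M N h"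
    and "\<And>x y. x \<in> carrier M \<Longrightarrow> y \<in> carrier M \<Longrightarrow> h (mult M x y) = mult N (h x) (h y)"
    and "\<And>x y. x \<in> carrier M \<Longrightarrow> y \<in> carrier M \<Longrightarrow> h (add M x y) = add N (h x) (h y)"
    and "h (one M) = one N"
    and "\<And>c x. x \<in> carrier M \<Longrightarrow> h (Module.smult M c x) = Module.smult N c (h x)"
  shows "continuous_unital_hom M N h"
  using assms continuous_map_lipschitz[OF M N h]
  by (auto simp: continuous_unital_hom_def ring_hom_def lipschitz_map_def)

lemma continuous_unital_hom_completion:
  assumes M: "topological_algebra M" and N: "topological_algebra N"
    and h: "lipschitz_map M N h" and hom: "continuous_unital_hom M N h"
  shows "continuous_unital_hom (gauge_completion M) (gauge_completion N) (completion_map N h)"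
proof -
  interpret M: topological_algebra M by fact
  interpret N: topological_algebra N by fact
  note gs = M.gauged_space_axioms N.gauged_space_axioms
  have ch: "cauchy_map M N h" by (rule lipschitz_imp_cauchy_map[OF gs h])
  from hom have hom': "\<And>x y. x \<in> carrier M \<Longrightarrow> y \<in> carrier M \<Longrightarrow> h (mult M x y) = mult N (h x) (h y)"
    "\<And>x y. x \<in> carrier M \<Longrightarrow> y \<in> carrier M \<Longrightarrow> h (add M x y) = add N (h x) (h y)"
    "h (one M) = one N" "\<And>c x. x \<in> carrier M \<Longrightarrow> h (Module.smult M c x) = Module.smult N c (h x)"
    by (auto simp: continuous_unital_hom_def ring_hom_def)
  have sel: "mult (gauge_completion M') = completion_map2 M' (mult M')"
    "add (gauge_completion M') = completion_map2 M' (add M')"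
    "one (gauge_completion M') = completion_embed M' (one M')"
    "Module.smult (gauge_completion M') c = completion_map M' (Module.smult M' c)"
    for M' :: "('f, 'g) gauged_algebra" and c by (simp_all add: gauge_completion_def)
  show ?thesis
  proof (rule continuous_unital_hom_lipschitz)
    show "gauged_space (gauge_completion M)" "gauged_space (gauge_completion N)"
      by (rule M.gauged_space_completion N.gauged_space_completion)+
    show "lipschitz_map (gauge_completion M) (gauge_completion N) (completion_map N h)"
      by (rule completion_map_lipschitz[OF gs h])
    show "completion_map N h (one (gauge_completion M)) = one (gauge_completion N)"
      unfolding sel by (simp add: completion_map_embed[OF gs ch M.one_carrier] hom')
    fix X assume X: "X \<in> carrier (gauge_completion M)"
    {
      fix Y assume Y: "Y \<in> carrier (gauge_completion M)"
      show "completion_map N h (X \<otimes>\<^bsub>gauge_completion M\<^esub> Y) =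
          completion_map N h X \<otimes>\<^bsub>gauge_completion N\<^esub> completion_map N h Y"
        unfolding sel
        by (rule completion_map_hom2[where f = "mult M" and g = "mult N"])
          (simp_all add: gs ch M.cauchy_mult N.cauchy_mult hom' X Y)
      show "completion_map N h (X \<oplus>\<^bsub>gauge_completion M\<^esub> Y) =
          completion_map N h X \<oplus>\<^bsub>gauge_completion N\<^esub> completion_map N h Y"
        unfolding sel
        by (rule completion_map_hom2[where f = "add M" and g = "add N"])
          (simp_all add: gs ch M.cauchy_add N.cauchy_add hom' X Y)
    }
    fix c
    from X obtain F where F: "F \<in> cauchy_filters M" "X = cauchy_class M F"
      by (auto simp: M.carrier_completion)
    have h1: "filtermap h F \<in> cauchy_filters N"
      using ch M.cauchy_equiv_refl[OF F(1)] cauchy_equiv_fields unfolding cauchy_map_def by blast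
    have c1: "filtermap (Module.smult M c) F \<in> cauchy_filters M"
      using M.cauchy_smult M.cauchy_equiv_refl[OF F(1)] cauchy_equiv_fields unfolding cauchy_map_def by blast
    have "filtermap h (filtermap (Module.smult M c) F) = filtermap (Module.smult N c) (filtermap h F)"
      unfolding filtermap_filtermap
      by (rule filtermap_cong_carrier[of _ "carrier M"]) (use F(1) hom' in \<open>auto simp: cauchy_filters_def\<close>)
    thus "completion_map N h (c \<odot>\<^bsub>gauge_completion M\<^esub> X) = c \<odot>\<^bsub>gauge_completion N\<^esub> completion_map N h X"
      unfolding sel F(2) completion_map_class[OF gs(1,1) M.cauchy_smult F(1)]
        completion_map_class[OF gs ch F(1)] completion_map_class[OF gs ch c1]
        completion_map_class[OF gs(2,2) N.cauchy_smult h1]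
      by simp
  qed
qed

text \<open>The identity is asked on the carrier only, since the corresponding identity of induced
  maps is proved on the span of the pure tensors.\<close>

lemma completion_map_comp:
  assumes M: "gauged_space M" and N: "gauged_space N" and K: "gauged_space K"
    and h: "cauchy_map M N h" and g: "cauchy_map N K g" and f: "cauchy_map M K f"
    and fgh: "\<And>x. x \<in> carrier M \<Longrightarrow> f x = g (h x)"
    and X: "X \<in> carrier (gauge_completion M)"
  shows "completion_map K f X = completion_map K g (completion_map N h X)"
proof -
  interpret M: gauged_space M by fact
  from X obtain F where F: "F \<in> cauchy_filters M" "X = cauchy_class M F"
    by (auto simp: M.carrier_completion)
  have h1: "filtermap h F \<in> cauchy_filters N"
    using h M.cauchy_equiv_refl[OF F(1)] cauchy_equiv_fields unfolding cauchy_map_def by blast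
  have "filtermap f F = filtermap g (filtermap h F)"
    unfolding filtermap_filtermap
    by (rule filtermap_cong_carrier[of _ "carrier M"]) (use F(1) fgh in \<open>auto simp: cauchy_filters_def\<close>)
  thus ?thesis
    unfolding F(2) completion_map_class[OF M N h F(1)] completion_map_class[OF N K g h1]
      completion_map_class[OF M K f F(1)] by simp
qed

lemma completion_map_ident:
  assumes M: "gauged_space M" and f: "cauchy_map M M f" and id: "\<And>x. x \<in> carrier M \<Longrightarrow> f x = x"
    and X: "X \<in> carrier (gauge_completion M)"
  shows "completion_map M f X = X"
proof -
  interpret M: gauged_space M by fact
  from X obtain F where F: "F \<in> cauchy_filters M" "X = cauchy_class M F"
    by (auto simp: M.carrier_completion)
  have "filtermap f F = filtermap id F"
    by (rule filtermap_cong_carrier[of _ "carrier M"]) (use F(1) id in \<open>auto simp: cauchy_filters_def\<close>)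
  thus ?thesis
    unfolding F(2) completion_map_class[OF M M f F(1)] by (simp add: filtermap_ident id_def)
qed

section \<open>Bounded representations of tensors\<close>

text \<open>As simplification rules these two also match eta-expanded terms and hide the vector space
  structure of functions.\<close>

declare plus_fun_apply [simp del] zero_fun_apply [simp del]
lemmas fun_apply = plus_fun_apply zero_fun_apply

lemma tscale_simps [simp]:
  fixes s t :: "'x \<Rightarrow> 'k::comm_ring_1"
  shows "tscale c (s + t) = tscale c s + tscale c t" "tscale (a + b) t = tscale a t + tscale b t"
    "tscale a (tscale b t) = tscale (a * b) t" "tscale 1 t = t" "tscale c 0 = (0 :: 'x \<Rightarrow> 'k)"
    "tscale 0 t = 0"
  by (auto simp: fun_apply tscale_def fun_eq_iff algebra_simps)

lemma tscale_apply: "tscale c t x = c * t x"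
  by (simp add: tscale_def)

lemma tscale_sum: "tscale c (\<Sum>x\<in>X. t x) = (\<Sum>x\<in>X. tscale c (t x :: 'x \<Rightarrow> 'k::comm_ring_1))"
  by (induction X rule: infinite_finite_induct) simp_all

interpretation tensor: vector_space "tscale :: 'k::field \<Rightarrow> ('x \<Rightarrow> 'k) \<Rightarrow> _"
  by unfold_locales (simp_all add: algebra_simps)

abbreviation tspan :: "('i \<Rightarrow> 'x \<Rightarrow> 'k::field) \<Rightarrow> ('x \<Rightarrow> 'k) set" where
  "tspan P \<equiv> Modules.module.span tscale (range P)"

lemma tspan_induct [consumes 1, case_names zero add]:
  assumes "t \<in> tspan P" and "Q 0" and "\<And>c i t. t \<in> tspan P \<Longrightarrow> Q t \<Longrightarrow> Q (tscale c (P i) + t)"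
  shows "Q t"
proof -
  have "t \<in> tspan P \<and> Q t" using assms(1)
  proof (induction rule: tensor.span_induct_alt)
    case base
    show ?case using assms(2) tensor.span_zero by blast
  next
    case (step c x y)
    thus ?case using assms(3) by (auto simp: tensor.span_base intro!: tensor.span_add tensor.span_scale)
  qed
  thus ?thesis by blast
qed

text \<open>Linearity on the span is what \<open>tensor_pair V a\<close> has: it rests on
  multilinearity of the functions fed to \<open>a\<close>, which holds when the second argument is
  in the span.\<close>

definition span_linear :: "('i \<Rightarrow> 'x \<Rightarrow> 'k::field) \<Rightarrow> (('x \<Rightarrow> 'k) \<Rightarrow> ('y \<Rightarrow> 'k)) \<Rightarrow> bool" where
  "span_linear P \<Phi> \<longleftrightarrow> (\<forall>s\<in>tspan P. \<forall>t\<in>tspan P. \<Phi> (s + t) = \<Phi> s + \<Phi> t) \<and>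
     (\<forall>c. \<forall>t\<in>tspan P. \<Phi> (tscale c t) = tscale c (\<Phi> t))"

lemma span_linear_step:
  assumes "span_linear P \<Phi>" "t \<in> tspan P"
  shows "\<Phi> (tscale c (P i) + t) = tscale c (\<Phi> (P i)) + \<Phi> t"
proof -
  have Pi: "P i \<in> tspan P" by (simp add: tensor.span_base)
  moreover have "tscale c (P i) \<in> tspan P" by (intro tensor.span_scale Pi)
  ultimately show ?thesis using assms unfolding span_linear_def by auto
qed

lemma span_linear_0:
  assumes "span_linear P \<Phi>"
  shows "\<Phi> 0 = 0"
proof -
  have "\<Phi> (tscale 0 0) = tscale 0 (\<Phi> 0)"
    using assms tensor.span_zero unfolding span_linear_def by blast
  thus ?thesis by simp
qed

lemma span_linear_image:
  assumes "span_linear P \<Phi>" "\<And>i. \<Phi> (P i) \<in> tspan Q" "t \<in> tspan P"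
  shows "\<Phi> t \<in> tspan Q"
  using assms(3)
proof (induction rule: tspan_induct)
  case zero
  show ?case by (simp add: span_linear_0[OF assms(1)] tensor.span_zero)
next
  case (add c i t)
  thus ?case
    by (simp add: span_linear_step[OF assms(1)] tensor.span_add tensor.span_scale assms(2))
qed

lemma span_linear_eq:
  assumes "span_linear P \<Phi>" "span_linear P \<Psi>" "\<And>i. \<Phi> (P i) = \<Psi> (P i)" "t \<in> tspan P"
  shows "\<Phi> t = \<Psi> t"
  using assms(4)
  by (induction rule: tspan_induct)
    (simp_all add: span_linear_step[OF assms(1)] span_linear_step[OF assms(2)] assms(3)
      span_linear_0[OF assms(1)] span_linear_0[OF assms(2)])

text \<open>A weighted projective seminorm with its infimum removed: a finite representation of cost
  at most \<open>r\<close> is exhibited. With the zero weight it merely certifies that a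
  representation exists.\<close>

definition rep_bound ::
    "('i \<Rightarrow> 'x \<Rightarrow> 'k::real_normed_field) \<Rightarrow> ('i \<Rightarrow> real) \<Rightarrow> ('x \<Rightarrow> 'k) \<Rightarrow> real \<Rightarrow> bool" where
  "rep_bound P w t r \<longleftrightarrow>
     (\<exists>L. t = (\<Sum>(c, i)\<leftarrow>L. tscale c (P i)) \<and> (\<Sum>(c, i)\<leftarrow>L. norm c * w i) \<le> r)"

lemma rep_bound_0: "rep_bound P w 0 0"
  unfolding rep_bound_def by (intro exI[of _ "[]"]) simp

lemma rep_bound_mono: "rep_bound P w t r \<Longrightarrow> r \<le> s \<Longrightarrow> rep_bound P w t s"
  unfolding rep_bound_def using order_trans by blast

lemma rep_bound_add:
  assumes "rep_bound P w s q" "rep_bound P w t r"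
  shows "rep_bound P w (s + t) (q + r)"
proof -
  from assms obtain L L' where "s = (\<Sum>(c, i)\<leftarrow>L. tscale c (P i))" "(\<Sum>(c, i)\<leftarrow>L. norm c * w i) \<le> q"
    "t = (\<Sum>(c, i)\<leftarrow>L'. tscale c (P i))" "(\<Sum>(c, i)\<leftarrow>L'. norm c * w i) \<le> r"
    unfolding rep_bound_def by blast
  thus ?thesis unfolding rep_bound_def by (intro exI[of _ "L @ L'"]) simp
qed

lemma rep_bound_scale:
  assumes "rep_bound P w t r"
  shows "rep_bound P w (tscale c t) (norm c * r)"
proof -
  from assms obtain L where L: "t = (\<Sum>(c, i)\<leftarrow>L. tscale c (P i))" "(\<Sum>(c, i)\<leftarrow>L. norm c * w i) \<le> r"
    unfolding rep_bound_def by blast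
  let ?L = "map (\<lambda>(a, i). (c * a, i)) L"
  have "tscale c (\<Sum>(c, i)\<leftarrow>L. tscale c (P i)) = (\<Sum>(c, i)\<leftarrow>?L. tscale c (P i))"
    by (induction L) auto
  moreover have "(\<Sum>(c, i)\<leftarrow>?L. norm c * w i) = norm c * (\<Sum>(c, i)\<leftarrow>L. norm c * w i)"
    by (induction L) (auto simp: norm_mult algebra_simps)
  ultimately show ?thesis
    unfolding rep_bound_def using L by (intro exI[of _ ?L]) (simp add: mult_left_mono)
qed

lemma rep_bound_base: "rep_bound P w (P i) (w i)"
  unfolding rep_bound_def by (intro exI[of _ "[(1, i)]"]) simp

lemma rep_bound_sum:
  "(\<And>x. x \<in> X \<Longrightarrow> rep_bound P w (t x) (r x)) \<Longrightarrow> rep_bound P w (\<Sum>x\<in>X. t x) (\<Sum>x\<in>X. r x)"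
  by (induction X rule: infinite_finite_induct) (simp_all add: rep_bound_0 rep_bound_add)

lemma rep_bound_span: "rep_bound P w t r \<Longrightarrow> t \<in> tspan P"
proof -
  have "(\<Sum>(c, i)\<leftarrow>L. tscale c (P i)) \<in> tspan P" for L
    by (induction L) (auto simp: tensor.span_base tensor.span_zero intro!: tensor.span_add tensor.span_scale)
  thus "rep_bound P w t r \<Longrightarrow> t \<in> tspan P" unfolding rep_bound_def by blast
qed

lemma span_rep_bound: "t \<in> tspan P \<Longrightarrow> \<exists>r. rep_bound P w t r"
  by (induction rule: tspan_induct) (blast intro: rep_bound_0 rep_bound_add rep_bound_scale rep_bound_base)+

text \<open>A representation of \<open>t\<close> is mapped term by term and the costs add up, so it
  is enough to bound the map on generators. The estimates for contraction, product and induced map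
  all reduce to this.\<close>

lemma rep_bound_linear:
  assumes lin: "span_linear P \<Phi>" and C: "0 \<le> C"
    and bd: "\<And>i. rep_bound Q w' (\<Phi> (P i)) (C * w i)"
    and t: "rep_bound P w t r"
  shows "rep_bound Q w' (\<Phi> t) (C * r)"
proof -
  from t obtain L where L: "t = (\<Sum>(c, i)\<leftarrow>L. tscale c (P i))" "(\<Sum>(c, i)\<leftarrow>L. norm c * w i) \<le> r"
    unfolding rep_bound_def by blast
  have "rep_bound Q w' (\<Phi> (\<Sum>(c, i)\<leftarrow>L. tscale c (P i))) (C * (\<Sum>(c, i)\<leftarrow>L. norm c * w i))"
  proof (induction L)
    case Nil
    show ?case by (simp add: span_linear_0[OF lin] rep_bound_0)
  next
    case (Cons x L)
    obtain c i where x: "x = (c, i)" by fastforce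
    have "(\<Sum>(c, i)\<leftarrow>L. tscale c (P i)) \<in> tspan P"
      by (rule rep_bound_span[of _ "\<lambda>_. 0" _ "\<Sum>(c, i)\<leftarrow>L. norm c * 0"])
        (unfold rep_bound_def, blast)
    hence "\<Phi> (\<Sum>(c, i)\<leftarrow>x # L. tscale c (P i)) = tscale c (\<Phi> (P i)) + \<Phi> (\<Sum>(c, i)\<leftarrow>L. tscale c (P i))"
      by (simp add: x span_linear_step[OF lin])
    moreover have "rep_bound Q w' \<dots> (norm c * (C * w i) + C * (\<Sum>(c, i)\<leftarrow>L. norm c * w i))"
      by (intro rep_bound_add rep_bound_scale bd Cons.IH)
    ultimately show ?case by (simp add: x algebra_simps)
  qed
  thus ?thesis unfolding L(1) by (rule rep_bound_mono) (use L(2) C in \<open>simp add: mult_left_mono\<close>)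
qed

section \<open>Linear extensions\<close>

lemma lin_extend_add: "lin_extend \<Phi> (s + t) = lin_extend \<Phi> s + lin_extend \<Phi> t"
  and lin_extend_scale: "lin_extend \<Phi> (tscale c t) = tscale c (lin_extend \<Phi> t)"
  and lin_extend_0: "lin_extend \<Phi> 0 = 0"
  by (simp_all add: fun_apply lin_extend_def tscale_def fun_eq_iff)

lemma lin_extend_sum:
  fixes \<Phi> :: "'i \<Rightarrow> 'x \<Rightarrow> 'k::comm_ring_1"
  shows "lin_extend \<Phi> (\<Sum>x\<in>X. t x) = (\<Sum>x\<in>X. lin_extend \<Phi> (t x))"
  by (induction X rule: infinite_finite_induct) (simp_all add: lin_extend_add lin_extend_0)

lemma span_linear_lin_extend: "span_linear P (lin_extend \<Phi>)"
  by (simp add: span_linear_def lin_extend_add lin_extend_scale)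

section \<open>Tensors as functionals on multilinear forms, and bilinearity of the star
  product\<close>

context poisson_space
begin

text \<open>This includes every \<open>f\<close> that is not multilinear, where all values are 0;
  that is why \<open>lin_extend_pure\<close> can demand multilinearity at every
  \<open>f\<close>.\<close>

lemma multilinear_pure: "multilinear_form V (\<lambda>xs. pure V xs f)"
  by (cases "multilinear_form V f") (simp_all add: pure_def multilinear_form_0)

lemma multilinear_form2D:
  assumes "multilinear_form2 V f"
  shows "multilinear_form V (\<lambda>xs. f (xs, ys))" "multilinear_form V (\<lambda>ys. f (xs, ys))"
  using spec[OF conjunct1[OF assms[unfolded multilinear_form2_def]], of ys]
    spec[OF conjunct2[OF assms[unfolded multilinear_form2_def]], of xs] .

lemma multilinear_form2I:
  assumes "\<And>ys. multilinear_form V (\<lambda>xs. f (xs, ys))" "\<And>xs. multilinear_form V (\<lambda>ys. f (xs, ys))"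
  shows "multilinear_form2 V f"
  unfolding multilinear_form2_def by (intro conjI allI assms)

lemma multilinear_pure2:
  "multilinear_form V (\<lambda>xs. pure2 V xs ys f)" "multilinear_form V (\<lambda>ys. pure2 V xs ys f)"
  unfolding pure2_def
  by (cases "multilinear_form2 V f", simp_all only: multilinear_form2D multilinear_form_0 if_True if_False simp_thms)+

lemma lin_extend_pure:
  "(\<And>f. multilinear_form V (\<lambda>xs. \<Phi> xs f)) \<Longrightarrow> lin_extend \<Phi> (pure V xs) = \<Phi> xs"
  by (simp add: lin_extend_def pure_def)

lemma lin_extend_pure2:
  "(\<And>f. multilinear_form2 V (\<lambda>u. \<Phi> u f)) \<Longrightarrow> lin_extend \<Phi> (pure2 V xs ys) = \<Phi> (xs, ys)"
  by (simp add: lin_extend_def pure2_def)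

text \<open>Additivity in the argument of the functional \<open>a\<close>, not in \<open>a\<close>:
  it holds for pure tensors at multilinear arguments and passes to their span. Linearity of
  \<open>tensor_pair\<close> in its second factor comes from here.\<close>

lemma tensor_additive:
  assumes "a \<in> tspan (pure V)" "multilinear_form V f" "multilinear_form V g"
  shows "a (\<lambda>xs. f xs + g xs) = a f + a g"
proof -
  have fg: "multilinear_form V (\<lambda>xs. f xs + g xs)"
    using assms(2,3) unfolding multilinear_form_def linear_form_iff by (simp add: algebra_simps)
  show ?thesis using assms(1)
    by (induction rule: tspan_induct)
      (simp_all add: fun_apply tscale_apply pure_apply fg assms(2,3) algebra_simps)
qed

lemma tensor_homogeneous:
  assumes "a \<in> tspan (pure V)" "multilinear_form V f"
  shows "a (\<lambda>xs. c * f xs) = c * a f"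
  using assms(1)
  by (induction rule: tspan_induct)
    (simp_all add: fun_apply tscale_apply pure_apply multilinear_form_cmult assms(2) algebra_simps)

lemma multilinear_tensor:
  assumes b: "b \<in> tspan P" and f: "\<And>i. multilinear_form V (\<lambda>xs. P i (F xs))"
  shows "multilinear_form V (\<lambda>xs. b (F xs))"
  using b
proof (induction rule: tspan_induct)
  case zero
  show ?case by (simp add: fun_apply multilinear_form_0)
next
  case (add c i t)
  have *: "multilinear_form V (\<lambda>xs. c * P i (F xs))" by (rule multilinear_form_cmult[OF f])
  show ?case using add * unfolding multilinear_form_def linear_form_iff
    by (simp add: fun_apply tscale_apply algebra_simps)
qed

lemma multilinear_tensor_pure2:
  assumes "b \<in> tspan (pure V)"
  shows "multilinear_form V (\<lambda>xs. b (\<lambda>ys. pure2 V xs ys f))"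
proof (rule multilinear_tensor[where F = "\<lambda>xs ys. pure2 V xs ys f", OF assms])
  fix ys
  have "pure V ys (\<lambda>ys. pure2 V xs ys f) = pure2 V xs ys f" for xs
    by (rule pure_apply[OF multilinear_pure2(2)])
  thus "multilinear_form V (\<lambda>xs. pure V ys (\<lambda>ys. pure2 V xs ys f))"
    using multilinear_pure2(1) by simp
qed

lemma tensor_pair_apply: "tensor_pair V a b f = a (\<lambda>xs. b (\<lambda>ys. pure2 V xs ys f))"
  by (simp add: tensor_pair_def lin_extend_def)

lemma span_linear_tensor_pair1: "span_linear P (\<lambda>a. tensor_pair V a b)"
  unfolding tensor_pair_def by (rule span_linear_lin_extend)

lemma span_linear_tensor_pair2:
  assumes "a \<in> tspan (pure V)"
  shows "span_linear (pure V) (tensor_pair V a)"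
proof -
  have mult: "multilinear_form V (\<lambda>xs. t (\<lambda>ys. pure2 V xs ys f))" if "t \<in> tspan (pure V)" for t f
    using that by (rule multilinear_tensor_pure2)
  have "tensor_pair V a (s + t) f = (tensor_pair V a s + tensor_pair V a t) f"
    if st: "s \<in> tspan (pure V)" "t \<in> tspan (pure V)" for s t f
    using tensor_additive[OF assms mult[OF st(1), of f] mult[OF st(2), of f]]
    by (simp only: tensor_pair_apply plus_fun_apply)
  moreover have "tensor_pair V a (tscale c t) f = tscale c (tensor_pair V a t) f"
    if t: "t \<in> tspan (pure V)" for c t f
    using tensor_homogeneous[OF assms mult[OF t, of f], of c]
    by (simp only: tensor_pair_apply tscale_apply)
  ultimately show ?thesis unfolding span_linear_def fun_eq_iff by blast
qed

lemma tensor_pair_pure: "tensor_pair V (pure V xs) (pure V ys) = pure2 V xs ys"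
proof
  fix f
  have "pure V ys (\<lambda>ys. pure2 V xs ys f) = pure2 V xs ys f" for xs
    by (rule pure_apply[OF multilinear_pure2(2)])
  thus "tensor_pair V (pure V xs) (pure V ys) f = pure2 V xs ys f"
    unfolding tensor_pair_apply by (simp only: pure_apply[OF multilinear_pure2(1)])
qed

abbreviation pure_pair :: "'v list \<times> 'v list \<Rightarrow> ('k, 'v list \<times> 'v list) tensor" where
  "pure_pair \<equiv> (\<lambda>(xs, ys). pure2 V xs ys)"

text \<open>The cross-norm estimate, by one linear extension per factor: first \<open>a\<close>
  varies against a pure right factor, then \<open>b\<close> varies with \<open>a\<close> fixed. In
  the second extension \<open>r\<close> is the constant and so has to be nonnegative.\<close>

lemma rep_bound_tensor_pair:
  assumes w: "\<And>xs. 0 \<le> w xs" and a: "rep_bound (pure V) w a r" and b: "rep_bound (pure V) w b s"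
    and r: "0 \<le> r"
  shows "rep_bound pure_pair (\<lambda>(xs, ys). w xs * w ys) (tensor_pair V a b) (r * s)"
proof -
  let ?W = "\<lambda>(xs, ys). w xs * w ys"
  have base: "rep_bound pure_pair ?W (tensor_pair V (pure V xs) (pure V ys)) (w ys * w xs)" for xs ys
    using rep_bound_base[of pure_pair ?W "(xs, ys)"] by (simp add: tensor_pair_pure mult.commute)
  have "rep_bound pure_pair ?W (tensor_pair V a (pure V ys)) (w ys * r)" for ys
    by (rule rep_bound_linear[where P = "pure V" and w = w and \<Phi> = "\<lambda>a. tensor_pair V a (pure V ys)",
        OF span_linear_tensor_pair1 w base a])
  hence base2: "rep_bound pure_pair ?W (tensor_pair V a (pure V ys)) (r * w ys)" for ys
    by (simp add: mult.commute)
  have lin: "span_linear (pure V) (tensor_pair V a)"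
    by (rule span_linear_tensor_pair2[OF rep_bound_span[OF a]])
  show ?thesis
    by (rule rep_bound_linear[where P = "pure V" and w = w and \<Phi> = "tensor_pair V a", OF lin r base2 b])
qed

lemma tensor_pair_span:
  assumes "a \<in> tspan (pure V)" "b \<in> tspan (pure V)"
  shows "tensor_pair V a b \<in> tspan pure_pair"
proof -
  from span_rep_bound[OF assms(1)] obtain r where a: "rep_bound (pure V) (\<lambda>_. 0) a r" ..
  from span_rep_bound[OF assms(2)] obtain s where b: "rep_bound (pure V) (\<lambda>_. 0) b s" ..
  \<comment> \<open>The bound is raised to a nonnegative number because it is about to serve as a
    factor; with the zero weight only the representation matters.\<close>
  have "rep_bound (pure V) (\<lambda>_. 0) a (max 0 r)" by (rule rep_bound_mono[OF a]) simp
  hence "rep_bound pure_pair (\<lambda>(xs, ys). 0 * 0) (tensor_pair V a b) (max 0 r * s)"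
    by (intro rep_bound_tensor_pair[where w = "\<lambda>_. 0"] b) simp_all
  thus ?thesis by (rule rep_bound_span)
qed

lemma multilinear_permute_tensor:
  "multilinear_form V (\<lambda>xs. tscale (1 / fact (length xs))
     (\<Sum>\<sigma> | \<sigma> permutes {..<length xs}. permute_tensor V \<sigma> xs) f)"
proof (cases "multilinear_form V f")
  case True
  from multilinear_symmetrize[OF True] show ?thesis
    using True by (simp add: sum_tensor_apply tscale_def permute_tensor_def pure_apply)
next
  case False
  thus ?thesis
    by (simp add: sum_tensor_apply tscale_def permute_tensor_def pure_apply_not multilinear_form_0)
qed

lemma symmetrize_pure: "symmetrize V (pure V xs) = tscale (1 / fact (length xs))
     (\<Sum>\<sigma> | \<sigma> permutes {..<length xs}. permute_tensor V \<sigma> xs)"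
  unfolding symmetrize_def by (rule lin_extend_pure[OF multilinear_permute_tensor])

lemma symmetrize_span:
  assumes "t \<in> tspan (pure V)"
  shows "symmetrize V t \<in> tspan (pure V)"
proof (rule span_linear_image[OF _ _ assms])
  show "span_linear (pure V) (symmetrize V)"
    unfolding symmetrize_def by (rule span_linear_lin_extend)
  fix xs
  show "symmetrize V (pure V xs) \<in> tspan (pure V)"
    unfolding symmetrize_pure permute_tensor_def
    by (intro tensor.span_scale tensor.span_sum tensor.span_base) auto
qed

lemma symmetric_algebra_subset: "symmetric_algebra V \<subseteq> tspan (pure V)"
  unfolding symmetric_algebra_def tensor_algebra_def using symmetrize_span by blast

lemma symmetrize_add: "symmetrize V (s + t) = symmetrize V s + symmetrize V t"
  and symmetrize_scale: "symmetrize V (tscale c t) = tscale c (symmetrize V t)"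
  and symmetrize_0: "symmetrize V 0 = 0"
  by (simp_all add: symmetrize_def lin_extend_add lin_extend_scale lin_extend_0)

lemma symmetric_algebra_add:
  assumes "a \<in> symmetric_algebra V" "b \<in> symmetric_algebra V"
  shows "a + b \<in> symmetric_algebra V"
  using assms unfolding symmetric_algebra_def tensor_algebra_def
  by (auto simp: symmetrize_add[symmetric] intro!: imageI tensor.span_add)

lemma symmetric_algebra_scale:
  assumes "a \<in> symmetric_algebra V"
  shows "tscale c a \<in> symmetric_algebra V"
  using assms unfolding symmetric_algebra_def tensor_algebra_def
  by (auto simp: symmetrize_scale[symmetric] intro!: imageI tensor.span_scale)

lemma symmetric_algebra_0: "0 \<in> symmetric_algebra V"
  unfolding symmetric_algebra_def tensor_algebra_def
  by (rule image_eqI[of _ _ 0]) (simp_all add: symmetrize_0 tensor.span_zero)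

lemma symmetric_algebra_sum:
  "(\<And>x. x \<in> X \<Longrightarrow> a x \<in> symmetric_algebra V) \<Longrightarrow> (\<Sum>x\<in>X. a x) \<in> symmetric_algebra V"
  by (induction X rule: infinite_finite_induct) (simp_all add: symmetric_algebra_0 symmetric_algebra_add)

lemma pure_Nil_symmetric: "pure V [] \<in> symmetric_algebra V"
proof -
  have "{\<sigma>. \<sigma> permutes ({} :: nat set)} = {id}" by auto
  moreover have "parities 0 = {[]}" by (auto simp: parities_def)
  ultimately have "symmetrize V (pure V []) = pure V []"
    by (simp add: symmetrize_pure permute_tensor_def koszul_sign_def components_def)
  thus ?thesis unfolding symmetric_algebra_def tensor_algebra_def
    by (intro image_eqI[of _ _ "pure V []"]) (simp_all add: tensor.span_base)
qed

lemma lin_extend_append_pure2: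
  "lin_extend (\<lambda>(xs, ys). pure V (xs @ ys)) (pure2 V xs ys) = pure V (xs @ ys)"
proof -
  have "multilinear_form2 V (\<lambda>u. (case u of (xs, ys) \<Rightarrow> pure V (xs @ ys)) f)" for f
  proof (rule multilinear_form2I; unfold prod.case)
    have *: "multilinear_form V (\<lambda>xs. pure V xs f)" by (rule multilinear_pure)
    show "multilinear_form V (\<lambda>xs. pure V (xs @ ys) f)" for ys
      using * unfolding multilinear_form_def by simp
    show "multilinear_form V (\<lambda>ys. pure V (xs @ ys) f)" for xs
      unfolding multilinear_form_def
    proof (intro allI)
      fix us ws
      show "Vector_Spaces.linear (scl V) (*) (\<lambda>v. pure V (xs @ us @ v # ws) f)"
        using *[unfolded multilinear_form_def, rule_format, of "xs @ us" ws] by (simp only: append_assoc)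
    qed
  qed
  from lin_extend_pure2[of "\<lambda>(xs, ys). pure V (xs @ ys)", OF this] show ?thesis by simp
qed

lemma sym_mult_symmetric:
  assumes "t \<in> tspan pure_pair"
  shows "sym_mult V t \<in> symmetric_algebra V"
  unfolding sym_mult_def symmetric_algebra_def tensor_algebra_def
  by (intro imageI span_linear_image[OF span_linear_lin_extend _ assms])
    (auto simp: lin_extend_append_pure2 intro: tensor.span_base)

text \<open>\<open>lin_extend\<close> returns its formula on generators once the formula is
  multilinear in both lists; rewriting it through \<open>contraction_term\<close> supplies
  this.\<close>

lemma contraction_pure2:
  "contraction V (pure2 V xs ys) =
     (\<Sum>d\<in>parities (length xs). \<Sum>e\<in>parities (length ys). \<Sum>k<length xs. \<Sum>l<length ys.
       tscale (contraction_sign d k e l * form V (components V d xs ! k) (components V e ys ! l))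
         (pure2 V (omit k (components V d xs)) (omit l (components V e ys))))"
proof -
  let ?\<Phi> = "\<lambda>(xs, ys). \<Sum>d\<in>parities (length xs). \<Sum>e\<in>parities (length ys). \<Sum>k<length xs. \<Sum>l<length ys.
       tscale (contraction_sign d k e l * form V (components V d xs ! k) (components V e ys ! l))
         (pure2 V (omit k (components V d xs)) (omit l (components V e ys)))"
  have "multilinear_form2 V (\<lambda>u. ?\<Phi> u f)" for f
  proof (cases "multilinear_form2 V f")
    case True
    have "(\<lambda>u. ?\<Phi> u f) = (\<lambda>(xs, ys). \<Sum>d\<in>parities (length xs). \<Sum>e\<in>parities (length ys).
        contraction_term f d e (components V d xs) (components V e ys))"
      using True by (auto simp: fun_eq_iff sum_tensor_apply tscale_def pure2_def contraction_term_def
        parities_def mult.assoc intro!: sum.cong)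
    thus ?thesis using contraction_apply(2)[OF True] by simp
  next
    case False
    hence "(\<lambda>u. ?\<Phi> u f) = (\<lambda>_. 0)"
      by (auto simp: fun_eq_iff sum_tensor_apply tscale_def pure2_def)
    thus ?thesis using multilinear_form2_0 by simp
  qed
  from lin_extend_pure2[of ?\<Phi>, OF this] show ?thesis by (simp add: contraction_def)
qed

lemma contraction_span:
  assumes "t \<in> tspan pure_pair"
  shows "contraction V t \<in> tspan pure_pair"
proof (rule span_linear_image[OF _ _ assms])
  show "span_linear pure_pair (contraction V)"
    unfolding contraction_def by (rule span_linear_lin_extend)
  have base: "pure2 V xs ys \<in> tspan pure_pair" for xs ys
    by (rule tensor.span_base) (auto intro: image_eqI[of _ _ "(xs, ys)"])
  fix u
  show "contraction V (pure_pair u) \<in> tspan pure_pair"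
    by (cases u) (simp add: contraction_pure2 tensor.span_sum tensor.span_scale base)
qed

lemma contraction_power_span: "t \<in> tspan pure_pair \<Longrightarrow> (contraction V ^^ k) t \<in> tspan pure_pair"
  by (induction k) (simp_all add: contraction_span)

lemma contraction_power_add: "(contraction V ^^ k) (s + t) = (contraction V ^^ k) s + (contraction V ^^ k) t"
  by (induction k) (simp_all add: contraction_def lin_extend_add)

lemma contraction_power_scale: "(contraction V ^^ k) (tscale c t) = tscale c ((contraction V ^^ k) t)"
  by (induction k) (simp_all add: contraction_def lin_extend_scale)

lemma contraction_power_0: "(contraction V ^^ k) 0 = 0"
  by (induction k) (simp_all add: contraction_def lin_extend_0)

lemma contraction_power_sum: "(contraction V ^^ k) (\<Sum>x\<in>X. t x) = (\<Sum>x\<in>X. (contraction V ^^ k) (t x))"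
  by (induction X rule: infinite_finite_induct) (simp_all add: contraction_power_add contraction_power_0)

text \<open>Each contraction removes one entry of the first list, so after
  \<open>length xs + 1\<close> of them no term survives. This is what makes the star product a
  finite sum.\<close>

lemma contraction_power_pure2: "length xs < k \<Longrightarrow> (contraction V ^^ k) (pure2 V xs ys) = 0"
proof (induction k arbitrary: xs ys)
  case (Suc k)
  have "(contraction V ^^ k) (pure2 V (omit i (components V d xs)) zs) = 0"
    if "i < length xs" "d \<in> parities (length xs)" for i d zs
    using Suc that by (intro Suc.IH) (auto simp: parities_def length_omit)
  thus ?case
    unfolding funpow_Suc_right o_apply contraction_pure2
    by (simp add: contraction_power_sum contraction_power_scale)
qed simp

lemma contraction_nilpotent: "t \<in> tspan pure_pair \<Longrightarrow> \<exists>N. \<forall>k\<ge>N. (contraction V ^^ k) t = 0"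
proof (induction rule: tspan_induct)
  case zero
  show ?case by (simp add: contraction_power_0)
next
  case (add c u t)
  then obtain N where N: "\<forall>k\<ge>N. (contraction V ^^ k) t = 0" by blast
  obtain xs ys where u: "u = (xs, ys)" by fastforce
  show ?case
    using N contraction_power_pure2[of xs _ ys]
    by (intro exI[of _ "max N (Suc (length xs))"])
      (auto simp: u contraction_power_add contraction_power_scale Suc_le_eq)
qed

text \<open>\<open>star\<close> sums over those \<open>k\<close> whose contraction power is nonzero,
  a set that changes with the arguments. A fixed cut-off \<open>N\<close> gives an expression linear
  in \<open>t\<close>, with which \<open>star\<close> agrees for all large \<open>N\<close>.\<close>

definition star_sum :: "'k \<Rightarrow> nat \<Rightarrow> ('k, 'v list \<times> 'v list) tensor \<Rightarrow> ('k, 'v list) tensor" where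
  "star_sum z N t = (\<Sum>k<N. tscale (z ^ k / fact k) (sym_mult V ((contraction V ^^ k) t)))"

lemma star_eq_star_sum:
  assumes "a \<in> tspan (pure V)" "b \<in> tspan (pure V)"
  obtains N where "\<And>n. N \<le> n \<Longrightarrow> star V z a b = star_sum z n (tensor_pair V a b)"
proof -
  from contraction_nilpotent[OF tensor_pair_span[OF assms]]
  obtain N where N: "\<And>k. N \<le> k \<Longrightarrow> (contraction V ^^ k) (tensor_pair V a b) = 0" by blast
  have "star V z a b = star_sum z n (tensor_pair V a b)" if "N \<le> n" for n
    unfolding star_def star_sum_def
  proof (rule sum.mono_neutral_left)
    show "{k. (contraction V ^^ k) (tensor_pair V a b) \<noteq> 0} \<subseteq> {..<n}"
      using N that by (auto simp: not_le[symmetric])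
  qed (simp_all add: sym_mult_def symmetrize_def lin_extend_0)
  thus ?thesis by (rule that)
qed

lemma sym_mult_add: "sym_mult V (s + t) = sym_mult V s + sym_mult V t"
  and sym_mult_scale: "sym_mult V (tscale c t) = tscale c (sym_mult V t)"
  by (simp_all add: sym_mult_def symmetrize_def lin_extend_add lin_extend_scale)

lemma star_sum_add: "star_sum z N (s + t) = star_sum z N s + star_sum z N t"
  and star_sum_scale: "star_sum z N (tscale c t) = tscale c (star_sum z N t)"
  by (simp_all add: star_sum_def contraction_power_add contraction_power_scale sym_mult_add sym_mult_scale
      sum.distrib tscale_sum mult.commute)

lemma span_linear_star_sum: "span_linear P (star_sum z N)"
  by (simp add: span_linear_def star_sum_add star_sum_scale)

lemma star_symmetric:
  assumes "a \<in> tspan (pure V)" "b \<in> tspan (pure V)"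
  shows "star V z a b \<in> symmetric_algebra V"
proof -
  from star_eq_star_sum[OF assms] obtain N where "star V z a b = star_sum z N (tensor_pair V a b)" by blast
  thus ?thesis
    by (simp add: star_sum_def symmetric_algebra_sum symmetric_algebra_scale sym_mult_symmetric
        contraction_power_span tensor_pair_span assms)
qed

lemma star_add_left:
  assumes "a \<in> tspan (pure V)" "a' \<in> tspan (pure V)" "b \<in> tspan (pure V)"
  shows "star V z (a + a') b = star V z a b + star V z a' b"
proof -
  have aa: "a + a' \<in> tspan (pure V)" using assms by (simp add: tensor.span_add)
  obtain N1 where 1: "\<And>n. N1 \<le> n \<Longrightarrow> star V z a b = star_sum z n (tensor_pair V a b)"
    using star_eq_star_sum[OF assms(1,3)] by blast
  obtain N2 where 2: "\<And>n. N2 \<le> n \<Longrightarrow> star V z a' b = star_sum z n (tensor_pair V a' b)"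
    using star_eq_star_sum[OF assms(2,3)] by blast
  obtain N3 where 3: "\<And>n. N3 \<le> n \<Longrightarrow> star V z (a + a') b = star_sum z n (tensor_pair V (a + a') b)"
    using star_eq_star_sum[OF aa assms(3)] by blast
  \<comment> \<open>Three sums over three different index sets become comparable at a common
    cut-off.\<close>
  let ?n = "max N1 (max N2 N3)"
  show ?thesis
    using 1[of ?n] 2[of ?n] 3[of ?n] by (simp add: tensor_pair_def lin_extend_add star_sum_add)
qed

lemma star_add_right:
  assumes "a \<in> tspan (pure V)" "b \<in> tspan (pure V)" "b' \<in> tspan (pure V)"
  shows "star V z a (b + b') = star V z a b + star V z a b'"
proof -
  have bb: "b + b' \<in> tspan (pure V)" using assms by (simp add: tensor.span_add)
  have tp: "tensor_pair V a (b + b') = tensor_pair V a b + tensor_pair V a b'"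
    using span_linear_tensor_pair2[OF assms(1)] assms by (simp add: span_linear_def)
  obtain N1 where 1: "\<And>n. N1 \<le> n \<Longrightarrow> star V z a b = star_sum z n (tensor_pair V a b)"
    using star_eq_star_sum[OF assms(1,2)] by blast
  obtain N2 where 2: "\<And>n. N2 \<le> n \<Longrightarrow> star V z a b' = star_sum z n (tensor_pair V a b')"
    using star_eq_star_sum[OF assms(1,3)] by blast
  obtain N3 where 3: "\<And>n. N3 \<le> n \<Longrightarrow> star V z a (b + b') = star_sum z n (tensor_pair V a (b + b'))"
    using star_eq_star_sum[OF assms(1) bb] by blast
  let ?n = "max N1 (max N2 N3)"
  show ?thesis
    using 1[of ?n] 2[of ?n] 3[of ?n] by (simp add: tp star_sum_add)
qed

end

section \<open>The Weyl seminorms\<close>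

definition list_weight :: "('v \<Rightarrow> real) \<Rightarrow> 'v list \<Rightarrow> real" where
  "list_weight p xs = prod_list (map p xs)"

text \<open>With the degree factor inside the weight, the sum over degrees in
  \<open>weyl_seminorm\<close> becomes a single projective seminorm on the whole tensor
  algebra.\<close>

definition weyl_weight :: "real \<Rightarrow> ('v \<Rightarrow> real) \<Rightarrow> 'v list \<Rightarrow> real" where
  "weyl_weight R p xs = list_weight p xs * fact (length xs) powr R"

lemma list_weight_nonneg: "(\<And>v. 0 \<le> p v) \<Longrightarrow> 0 \<le> list_weight p xs"
  unfolding list_weight_def by (rule prod_list_nonneg) auto

lemma list_weight_mono: "(\<And>v. 0 \<le> p v) \<Longrightarrow> (\<And>v. p v \<le> q v) \<Longrightarrow> list_weight p xs \<le> list_weight q xs"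
proof (induction xs)
  case (Cons x xs)
  have "0 \<le> q x" using Cons.prems order_trans by blast
  with Cons show ?case
    using mult_mono[of "p x" "q x" "list_weight p xs" "list_weight q xs"] list_weight_nonneg[of p xs]
    by (simp add: list_weight_def)
qed (simp add: list_weight_def)

lemma list_weight_scale: "list_weight (\<lambda>v. D * p v) xs = D ^ length xs * list_weight p xs"
  by (induction xs) (simp_all add: list_weight_def)

lemma list_weight_append: "list_weight p (xs @ ys) = list_weight p xs * list_weight p ys"
  by (simp add: list_weight_def)

lemma list_weight_permute:
  assumes "\<sigma> permutes {..<length xs}"
  shows "list_weight p (permute_list \<sigma> xs) = list_weight p xs"
proof -
  have "list_weight p ys = prod_mset (image_mset p (mset ys))" for ys
    unfolding list_weight_def by (simp flip: prod_mset_prod_list)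
  thus ?thesis using assms by simp
qed

lemma list_weight_omit: "k < length xs \<Longrightarrow> list_weight p xs = p (xs ! k) * list_weight p (omit k xs)"
proof -
  assume "k < length xs"
  from id_take_nth_drop[OF this]
  have "list_weight p xs = list_weight p (take k xs @ xs ! k # drop (Suc k) xs)" by simp
  thus ?thesis by (simp add: list_weight_def omit_def mult_ac)
qed

lemma weyl_weight_nonneg: "(\<And>v. 0 \<le> p v) \<Longrightarrow> 0 \<le> weyl_weight R p xs"
  by (simp add: weyl_weight_def list_weight_nonneg)

lemma weyl_weight_mono:
  "(\<And>v. 0 \<le> p v) \<Longrightarrow> (\<And>v. p v \<le> q v) \<Longrightarrow> weyl_weight R p xs \<le> weyl_weight R q xs"
  unfolding weyl_weight_def by (intro mult_right_mono list_weight_mono) auto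

lemma rep_bound_weight_mono:
  assumes "rep_bound P w' t r" "\<And>i. w i \<le> w' i"
  shows "rep_bound P w t r"
proof -
  from assms(1) obtain L where L: "t = (\<Sum>(c, i)\<leftarrow>L. tscale c (P i))" "(\<Sum>(c, i)\<leftarrow>L. norm c * w' i) \<le> r"
    unfolding rep_bound_def by blast
  have "(\<Sum>(c, i)\<leftarrow>L. norm c * w i) \<le> (\<Sum>(c, i)\<leftarrow>L. norm c * w' i)"
    by (intro sum_list_mono) (auto intro: mult_left_mono assms(2))
  thus ?thesis unfolding rep_bound_def using L by (intro exI[of _ L]) simp
qed

lemma rep_bound_nonneg:
  assumes "rep_bound P w t r" "\<And>i. 0 \<le> w i"
  shows "0 \<le> r"
proof -
  from assms(1) obtain L where "t = (\<Sum>(c, i)\<leftarrow>L. tscale c (P i))" "(\<Sum>(c, i)\<leftarrow>L. norm c * w i) \<le> r"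
    unfolding rep_bound_def by blast
  moreover have "0 \<le> (\<Sum>(c, i)\<leftarrow>L. norm c * w i)"
    by (intro sum_list_nonneg) (auto simp: assms(2))
  ultimately show ?thesis by linarith
qed

text \<open>Only an inequality, since \<open>L\<close> may have entries with labels outside
  \<open>S\<close>: this happens for lengths in which the terms of a representation cancel.\<close>

lemma sum_filter_le:
  fixes f :: "'a \<Rightarrow> real"
  assumes "finite S" "\<And>x. 0 \<le> f x"
  shows "(\<Sum>n\<in>S. \<Sum>x\<leftarrow>filter (\<lambda>x. g x = n) L. f x) \<le> (\<Sum>x\<leftarrow>L. f x)"
proof (induction L)
  case (Cons x L)
  have "(\<Sum>n\<in>S. \<Sum>y\<leftarrow>filter (\<lambda>x. g x = n) (x # L). f y) =
      (\<Sum>n\<in>S. if n = g x then f x else 0) + (\<Sum>n\<in>S. \<Sum>y\<leftarrow>filter (\<lambda>x. g x = n) L. f y)"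
    unfolding sum.distrib[symmetric] by (rule sum.cong) auto
  also have "\<dots> \<le> f x + (\<Sum>y\<leftarrow>L. f y)"
    using Cons.IH assms by (intro add_mono) (auto simp: sum.delta)
  finally show ?case by simp
qed simp

context poisson_space
begin

lemma degree_part_pure: "degree_part V n (pure V xs) = (if length xs = n then pure V xs else 0)"
  unfolding degree_part_def
proof (rule lin_extend_pure)
  fix f
  have "multilinear_form V (\<lambda>xs. if length xs = n then pure V xs f else 0)"
    using multilinear_pure[of f] unfolding multilinear_form_def linear_form_iff by auto
  moreover have "(\<lambda>xs. (if length xs = n then pure V xs else 0) f) = (\<lambda>xs. if length xs = n then pure V xs f else 0)"
    by (auto simp: fun_apply)
  ultimately show "multilinear_form V (\<lambda>xs. (if length xs = n then pure V xs else 0) f)" by simp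
qed

lemma degree_part_add: "degree_part V n (s + t) = degree_part V n s + degree_part V n t"
  and degree_part_scale: "degree_part V n (tscale c t) = tscale c (degree_part V n t)"
  and degree_part_0: "degree_part V n 0 = 0"
  by (simp_all add: degree_part_def lin_extend_add lin_extend_scale lin_extend_0)

lemma degree_part_sum_list:
  "degree_part V n (\<Sum>(c, xs)\<leftarrow>L. tscale c (pure V xs)) =
    (\<Sum>(c, xs)\<leftarrow>filter (\<lambda>u. length (snd u) = n) L. tscale c (pure V xs))"
  by (induction L) (auto simp: degree_part_add degree_part_scale degree_part_0 degree_part_pure)

lemma degree_part_decomposition:
  assumes "t \<in> tspan (pure V)"
  shows "finite {n. degree_part V n t \<noteq> 0}" "(\<Sum>n | degree_part V n t \<noteq> 0. degree_part V n t) = t"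
proof -
  \<comment> \<open>The claim is made for all large \<open>M\<close>, not for one, so that the
    cut-off of the tail and that of the new term can be enlarged to a common one.\<close>
  from assms have "\<exists>N. \<forall>M\<ge>N. (\<Sum>n<M. degree_part V n t) = t \<and> degree_part V M t = 0"
  proof (induction rule: tspan_induct)
    case zero
    show ?case by (simp add: degree_part_0)
  next
    case (add c xs t)
    then obtain N where N: "\<forall>M\<ge>N. (\<Sum>n<M. degree_part V n t) = t \<and> degree_part V M t = 0" by blast
    have "(\<Sum>n<M. degree_part V n (tscale c (pure V xs) + t)) = tscale c (pure V xs) + t \<and>
        degree_part V M (tscale c (pure V xs) + t) = 0" if "max N (Suc (length xs)) \<le> M" for M
    proof -
      have "(\<Sum>n<M. degree_part V n (pure V xs)) = (\<Sum>n<M. if length xs = n then pure V xs else 0)"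
        by (simp add: degree_part_pure)
      also have "\<dots> = pure V xs" using that by (subst sum.delta') auto
      finally have pure: "(\<Sum>n<M. degree_part V n (pure V xs)) = pure V xs" .
      have D: "degree_part V n (tscale c (pure V xs) + t) = tscale c (degree_part V n (pure V xs)) + degree_part V n t" for n
        by (simp only: degree_part_add degree_part_scale)
      have t: "(\<Sum>n<M. degree_part V n t) = t" "degree_part V M t = 0" using N that by auto
      have "(\<Sum>n<M. degree_part V n (tscale c (pure V xs) + t)) =
          (\<Sum>n<M. tscale c (degree_part V n (pure V xs)) + degree_part V n t)"
        by (rule sum.cong[OF refl D])
      also have "\<dots> = tscale c (\<Sum>n<M. degree_part V n (pure V xs)) + (\<Sum>n<M. degree_part V n t)"
        by (simp only: sum.distrib tscale_sum)
      also have "\<dots> = tscale c (pure V xs) + t" by (simp only: pure t)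
      finally have "(\<Sum>n<M. degree_part V n (tscale c (pure V xs) + t)) = tscale c (pure V xs) + t" .
      moreover have "degree_part V M (pure V xs) = 0" using that by (simp add: degree_part_pure)
      hence "degree_part V M (tscale c (pure V xs) + t) = 0"
        by (simp only: D t(2) tscale_simps add_0_left)
      ultimately show ?thesis by (rule conjI)
    qed
    thus ?case by blast
  qed
  then obtain N where N: "\<And>M. N \<le> M \<Longrightarrow> (\<Sum>n<M. degree_part V n t) = t"
    "\<And>M. N \<le> M \<Longrightarrow> degree_part V M t = 0" by blast
  have sub: "{n. degree_part V n t \<noteq> 0} \<subseteq> {..<N}" using N(2) by (auto simp flip: not_le)
  thus "finite {n. degree_part V n t \<noteq> 0}" by (rule finite_subset) simp
  have "(\<Sum>n | degree_part V n t \<noteq> 0. degree_part V n t) = (\<Sum>n<N. degree_part V n t)"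
    by (rule sum.mono_neutral_left[OF _ sub]) auto
  thus "(\<Sum>n | degree_part V n t \<noteq> 0. degree_part V n t) = t" using N(1) by simp
qed

lemma projective_seminorm_le:
  assumes p: "\<And>v. 0 \<le> p v" and "\<forall>(c, xs)\<in>set L. length xs = n" "t = (\<Sum>(c, xs)\<leftarrow>L. tscale c (pure V xs))"
  shows "projective_seminorm V p n t \<le> (\<Sum>(c, xs)\<leftarrow>L. norm c * list_weight p xs)"
  unfolding projective_seminorm_def list_weight_def
proof (rule cInf_lower)
  have "0 \<le> (\<Sum>(c, xs)\<leftarrow>L. norm c * prod_list (map p xs))" for L :: "('k \<times> 'v list) list"
    using list_weight_nonneg[of p, OF p] by (intro sum_list_nonneg) (auto simp: list_weight_def)
  thus "bdd_below {\<Sum>(c, xs)\<leftarrow>L. norm c * prod_list (map p xs) | L.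
      (\<forall>(c, xs)\<in>set L. length xs = n) \<and> t = (\<Sum>(c, xs)\<leftarrow>L. tscale c (pure V xs))}"
    by (intro bdd_belowI[of _ 0]) auto
qed (use assms(2,3) in blast)

text \<open>Sorting a representation of \<open>t\<close> by length represents each of its degree
  parts, at a total cost not above the given one.\<close>

lemma weyl_seminorm_le:
  assumes p: "\<And>v. 0 \<le> p v" and t: "rep_bound (pure V) (weyl_weight R p) t r"
  shows "weyl_seminorm V R p t \<le> r"
proof -
  from t obtain L where L: "t = (\<Sum>(c, xs)\<leftarrow>L. tscale c (pure V xs))"
    "(\<Sum>(c, xs)\<leftarrow>L. norm c * weyl_weight R p xs) \<le> r"
    unfolding rep_bound_def by blast
  let ?L = "\<lambda>n. filter (\<lambda>u. length (snd u) = n) L"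
  let ?f = "\<lambda>(c, xs). norm c * weyl_weight R p xs"
  let ?S = "{n. degree_part V n t \<noteq> 0}"
  have "projective_seminorm V p n (degree_part V n t) * fact n powr R \<le> (\<Sum>u\<leftarrow>?L n. ?f u)" for n
  proof -
    have "projective_seminorm V p n (degree_part V n t) \<le> (\<Sum>(c, xs)\<leftarrow>?L n. norm c * list_weight p xs)"
      by (rule projective_seminorm_le[OF p]) (auto simp: L(1) degree_part_sum_list)
    hence "projective_seminorm V p n (degree_part V n t) * fact n powr R \<le>
        (\<Sum>(c, xs)\<leftarrow>?L n. norm c * list_weight p xs) * fact n powr R"
      by (rule mult_right_mono) simp
    also have "\<dots> = (\<Sum>u\<leftarrow>?L n. ?f u)"
      by (induction L) (auto simp: weyl_weight_def algebra_simps)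
    finally show ?thesis .
  qed
  hence "weyl_seminorm V R p t \<le> (\<Sum>n\<in>?S. \<Sum>u\<leftarrow>?L n. ?f u)"
    unfolding weyl_seminorm_def by (rule sum_mono)
  also have "\<dots> \<le> (\<Sum>u\<leftarrow>L. ?f u)"
    by (rule sum_filter_le[OF degree_part_decomposition(1)[OF rep_bound_span[OF t]]])
      (auto simp: weyl_weight_nonneg p)
  also have "\<dots> \<le> r" by (rule L(2))
  finally show ?thesis .
qed

lemma rep_bound_projective:
  assumes t: "t \<in> tspan (pure V)" and e: "0 < e"
  shows "rep_bound (pure V) (weyl_weight R p) (degree_part V n t)
    (projective_seminorm V p n (degree_part V n t) * fact n powr R + e)"
proof -
  let ?S = "{(\<Sum>(c, xs)\<leftarrow>L. norm c * prod_list (map p xs)) | L.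
      (\<forall>(c, xs)\<in>set L. length xs = n) \<and> degree_part V n t = (\<Sum>(c, xs)\<leftarrow>L. tscale c (pure V xs))}"
  from span_rep_bound[OF t] obtain r where "rep_bound (pure V) (\<lambda>_. 0) t r" ..
  then obtain L where L: "t = (\<Sum>(c, xs)\<leftarrow>L. tscale c (pure V xs))" unfolding rep_bound_def by blast
  have "\<forall>(c, xs)\<in>set (filter (\<lambda>u. length (snd u) = n) L). length xs = n" by auto
  moreover have "degree_part V n t = (\<Sum>(c, xs)\<leftarrow>filter (\<lambda>u. length (snd u) = n) L. tscale c (pure V xs))"
    unfolding L by (rule degree_part_sum_list)
  ultimately have ne: "?S \<noteq> {}" by blast
  \<comment> \<open>The tolerance is divided by the degree factor that multiplies it afterwards, so
    that exactly \<open>e\<close> remains.\<close>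
  have "Inf ?S < Inf ?S + e / fact n powr R" using e by simp
  from cInf_lessD[OF ne this] obtain x where x: "x \<in> ?S" "x < Inf ?S + e / fact n powr R" ..
  from x(1)[unfolded mem_Collect_eq] obtain L where "x = (\<Sum>(c, xs)\<leftarrow>L. norm c * prod_list (map p xs)) \<and>
      (\<forall>(c, xs)\<in>set L. length xs = n) \<and> degree_part V n t = (\<Sum>(c, xs)\<leftarrow>L. tscale c (pure V xs))" ..
  note L = conjunct1[OF conjunct2[OF this]] conjunct2[OF conjunct2[OF this]] conjunct1[OF this]
  have "(\<Sum>(c, xs)\<leftarrow>L. norm c * weyl_weight R p xs) = x * fact n powr R"
  proof -
    have "map (\<lambda>(c, xs). norm c * weyl_weight R p xs) L =
        map (\<lambda>u. (case u of (c, xs) \<Rightarrow> norm c * prod_list (map p xs)) * fact n powr R) L"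
      using L(1) by (intro map_cong refl) (auto simp: weyl_weight_def list_weight_def)
    thus ?thesis by (simp only: L(3) sum_list_mult_const)
  qed
  also have "\<dots> \<le> (Inf ?S + e / fact n powr R) * fact n powr R"
    using x(2) by (intro mult_right_mono) auto
  also have "\<dots> = projective_seminorm V p n (degree_part V n t) * fact n powr R + e"
    unfolding projective_seminorm_def by (simp add: distrib_right)
  finally show ?thesis unfolding rep_bound_def using L(2) by blast
qed

text \<open>Almost optimal representations of the degree parts are joined. As infima need not be
  attained, this converse of \<open>weyl_seminorm_le\<close> asks for a strict inequality.\<close>

lemma rep_bound_weyl:
  assumes t: "t \<in> tspan (pure V)" and r: "weyl_seminorm V R p t < r"
  shows "rep_bound (pure V) (weyl_weight R p) t r"
proof -
  let ?S = "{n. degree_part V n t \<noteq> 0}"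
  \<comment> \<open>The slack is shared among the nonzero degrees; the extra 1 keeps the denominator
    positive when there are none.\<close>
  define e where "e = (r - weyl_seminorm V R p t) / (real (card ?S) + 1)"
  have e: "0 < e" using r unfolding e_def by (intro divide_pos_pos) auto
  have "rep_bound (pure V) (weyl_weight R p) (\<Sum>n\<in>?S. degree_part V n t)
      (\<Sum>n\<in>?S. projective_seminorm V p n (degree_part V n t) * fact n powr R + e)"
    by (intro rep_bound_sum rep_bound_projective t e)
  hence "rep_bound (pure V) (weyl_weight R p) t (weyl_seminorm V R p t + real (card ?S) * e)"
    unfolding degree_part_decomposition(2)[OF t] by (simp add: sum.distrib weyl_seminorm_def)
  moreover have "(real (card ?S) + 1) * e = r - weyl_seminorm V R p t" unfolding e_def by simp
  ultimately show ?thesis using e by (elim rep_bound_mono) (simp add: algebra_simps)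
qed

lemma weyl_nonneg:
  assumes p: "\<And>v. 0 \<le> p v" and t: "t \<in> tspan (pure V)"
  shows "0 \<le> weyl_seminorm V R p t"
proof (rule dense_ge)
  fix r assume "weyl_seminorm V R p t < r"
  from rep_bound_weyl[OF t this] have "rep_bound (pure V) (weyl_weight R p) t r" .
  thus "0 \<le> r" by (rule rep_bound_nonneg[where w = "weyl_weight R p", OF _ weyl_weight_nonneg[where p = p, OF p]])
qed

lemma weyl_add:
  assumes p: "\<And>v. 0 \<le> p v" and s: "s \<in> tspan (pure V)" and t: "t \<in> tspan (pure V)"
  shows "weyl_seminorm V R p (s + t) \<le> weyl_seminorm V R p s + weyl_seminorm V R p t"
proof (rule field_le_epsilon)
  fix e :: real assume "0 < e"
  hence less: "x < x + e / 2" for x by simp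
  from rep_bound_add[OF rep_bound_weyl[OF s less] rep_bound_weyl[OF t less]]
  show "weyl_seminorm V R p (s + t) \<le> weyl_seminorm V R p s + weyl_seminorm V R p t + e"
    by (intro weyl_seminorm_le p) (simp add: algebra_simps)
qed

lemma weyl_scale:
  assumes p: "\<And>v. 0 \<le> p v" and t: "t \<in> tspan (pure V)"
  shows "weyl_seminorm V R p (tscale c t) \<le> norm c * weyl_seminorm V R p t"
proof (rule field_le_epsilon)
  fix e :: real assume e: "0 < e"
  \<comment> \<open>Dividing by \<open>norm c + 1\<close> covers \<open>c = 0\<close> as
    well.\<close>
  have "x < x + e / (norm c + 1)" for x using e by (simp add: add_nonneg_pos)
  from rep_bound_weyl[OF t this]
  have "rep_bound (pure V) (weyl_weight R p) t (weyl_seminorm V R p t + e / (norm c + 1))" .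
  from weyl_seminorm_le[OF p rep_bound_scale[OF this, of c]]
  have "weyl_seminorm V R p (tscale c t) \<le> norm c * (weyl_seminorm V R p t + e / (norm c + 1))" .
  also have "\<dots> = norm c * weyl_seminorm V R p t + e * (norm c / (norm c + 1))"
    by (simp add: algebra_simps)
  also have "\<dots> \<le> norm c * weyl_seminorm V R p t + e"
    using e by (simp add: mult_left_le divide_le_eq add_nonneg_pos)
  finally show "weyl_seminorm V R p (tscale c t) \<le> norm c * weyl_seminorm V R p t + e" .
qed

lemma weyl_0: "(\<And>v. 0 \<le> p v) \<Longrightarrow> weyl_seminorm V R p 0 = 0"
  using weyl_seminorm_le[OF _ rep_bound_0, of p R] weyl_nonneg[of p 0] tensor.span_zero
  by (metis antisym)

end

section \<open>Continuous seminorms\<close>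

context poisson_space
begin

lemma continuous_scl_const: "continuous_on UNIV (\<lambda>v. scl V c v)"
  using continuous_on_compose2[OF continuous_scl, of UNIV "\<lambda>v. (c, v)"]
  by (simp add: continuous_on_Pair)

lemma continuous_scl_left: "continuous_on UNIV (\<lambda>c. scl V c v)"
  using continuous_on_compose2[OF continuous_scl, of UNIV "\<lambda>c. (c, v)"]
  by (simp add: continuous_on_Pair)

lemma open_absorbs:
  assumes "open U" "0 \<in> U"
  obtains c where "c \<noteq> 0" "scl V c v \<in> U"
proof -
  have "open ((\<lambda>c. scl V c v) -` U)"
    by (rule open_vimage[OF assms(1) continuous_scl_left])
  moreover have "0 \<in> (\<lambda>c. scl V c v) -` U" using assms(2) by simp
  ultimately obtain e where e: "e > 0" "ball 0 e \<subseteq> (\<lambda>c. scl V c v) -` U"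
    using open_contains_ball by blast
  have "of_real (e / 2) \<in> ball (0 :: 'k) e" using e(1) by simp
  with e have "scl V (of_real (e / 2)) v \<in> U" by blast
  with e(1) show ?thesis by (intro that[of "of_real (e / 2)"]) auto
qed

lemma continuous_seminormD:
  assumes "continuous_seminorm V p"
  shows "0 \<le> p v" "p (v + w) \<le> p v + p w" "p (scl V c v) = norm c * p v" "continuous_on UNIV p" "p 0 = 0"
proof -
  show "0 \<le> p v" "p (v + w) \<le> p v + p w" "p (scl V c v) = norm c * p v" "continuous_on UNIV p"
    using assms by (auto simp: continuous_seminorm_def)
  have "p (scl V 0 0) = norm (0 :: 'k) * p 0" using assms unfolding continuous_seminorm_def by blast
  thus "p 0 = 0" by simp
qed

lemma continuous_seminormI:
  assumes nonneg: "\<And>v. 0 \<le> p v" and tri: "\<And>v w. p (v + w) \<le> p v + p w"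
    and scale: "\<And>c v. p (scl V c v) = norm c * p v"
    and U: "open U" "0 \<in> U" "\<And>v. v \<in> U \<Longrightarrow> p v \<le> 1"
  shows "continuous_seminorm V p"
proof -
  have "continuous_on UNIV p"
    unfolding continuous_on_def
  proof (intro ballI tendstoI)
    fix v and e :: real assume e: "0 < e"
    \<comment> \<open>With this scale, \<open>scl V c (x - v) \<in> U\<close> forces
      \<open>p (x - v) \<le> e / 2\<close>.\<close>
    define c :: 'k where "c = of_real (2 / e)"
    have c: "norm c = 2 / e" unfolding c_def norm_of_real using e by simp
    have "continuous_on UNIV (\<lambda>x. scl V c (x - v))"
      by (rule continuous_on_compose2[OF continuous_scl_const]) (auto intro!: continuous_intros)
    hence "open ((\<lambda>x. scl V c (x - v)) -` U)" by (rule open_vimage[OF U(1)])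
    moreover have "v \<in> (\<lambda>x. scl V c (x - v)) -` U" using U(2) by simp
    moreover have "dist (p x) (p v) < e" if "x \<in> (\<lambda>x. scl V c (x - v)) -` U" for x
    proof -
      have "norm c * p (x - v) \<le> 1" using U(3)[of "scl V c (x - v)"] that unfolding scale by simp
      hence "2 / e * p (x - v) \<le> 1" unfolding c .
      hence "p (x - v) < e" using e by (simp add: field_simps)
      moreover have "p (v - x) = p (x - v)" using scale[of "- 1" "x - v"] by simp
      ultimately show ?thesis
        using tri[of v "x - v"] tri[of x "v - x"] by (simp add: dist_real_def)
    qed
    ultimately show "\<forall>\<^sub>F x in at v. dist (p x) (p v) < e"
      unfolding eventually_at_topological by blast
  qed
  thus ?thesis using nonneg tri scale by (simp add: continuous_seminorm_def)
qed

text \<open>The supremum is finite because \<open>U\<close> absorbs every vector, and continuous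
  because the family is uniformly bounded on \<open>U\<close>. It is applied once to each slot of
  \<open>form V\<close>.\<close>

lemma sup_seminorm:
  fixes g :: "'i \<Rightarrow> 'v \<Rightarrow> 'k"
  assumes I: "I \<noteq> {}" and lin: "\<And>i. i \<in> I \<Longrightarrow> Vector_Spaces.linear (scl V) (*) (g i)"
    and U: "open U" "0 \<in> U" "\<And>i v. i \<in> I \<Longrightarrow> v \<in> U \<Longrightarrow> norm (g i v) \<le> 1"
  shows "continuous_seminorm V (\<lambda>v. SUP i\<in>I. norm (g i v))"
    and "i \<in> I \<Longrightarrow> norm (g i v) \<le> (SUP i\<in>I. norm (g i v))"
proof -
  let ?p = "\<lambda>v. SUP i\<in>I. norm (g i v)"
  have ga: "g i (v + w) = g i v + g i w" "g i (scl V c v) = c * g i v" if "i \<in> I" for i v w c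
    using lin[OF that] unfolding linear_form_iff by auto
  have bdd: "bdd_above ((\<lambda>i. norm (g i v)) ` I)" for v
  proof -
    obtain c where c: "c \<noteq> 0" "scl V c v \<in> U" using open_absorbs[OF U(1,2)] .
    have "norm (g i v) \<le> 1 / norm c" if "i \<in> I" for i
      using U(3)[OF that c(2)] ga(2)[OF that, of c v] c(1) by (simp add: norm_mult field_simps)
    thus ?thesis by (intro bdd_aboveI2) auto
  qed
  show up: "norm (g i v) \<le> ?p v" if "i \<in> I" for i v by (rule cSUP_upper[OF that bdd])
  have nonneg: "0 \<le> ?p v" for v
  proof -
    obtain i where "i \<in> I" using I by blast
    from norm_ge_zero up[OF this] show ?thesis by (rule order_trans)
  qed
  have le: "?p (scl V c v) \<le> norm c * ?p v" for c v
    by (rule cSUP_least[OF I]) (auto simp: ga norm_mult intro!: mult_left_mono up)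
  show "continuous_seminorm V ?p"
  proof (rule continuous_seminormI[OF nonneg _ _ U(1,2)])
    fix v w
    show "?p (v + w) \<le> ?p v + ?p w"
    proof (rule cSUP_least[OF I])
      fix i assume i: "i \<in> I"
      show "norm (g i (v + w)) \<le> ?p v + ?p w"
        unfolding ga(1)[OF i] using norm_triangle_ineq[of "g i v" "g i w"] up[OF i, of v] up[OF i, of w]
        by linarith
    qed
  next
    fix c v
    show "?p (scl V c v) = norm c * ?p v"
    proof (cases "c = 0")
      case True
      with le[of 0 v] nonneg[of "scl V 0 v"] show ?thesis by simp
    next
      case False
      have "?p v \<le> norm (inverse c) * ?p (scl V c v)"
        using le[of "inverse c" "scl V c v"] False by simp
      hence "norm c * ?p v \<le> norm c * (norm (inverse c) * ?p (scl V c v))" by (rule mult_left_mono) simp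
      also have "\<dots> = norm (c * inverse c) * ?p (scl V c v)" by (simp only: norm_mult mult.assoc)
      also have "\<dots> = ?p (scl V c v)" using False by simp
      finally have "norm c * ?p v \<le> ?p (scl V c v)" .
      with le[of c v] show ?thesis by simp
    qed
  next
    fix v assume "v \<in> U"
    thus "?p v \<le> 1" using U(3) by (intro cSUP_least[OF I])
  qed
qed

lemma continuous_seminorm_add:
  assumes p: "continuous_seminorm V p" and q: "continuous_seminorm V q"
  shows "continuous_seminorm V (\<lambda>v. p v + q v)"
  unfolding continuous_seminorm_def
proof (intro conjI allI)
  fix v w c
  show "0 \<le> p v + q v" using continuous_seminormD(1)[OF p, of v] continuous_seminormD(1)[OF q, of v] by simp
  show "p (v + w) + q (v + w) \<le> p v + q v + (p w + q w)"
    using continuous_seminormD(2)[OF p, of v w] continuous_seminormD(2)[OF q, of v w] by simp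
  show "p (scl V c v) + q (scl V c v) = norm c * (p v + q v)"
    unfolding continuous_seminormD(3)[OF p] continuous_seminormD(3)[OF q] by (simp only: distrib_left)
  show "continuous_on UNIV (\<lambda>v. p v + q v)"
    by (rule continuous_on_add[OF continuous_seminormD(4)[OF p] continuous_seminormD(4)[OF q]])
qed

lemma continuous_seminorm_cmult:
  assumes p: "continuous_seminorm V p" and D: "0 \<le> D"
  shows "continuous_seminorm V (\<lambda>v. D * p v)"
  unfolding continuous_seminorm_def
proof (intro conjI allI)
  fix v w c
  show "0 \<le> D * p v" using continuous_seminormD(1)[OF p, of v] D by simp
  show "D * p (v + w) \<le> D * p v + D * p w"
    unfolding distrib_left[symmetric] by (rule mult_left_mono[OF continuous_seminormD(2)[OF p] D])
  show "D * p (scl V c v) = norm c * (D * p v)"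
    unfolding continuous_seminormD(3)[OF p] by (simp only: mult_ac)
  show "continuous_on UNIV (\<lambda>v. D * p v)"
    by (rule continuous_on_mult_left[OF continuous_seminormD(4)[OF p]])
qed

lemma continuous_seminorm_0: "continuous_seminorm V (\<lambda>v. 0)"
  unfolding continuous_seminorm_def by simp

lemma continuous_seminorm_part:
  assumes "continuous_seminorm V p"
  shows "continuous_seminorm V (\<lambda>v. p (part V e v))"
proof -
  have "continuous_on UNIV (\<lambda>v. p (part V e v))"
    by (rule continuous_on_compose2[OF continuous_seminormD(4)[OF assms] part_continuous]) simp
  thus ?thesis using assms unfolding continuous_seminorm_def by (simp add: part_add part_scl)
qed

lemma form_zero: "form V 0 w = 0" "form V v 0 = 0"
  using form_linear1[of w] form_linear2[of v] unfolding linear_form_iff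
  by (metis mult_zero_left scale_zero_left)+

text \<open>The second seminorm is the dual norm of the first with respect to the form, so that no
  Minkowski functional is needed.\<close>

lemma form_seminorms:
  obtains p q where "continuous_seminorm V p" "continuous_seminorm V q"
    "\<And>v w. norm (form V v w) \<le> p v * q w"
proof -
  have "open ((\<lambda>(v, w). form V v w) -` ball 0 1)"
    by (rule open_vimage[OF _ form_continuous]) simp
  moreover have "(0, 0) \<in> (\<lambda>(v, w). form V v w) -` ball 0 1" by (simp add: form_zero)
  ultimately obtain A B where AB: "open A" "open B" "(0, 0) \<in> A \<times> B"
    "A \<times> B \<subseteq> (\<lambda>(v, w). form V v w) -` ball 0 1" by (rule open_prod_elim)
  define U where "U = A \<inter> B"
  have U: "open U" "0 \<in> U" using AB by (auto simp: U_def)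
  have bd: "norm (form V v w) \<le> 1" if "v \<in> U" "w \<in> U" for v w
    using subsetD[OF AB(4), of "(v, w)"] that unfolding U_def by simp
  define p where "p v = (SUP w\<in>U. norm (form V v w))" for v
  have p: "continuous_seminorm V p" "w \<in> U \<Longrightarrow> norm (form V v w) \<le> p v" for v w
    unfolding p_def using sup_seminorm[of U "\<lambda>w v. form V v w" U] U bd form_linear1 by blast+
  let ?I = "{v. p v \<le> 1}"
  have I: "?I \<noteq> {}" using continuous_seminormD(5)[OF p(1)] by (auto intro!: exI[of _ 0])
  have bd2: "norm (form V v w) \<le> 1" if "v \<in> ?I" "w \<in> U" for v w
    using p(2)[OF that(2), of v] that(1) by simp
  define q where "q w = (SUP v\<in>?I. norm (form V v w))" for w
  have q: "continuous_seminorm V q" "p v \<le> 1 \<Longrightarrow> norm (form V v w) \<le> q w" for v w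
    unfolding q_def using sup_seminorm[of ?I "\<lambda>v w. form V v w" U] I U bd2 form_linear2 by blast+
  have form_scale: "norm (form V (scl V (of_real c) v) w) = \<bar>c\<bar> * norm (form V v w)" for c v w
    using form_linear1[of w] unfolding linear_form_iff by (simp add: norm_mult)
  have "norm (form V v w) \<le> p v * q w" for v w
  proof (cases "p v = 0")
    case True
    have "form V v w = 0"
    proof (rule ccontr)
      assume nz: "form V v w \<noteq> 0"
      \<comment> \<open>All multiples of \<open>v\<close> lie in the unit ball of \<open>p\<close>,
        so \<open>q w\<close> bounds the norm of every multiple of the value; this multiple has norm
        \<open>q w + 1\<close>.\<close>
      define c where "c = (q w + 1) / norm (form V v w)"
      have "p (scl V (of_real c) v) \<le> 1" using True by (simp add: continuous_seminormD(3)[OF p(1)])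
      from q(2)[OF this, of w] have "\<bar>c\<bar> * norm (form V v w) \<le> q w" by (simp add: form_scale)
      moreover have "\<bar>c\<bar> * norm (form V v w) = q w + 1"
        unfolding c_def using nz continuous_seminormD(1)[OF q(1), of w] by simp
      ultimately show False by simp
    qed
    thus ?thesis using True by simp
  next
    case False
    hence pos: "0 < p v" using continuous_seminormD(1)[OF p(1), of v] by simp
    hence "p (scl V (of_real (1 / p v)) v) \<le> 1"
      unfolding continuous_seminormD(3)[OF p(1)] norm_of_real by simp
    from q(2)[OF this, of w] pos show ?thesis unfolding form_scale by (simp add: field_simps)
  qed
  with p(1) q(1) show ?thesis by (rule that)
qed

text \<open>The middle clause makes the weight of a list the exact sum of the weights of its
  component lists, so splitting into homogeneous parts costs no constant. The last clause lets
  contracting two entries cost no more than the weights of these entries.\<close>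

definition good_seminorm :: "('v \<Rightarrow> real) \<Rightarrow> bool" where
  "good_seminorm q \<longleftrightarrow> (\<forall>v. 0 \<le> q v) \<and> (\<forall>v. q (part V False v) + q (part V True v) = q v) \<and>
     (\<forall>v w. norm (form V v w) \<le> q v * q w)"

lemma good_seminorm_exists:
  assumes p: "continuous_seminorm V p"
  obtains q where "continuous_seminorm V q" "good_seminorm q" "\<And>v. p v \<le> q v"
proof -
  obtain p1 q1 where 1: "continuous_seminorm V p1" "continuous_seminorm V q1"
    "\<And>v w. norm (form V v w) \<le> p1 v * q1 w" using form_seminorms by blast
  define p2 where "p2 v = p v + (p1 v + q1 v)" for v
  have p2: "continuous_seminorm V p2" unfolding p2_def by (intro continuous_seminorm_add p 1)
  \<comment> \<open>Adding up over the two parts can only enlarge \<open>p2\<close>, and doing it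
    again changes nothing because a homogeneous vector has at most one nonzero part.\<close>
  define q where "q v = p2 (part V False v) + p2 (part V True v)" for v
  have q: "continuous_seminorm V q" unfolding q_def
    by (intro continuous_seminorm_add continuous_seminorm_part p2)
  have pq: "p2 v \<le> q v" for v
    using continuous_seminormD(2)[OF p2, of "part V False v" "part V True v"] part_sum[of v]
    by (simp add: q_def)
  have nn: "0 \<le> p v" "0 \<le> p1 v" "0 \<le> q1 v" for v
    using p 1 by (auto intro: continuous_seminormD)
  have "norm (form V v w) \<le> q v * q w" for v w
  proof -
    have "norm (form V v w) \<le> p1 v * q1 w" by (rule 1)
    also have "\<dots> \<le> q v * q w"
      using pq[of v] pq[of w] nn[of v] nn[of w] unfolding p2_def by (intro mult_mono) linarith+
    finally show ?thesis .
  qed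
  moreover have "q (part V False v) + q (part V True v) = q v" for v
    by (simp add: q_def part_part continuous_seminormD(5)[OF p2])
  ultimately have "good_seminorm q" unfolding good_seminorm_def using continuous_seminormD(1)[OF q] by blast
  moreover have "p v \<le> q v" for v using pq[of v] nn[of v] unfolding p2_def by linarith
  ultimately show ?thesis using q that by blast
qed

end

section \<open>Continuity of the star product\<close>

lemma fact_le_powr:
  fixes R :: real
  assumes "1 / 2 \<le> R"
  shows "(fact k :: real) \<le> (fact k * fact k) powr R"
proof -
  have "(1 :: real) \<le> fact k" by (rule fact_ge_1)
  hence "(1 :: real) \<le> fact k * fact k" using mult_mono[of 1 "fact k :: real" 1 "fact k"] by simp
  \<comment> \<open>The left side is the power 1/2 of the same base, and the base is at least
    1.\<close>
  from powr_mono[OF assms this] show ?thesis by (simp add: powr_half_sqrt)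
qed

lemma fact_mult_le: "(fact k * fact m :: real) \<le> fact (k + m)"
proof -
  have "fact k * fact m * (1 :: real) \<le> fact k * fact m * real ((k + m) choose k)"
    by (intro mult_left_mono) (auto simp: Suc_le_eq)
  also have "\<dots> = fact (k + m)" by (simp add: binomial_fact)
  finally show ?thesis by simp
qed

lemma fact_add_le: "(fact (k + m) :: real) \<le> 2 ^ (k + m) * (fact k * fact m)"
proof -
  have "(fact (k + m) :: real) = real ((k + m) choose k) * (fact k * fact m)"
    by (simp add: binomial_fact)
  also have "\<dots> \<le> 2 ^ (k + m) * (fact k * fact m)"
  proof (rule mult_right_mono)
    have "real ((k + m) choose k) \<le> real (2 ^ (k + m))"
      by (rule of_nat_mono[OF binomial_le_pow2])
    thus "real ((k + m) choose k) \<le> 2 ^ (k + m)" by simp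
  qed simp
  finally show ?thesis .
qed

text \<open>Here the bound on \<open>R\<close> enters, through the factor \<open>k!\<close> that is left over from the binomial
  coefficients.\<close>

lemma contraction_factor_le:
  fixes R :: real
  assumes R: "1 / 2 \<le> R" and k: "k \<le> n" "k \<le> m"
  shows "fact n / fact (n - k) * (fact m / fact (m - k)) / fact k * fact (n - k + (m - k)) powr R
    \<le> (2 * 2 powr R) ^ (n + m) * (fact n powr R * fact m powr R)"
proof -
  obtain n' m' where n: "n = k + n'" and m: "m = k + m'" using k by (metis le_add_diff_inverse)
  have pow: "(2 ^ j) powr R = (2 powr R) ^ j" for j
    by (induction j) (simp_all add: powr_mult)
  \<comment> \<open>The quotient is a binomial coefficient times \<open>k!\<close>, and the
    coefficient is at most \<open>2 ^ (k + j)\<close>.\<close>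
  have ch: "fact (k + j) / fact j \<le> 2 ^ (k + j) * (fact k :: real)" for j
    using fact_add_le[of k j] by (simp add: field_simps)
  have "fact n / fact (n - k) * (fact m / fact (m - k)) / fact k \<le>
      (2 ^ n * fact k) * (2 ^ m * fact k) / (fact k :: real)"
    unfolding n m using ch by (intro divide_right_mono mult_mono) simp_all
  also have "\<dots> = 2 ^ (n + m) * fact k" by (simp add: power_add)
  finally have 1: "fact n / fact (n - k) * (fact m / fact (m - k)) / fact k \<le> 2 ^ (n + m) * (fact k :: real)" .
  \<comment> \<open>The two quotients give \<open>k!\<close> twice, of which the division leaves
    one. It is absorbed as the power \<open>R\<close> of \<open>k! * k!\<close>; one of these
    factors then completes \<open>n'!\<close> to at most \<open>n!\<close>, the other
    \<open>m'!\<close> to at most \<open>m!\<close>.\<close>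
  have "fact k * fact (n' + m') powr R \<le> (fact k * fact k) powr R * (2 ^ (n' + m') * (fact n' * fact m')) powr R"
    using R fact_add_le[of n' m'] by (intro mult_mono fact_le_powr powr_mono2) auto
  also have "\<dots> = (2 ^ (n' + m') * ((fact k * fact n') * (fact k * fact m'))) powr R"
    by (simp add: powr_mult mult_ac)
  also have "\<dots> \<le> (2 ^ (n + m) * (fact n * fact m)) powr R"
    using R unfolding n m
    by (intro powr_mono2 mult_mono fact_mult_le power_increasing) auto
  also have "\<dots> = (2 powr R) ^ (n + m) * (fact n powr R * fact m powr R)"
    by (simp only: powr_mult pow)
  finally have 2: "fact k * fact (n' + m') powr R \<le> (2 powr R) ^ (n + m) * (fact n powr R * fact m powr R)" .
  have "fact n / fact (n - k) * (fact m / fact (m - k)) / fact k * fact (n - k + (m - k)) powr R \<le>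
      2 ^ (n + m) * fact k * fact (n - k + (m - k)) powr R"
    using 1 by (rule mult_right_mono) simp
  also have "\<dots> = 2 ^ (n + m) * (fact k * fact (n' + m') powr R)" by (simp add: n m)
  also have "\<dots> \<le> 2 ^ (n + m) * ((2 powr R) ^ (n + m) * (fact n powr R * fact m powr R))"
    using 2 by (rule mult_left_mono) simp
  also have "\<dots> = (2 * 2 powr R) ^ (n + m) * (fact n powr R * fact m powr R)"
    by (simp add: power_mult_distrib)
  finally show ?thesis .
qed

text \<open>How a degree weight is pulled back along one contraction: there are \<open>n * m\<close>
  terms, each landing in degrees \<open>n - 1\<close> and \<open>m - 1\<close>. Truncated
  subtraction is harmless, as the factor \<open>n * m\<close> is then 0.\<close>

definition lower :: "(nat \<Rightarrow> nat \<Rightarrow> real) \<Rightarrow> nat \<Rightarrow> nat \<Rightarrow> real" where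
  "lower u n m = real n * real m * u (n - 1) (m - 1)"

lemma lower_power:
  "(lower ^^ k) u n m = (if k \<le> n \<and> k \<le> m
     then fact n / fact (n - k) * (fact m / fact (m - k)) * u (n - k) (m - k) else 0)"
proof (induction k arbitrary: n m)
  case (Suc k)
  have "(lower ^^ Suc k) u n m = real n * real m * (lower ^^ k) u (n - 1) (m - 1)"
    by (subst funpow.simps(2), subst o_apply, rule lower_def)
  thus ?case by (cases n; cases m) (simp_all add: Suc)
qed simp

lemma lower_power_nonneg: "(\<And>n m. 0 \<le> u n m) \<Longrightarrow> 0 \<le> (lower ^^ k) u n m"
  unfolding lower_power by simp

text \<open>Binomial coefficients with index up to \<open>n\<close> are at least 1. A pure power in
  \<open>n\<close> is wanted, for any size of \<open>Z\<close>, because it can later be absorbed as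
  one factor per vector.\<close>

lemma sum_power_le:
  fixes Z :: real
  assumes "0 \<le> Z"
  shows "(\<Sum>k\<le>n. Z ^ k) \<le> (1 + Z) ^ n"
proof -
  have "(\<Sum>k\<le>n. Z ^ k) \<le> (\<Sum>k\<le>n. real (n choose k) * Z ^ k)"
  proof (rule sum_mono)
    fix k assume "k \<in> {..n}"
    hence "1 \<le> real (n choose k)" by (simp add: Suc_le_eq)
    from mult_right_mono[OF this, of "Z ^ k"] assms show "Z ^ k \<le> real (n choose k) * Z ^ k" by simp
  qed
  also have "\<dots> = (1 + Z) ^ n" using binomial_ring[of Z 1 n] by (simp add: add.commute)
  finally show ?thesis .
qed

text \<open>The terms with \<open>k > n\<close> vanish, so the bound is free of the cut-off
  \<open>N\<close>, which varies with the tensors. The constant appears to the power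
  \<open>n + m\<close> so that rescaling the seminorm absorbs it.\<close>

lemma star_weight_le:
  fixes R Z :: real
  assumes R: "1 / 2 \<le> R" and Z: "0 \<le> Z"
  shows "(\<Sum>k<N. Z ^ k / fact k * (lower ^^ k) (\<lambda>n m. fact (n + m) powr R) n m)
    \<le> ((1 + Z) * (2 * 2 powr R)) ^ (n + m) * (fact n powr R * fact m powr R)"
proof -
  define B where "B = (2 * 2 powr R) ^ (n + m) * (fact n powr R * fact m powr R)"
  have B: "0 \<le> B" unfolding B_def by simp
  have "(\<Sum>k<N. Z ^ k / fact k * (lower ^^ k) (\<lambda>n m. fact (n + m) powr R) n m)
      \<le> (\<Sum>k<N. if k \<le> n then Z ^ k * B else 0)"
  proof (rule sum_mono)
    fix k
    show "Z ^ k / fact k * (lower ^^ k) (\<lambda>n m. fact (n + m) powr R) n m \<le> (if k \<le> n then Z ^ k * B else 0)"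
    proof (cases "k \<le> n \<and> k \<le> m")
      case True
      hence "Z ^ k * (fact n / fact (n - k) * (fact m / fact (m - k)) / fact k * fact (n - k + (m - k)) powr R) \<le> Z ^ k * B"
        unfolding B_def using contraction_factor_le[OF R, of k n m] Z by (intro mult_left_mono) auto
      with True show ?thesis unfolding lower_power by (simp add: mult_ac)
    next
      case False
      thus ?thesis unfolding lower_power using B Z by (simp only: if_False) auto
    qed
  qed
  also have "\<dots> = (\<Sum>k\<in>{..<N} \<inter> {k. k \<le> n}. Z ^ k * B)" by (simp add: sum.If_cases)
  also have "\<dots> \<le> (\<Sum>k\<le>n. Z ^ k * B)" using B Z by (intro sum_mono2) auto
  also have "\<dots> = (\<Sum>k\<le>n. Z ^ k) * B" by (simp add: sum_distrib_right)
  also have "\<dots> \<le> (1 + Z) ^ (n + m) * B"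
    using sum_power_le[OF Z, of n] power_increasing[of n "n + m" "1 + Z"] Z
    by (intro mult_right_mono B) linarith
  also have "\<dots> = ((1 + Z) * (2 * 2 powr R)) ^ (n + m) * (fact n powr R * fact m powr R)"
    unfolding B_def by (simp only: power_mult_distrib mult.assoc)
  finally show ?thesis .
qed

section \<open>Norm bounds for symmetrization, contraction and star product\<close>

lemma parities_0: "parities 0 = {[]}"
  by (auto simp: parities_def)

lemma parities_Suc: "parities (Suc n) = (\<lambda>(b, d). b # d) ` (UNIV \<times> parities n)"
  by (auto simp: parities_def length_Suc_conv image_iff)

lemma norm_koszul_sign: "norm (koszul_sign d \<sigma> :: 'k::real_normed_field) = 1"
  by (simp add: koszul_sign_def norm_power)

lemma norm_contraction_sign: "norm (contraction_sign d k e l :: 'k::real_normed_field) = 1"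
  by (simp add: contraction_sign_def norm_power)

context poisson_space
begin

lemma good_seminormD:
  assumes "good_seminorm q"
  shows "0 \<le> q v" "q (part V False v) + q (part V True v) = q v" "norm (form V v w) \<le> q v * q w"
  using assms unfolding good_seminorm_def by blast+

text \<open>Expand the product over the entries of
  \<open>q (part V False x) + q (part V True x) = q x\<close>.\<close>

lemma sum_parities_weight:
  assumes q: "good_seminorm q"
  shows "(\<Sum>d\<in>parities (length xs). list_weight q (components V d xs)) = list_weight q xs"
proof (induction xs)
  case Nil
  show ?case by (simp add: parities_0 components_def)
next
  case (Cons x xs)
  have "(\<Sum>d\<in>parities (length (x # xs)). list_weight q (components V d (x # xs))) =
      (\<Sum>(b, d)\<in>UNIV \<times> parities (length xs). q (part V b x) * list_weight q (components V d xs))"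
    unfolding list.size add_Suc_right add_0_right parities_Suc
    by (subst sum.reindex) (auto simp: inj_on_def components_def list_weight_def intro!: sum.cong)
  also have "\<dots> = (\<Sum>b\<in>UNIV. q (part V b x)) * (\<Sum>d\<in>parities (length xs). list_weight q (components V d xs))"
    by (simp only: sum_product sum.cartesian_product)
  also have "\<dots> = list_weight q (x # xs)"
    unfolding Cons.IH using good_seminormD(2)[OF q, of x] by (simp add: UNIV_bool list_weight_def add.commute)
  finally show ?case .
qed

text \<open>Signs have norm 1, permuting keeps the weight, the parity components add up exactly and
  \<open>1 / n!\<close> cancels the \<open>n!\<close> permutations, so symmetrizing costs
  nothing.\<close>

lemma rep_bound_symmetrize_pure:
  assumes q: "good_seminorm q"
  shows "rep_bound (pure V) (weyl_weight R q) (symmetrize V (pure V xs)) (weyl_weight R q xs)"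
proof -
  have perm: "rep_bound (pure V) (weyl_weight R q) (permute_tensor V \<sigma> xs) (weyl_weight R q xs)"
    if \<sigma>: "\<sigma> permutes {..<length xs}" for \<sigma>
  proof -
    have "rep_bound (pure V) (weyl_weight R q) (permute_tensor V \<sigma> xs)
        (\<Sum>d\<in>parities (length xs). list_weight q (components V d xs) * fact (length xs) powr R)"
      unfolding permute_tensor_def
    proof (rule rep_bound_sum)
      fix d assume "d \<in> parities (length xs)"
      hence d: "length d = length xs" by (simp add: parities_def)
      let ?ys = "permute_list \<sigma> (components V d xs)"
      have "weyl_weight R q ?ys = list_weight q (components V d xs) * fact (length xs) powr R"
        using \<sigma> d by (simp add: weyl_weight_def list_weight_permute)
      with rep_bound_scale[OF rep_bound_base[of "pure V" "weyl_weight R q" ?ys], of "koszul_sign d \<sigma>"]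
      show "rep_bound (pure V) (weyl_weight R q) (tscale (koszul_sign d \<sigma>) (pure V ?ys))
          (list_weight q (components V d xs) * fact (length xs) powr R)"
        by (simp add: norm_koszul_sign)
    qed
    thus ?thesis
      by (simp only: sum_distrib_right[symmetric] sum_parities_weight[OF q] weyl_weight_def)
  qed
  have "rep_bound (pure V) (weyl_weight R q) (\<Sum>\<sigma> | \<sigma> permutes {..<length xs}. permute_tensor V \<sigma> xs)
      (\<Sum>\<sigma> | \<sigma> permutes {..<length xs}. weyl_weight R q xs)"
    by (rule rep_bound_sum) (use perm in simp)
  from rep_bound_scale[OF this, of "1 / fact (length xs)"] show ?thesis
    unfolding symmetrize_pure by (simp add: card_permutations norm_divide)
qed

definition pair_weight :: "('v \<Rightarrow> real) \<Rightarrow> (nat \<Rightarrow> nat \<Rightarrow> real) \<Rightarrow> 'v list \<times> 'v list \<Rightarrow> real" where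
  "pair_weight q u = (\<lambda>(xs, ys). u (length xs) (length ys) * (list_weight q xs * list_weight q ys))"

text \<open>The bound on the form gives back exactly the two entries that \<open>omit\<close>
  removed. Each term thus has a weight that does not depend on \<open>k\<close> and
  \<open>l\<close>, and counting the terms produces the factor \<open>n * m\<close> of
  \<open>lower\<close>.\<close>

lemma rep_bound_contraction_pure2:
  assumes q: "good_seminorm q" and u: "\<And>n m. 0 \<le> u n m"
  shows "rep_bound pure_pair (pair_weight q u) (contraction V (pure2 V xs ys)) (pair_weight q (lower u) (xs, ys))"
proof -
  define n m where "n = length xs" and "m = length ys"
  let ?T = "\<lambda>d e. u (n - 1) (m - 1) * (list_weight q (components V d xs) * list_weight q (components V e ys))"
  have tm: "rep_bound pure_pair (pair_weight q u)
      (tscale (contraction_sign d k e l * form V (components V d xs ! k) (components V e ys ! l))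
         (pure2 V (omit k (components V d xs)) (omit l (components V e ys)))) (?T d e)"
    if "d \<in> parities (length xs)" "e \<in> parities (length ys)" "k \<in> {..<length xs}" "l \<in> {..<length ys}" for d e k l
  proof -
    define xd ye where "xd = components V d xs" and "ye = components V e ys"
    have len: "length xd = n" "length ye = m" "k < length xd" "l < length ye"
      using that unfolding xd_def ye_def n_def m_def by (simp_all add: parities_def)
    let ?c = "contraction_sign d k e l * form V (xd ! k) (ye ! l)"
    have "norm ?c * pair_weight q u (omit k xd, omit l ye) =
        norm (form V (xd ! k) (ye ! l)) * (u (n - 1) (m - 1) * (list_weight q (omit k xd) * list_weight q (omit l ye)))"
      using len by (simp add: norm_mult norm_contraction_sign pair_weight_def length_omit)
    also have "\<dots> \<le> (q (xd ! k) * q (ye ! l)) * (u (n - 1) (m - 1) * (list_weight q (omit k xd) * list_weight q (omit l ye)))"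
      by (intro mult_right_mono good_seminormD(3)[OF q] mult_nonneg_nonneg u list_weight_nonneg good_seminormD(1)[OF q])
    also have "\<dots> = u (n - 1) (m - 1) * (list_weight q xd * list_weight q ye)"
      unfolding list_weight_omit[OF len(3)] list_weight_omit[OF len(4)] by (simp only: mult_ac)
    finally have le: "norm ?c * pair_weight q u (omit k xd, omit l ye) \<le> u (n - 1) (m - 1) * (list_weight q xd * list_weight q ye)" .
    have "rep_bound pure_pair (pair_weight q u) (tscale ?c (pure2 V (omit k xd) (omit l ye)))
        (norm ?c * pair_weight q u (omit k xd, omit l ye))"
      using rep_bound_scale[OF rep_bound_base[of pure_pair "pair_weight q u" "(omit k xd, omit l ye)"], of ?c] by simp
    from rep_bound_mono[OF this le] show ?thesis unfolding xd_def ye_def .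
  qed
  have "rep_bound pure_pair (pair_weight q u) (contraction V (pure2 V xs ys))
      (\<Sum>d\<in>parities (length xs). \<Sum>e\<in>parities (length ys). \<Sum>k<length xs. \<Sum>l<length ys. ?T d e)"
    unfolding contraction_pure2 by (rule rep_bound_sum)+ (rule tm)
  also have "(\<Sum>d\<in>parities (length xs). \<Sum>e\<in>parities (length ys). \<Sum>k<length xs. \<Sum>l<length ys. ?T d e) =
      (\<Sum>d\<in>parities (length xs). \<Sum>e\<in>parities (length ys). real n * real m * u (n - 1) (m - 1) *
        (list_weight q (components V d xs) * list_weight q (components V e ys)))"
    by (simp add: n_def m_def mult_ac)
  also have "\<dots> = real n * real m * u (n - 1) (m - 1) * (\<Sum>d\<in>parities (length xs). \<Sum>e\<in>parities (length ys).
      list_weight q (components V d xs) * list_weight q (components V e ys))"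
    by (simp only: sum_distrib_left)
  also have "\<dots> = real n * real m * u (n - 1) (m - 1) *
      ((\<Sum>d\<in>parities (length xs). list_weight q (components V d xs)) * (\<Sum>e\<in>parities (length ys). list_weight q (components V e ys)))"
    by (simp only: sum_product)
  also have "\<dots> = pair_weight q (lower u) (xs, ys)"
    unfolding sum_parities_weight[OF q] by (simp add: pair_weight_def lower_def n_def m_def)
  finally show ?thesis .
qed

text \<open>Weights travel backwards: after the last contraction the weight is \<open>u\<close>, and
  each earlier stage needs one more \<open>lower\<close>.\<close>

lemma rep_bound_contraction_power:
  assumes q: "good_seminorm q" and u: "\<And>n m. 0 \<le> u n m"
    and t: "rep_bound pure_pair (pair_weight q ((lower ^^ k) u)) t r"
  shows "rep_bound pure_pair (pair_weight q u) ((contraction V ^^ k) t) r"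
  using t
proof (induction k arbitrary: t)
  case (Suc k)
  have lin: "span_linear pure_pair (contraction V)"
    unfolding contraction_def by (rule span_linear_lin_extend)
  have lu: "0 \<le> (lower ^^ k) u n m" for n m by (rule lower_power_nonneg[OF u])
  have "rep_bound pure_pair (pair_weight q ((lower ^^ k) u)) (contraction V (pure_pair v))
      (1 * pair_weight q (lower ((lower ^^ k) u)) v)" for v
    using rep_bound_contraction_pure2[OF q lu, where xs = "fst v" and ys = "snd v"]
    by (simp add: case_prod_beta)
  from rep_bound_linear[OF lin zero_le_one this Suc.prems[unfolded funpow.simps o_apply]]
  have "rep_bound pure_pair (pair_weight q ((lower ^^ k) u)) (contraction V t) r" unfolding mult_1 .
  from Suc.IH[OF this] show ?case by (simp only: funpow_Suc_right o_apply)
qed simp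

text \<open>A concatenation has length \<open>n + m\<close>, so this degree weight is exactly
  \<open>weyl_weight\<close> of \<open>xs @ ys\<close>, which symmetrizing does not
  increase.\<close>

lemma rep_bound_sym_mult:
  assumes q: "good_seminorm q" and t: "rep_bound pure_pair (pair_weight q (\<lambda>n m. fact (n + m) powr R)) t r"
  shows "rep_bound (pure V) (weyl_weight R q) (sym_mult V t) r"
proof -
  have lin: "span_linear pure_pair (sym_mult V)"
    unfolding span_linear_def using sym_mult_add sym_mult_scale by blast
  have "rep_bound (pure V) (weyl_weight R q) (sym_mult V (pure_pair v)) (1 * pair_weight q (\<lambda>n m. fact (n + m) powr R) v)" for v
  proof -
    obtain xs ys where v: "v = (xs, ys)" by fastforce
    have "pair_weight q (\<lambda>n m. fact (n + m) powr R) (xs, ys) = weyl_weight R q (xs @ ys)"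
      by (simp add: pair_weight_def weyl_weight_def list_weight_append)
    thus ?thesis unfolding v sym_mult_def using rep_bound_symmetrize_pure[OF q, of R "xs @ ys"]
      by (simp add: lin_extend_append_pure2)
  qed
  from rep_bound_linear[OF lin zero_le_one this t] show ?thesis unfolding mult_1 .
qed

text \<open>The constant of \<open>star_weight_le\<close> carries the sum of both lengths as
  exponent; it splits into one power per list and becomes a factor of \<open>q\<close>.\<close>

lemma rep_bound_star_sum:
  fixes z :: 'k
  assumes q: "good_seminorm q" and R: "1 / 2 \<le> R"
  defines "w \<equiv> weyl_weight R (\<lambda>v. (1 + norm z) * (2 * 2 powr R) * q v)"
  shows "rep_bound (pure V) (weyl_weight R q) (star_sum z N (pure2 V xs ys)) (w xs * w ys)"
proof -
  let ?u = "\<lambda>n m. fact (n + m) powr R"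
  define D where "D = (1 + norm z) * (2 * 2 powr R)"
  define n m where "n = length xs" and "m = length ys"
  let ?l = "list_weight q xs * list_weight q ys"
  have l: "0 \<le> ?l" by (intro mult_nonneg_nonneg list_weight_nonneg good_seminormD(1)[OF q])
  have "rep_bound (pure V) (weyl_weight R q) (star_sum z N (pure2 V xs ys))
      (\<Sum>k<N. norm (z ^ k / fact k) * pair_weight q ((lower ^^ k) ?u) (xs, ys))"
    unfolding star_sum_def
  proof (rule rep_bound_sum)
    fix k
    have "rep_bound pure_pair (pair_weight q ((lower ^^ k) ?u)) (pure2 V xs ys) (pair_weight q ((lower ^^ k) ?u) (xs, ys))"
      using rep_bound_base[of pure_pair "pair_weight q ((lower ^^ k) ?u)" "(xs, ys)"] by simp
    from rep_bound_scale[OF rep_bound_sym_mult[OF q rep_bound_contraction_power[OF q _ this]]]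
    show "rep_bound (pure V) (weyl_weight R q)
        (tscale (z ^ k / fact k) (sym_mult V ((contraction V ^^ k) (pure2 V xs ys))))
        (norm (z ^ k / fact k) * pair_weight q ((lower ^^ k) ?u) (xs, ys))" by simp
  qed
  moreover have "(\<Sum>k<N. norm (z ^ k / fact k) * pair_weight q ((lower ^^ k) ?u) (xs, ys)) \<le> w xs * w ys"
  proof -
    have "(\<Sum>k<N. norm (z ^ k / fact k) * pair_weight q ((lower ^^ k) ?u) (xs, ys)) =
        (\<Sum>k<N. norm z ^ k / fact k * (lower ^^ k) ?u n m) * ?l"
      unfolding sum_distrib_right
      by (rule sum.cong) (simp_all add: norm_divide norm_power pair_weight_def n_def m_def)
    also have "\<dots> \<le> D ^ (n + m) * (fact n powr R * fact m powr R) * ?l"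
      unfolding D_def by (rule mult_right_mono[OF star_weight_le[OF R] l]) simp
    also have "\<dots> = w xs * w ys"
      unfolding w_def D_def[symmetric] weyl_weight_def list_weight_scale n_def m_def power_add by (simp only: mult_ac)
    finally show ?thesis .
  qed
  ultimately show ?thesis by (rule rep_bound_mono)
qed

lemma star_seminorm_bound:
  assumes p: "continuous_seminorm V p" and R: "1 / 2 \<le> R"
  shows "\<exists>p'. continuous_seminorm V p' \<and> (\<forall>a\<in>tspan (pure V). \<forall>b\<in>tspan (pure V).
    weyl_seminorm V R p (star V z a b) \<le> weyl_seminorm V R p' a * weyl_seminorm V R p' b)"
proof -
  obtain q where q: "continuous_seminorm V q" "good_seminorm q" "\<And>v. p v \<le> q v"
    using good_seminorm_exists[OF p] by blast
  define p' where "p' v = (1 + norm z) * (2 * 2 powr R) * q v" for v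
  have p': "continuous_seminorm V p'"
    unfolding p'_def by (rule continuous_seminorm_cmult[OF q(1)]) simp
  have pn: "0 \<le> p v" "0 \<le> p' v" for v
    by (rule continuous_seminormD(1)[OF p], rule continuous_seminormD(1)[OF p'])
  have "weyl_seminorm V R p (star V z a b) \<le> weyl_seminorm V R p' a * weyl_seminorm V R p' b"
    if a: "a \<in> tspan (pure V)" and b: "b \<in> tspan (pure V)" for a b
  proof -
    let ?N = "weyl_seminorm V R p'"
    \<comment> \<open>Representations are guaranteed only strictly above the seminorms; the product
      of the seminorms themselves is reached by a limit from above.\<close>
    have bound: "weyl_seminorm V R p (star V z a b) \<le> r * s" if r: "?N a < r" and s: "?N b < s" for r s
    proof -
      obtain N where N: "\<And>n. N \<le> n \<Longrightarrow> star V z a b = star_sum z n (tensor_pair V a b)"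
        using star_eq_star_sum[OF a b, of z] by blast
      have r0: "0 \<le> r" using weyl_nonneg[where p = p', OF pn(2) a, of R] r by linarith
      let ?w = "weyl_weight R p'"
      have w0: "0 \<le> ?w xs" for xs by (rule weyl_weight_nonneg[where p = p', OF pn(2)])
      have tp: "rep_bound pure_pair (\<lambda>(xs, ys). ?w xs * ?w ys) (tensor_pair V a b) (r * s)"
        by (rule rep_bound_tensor_pair[OF w0 rep_bound_weyl[OF a r] rep_bound_weyl[OF b s] r0])
      have "rep_bound (pure V) (weyl_weight R q) (star_sum z N (pure_pair v)) (1 * (\<lambda>(xs, ys). ?w xs * ?w ys) v)" for v
        using rep_bound_star_sum[OF q(2) R, of z N "fst v" "snd v"] unfolding p'_def by (simp add: case_prod_beta)
      from rep_bound_linear[OF span_linear_star_sum zero_le_one this tp]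
      have "rep_bound (pure V) (weyl_weight R q) (star V z a b) (r * s)" unfolding mult_1 N[OF order_refl] .
      from rep_bound_weight_mono[OF this weyl_weight_mono[where p = p, OF pn(1) q(3)]]
      show ?thesis by (rule weyl_seminorm_le[where p = p, OF pn(1)])
    qed
    have lim: "((\<lambda>e. (?N a + e) * (?N b + e)) \<longlongrightarrow> (?N a + 0) * (?N b + 0)) (at_right 0)"
      by (intro tendsto_intros)
    have "weyl_seminorm V R p (star V z a b) \<le> (?N a + 0) * (?N b + 0)"
    proof (rule tendsto_lowerbound[OF lim])
      show "\<forall>\<^sub>F e in at_right 0. weyl_seminorm V R p (star V z a b) \<le> (?N a + e) * (?N b + e)"
        unfolding eventually_at_right_field by (intro exI[of _ 1]) (auto intro!: bound)
    qed simp
    thus ?thesis by simp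
  qed
  with p' show ?thesis by (intro exI conjI ballI)
qed

end

section \<open>The Weyl algebra as a topological algebra\<close>

lemma lin_extend_diff:
  fixes \<Phi> :: "'i \<Rightarrow> 'x \<Rightarrow> 'k::comm_ring_1"
  shows "lin_extend \<Phi> (s - t) = lin_extend \<Phi> s - lin_extend \<Phi> t"
  by (simp add: lin_extend_def fun_eq_iff)

definition pseudometric_on :: "'a set \<Rightarrow> ('a \<Rightarrow> 'a \<Rightarrow> real) \<Rightarrow> bool" where
  "pseudometric_on S d \<longleftrightarrow> (\<forall>x\<in>S. d x x = 0) \<and> (\<forall>x\<in>S. \<forall>y\<in>S. 0 \<le> d x y) \<and>
     (\<forall>x\<in>S. \<forall>y\<in>S. d x y = d y x) \<and> (\<forall>x\<in>S. \<forall>y\<in>S. \<forall>z\<in>S. d x z \<le> d x y + d y z)"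

lemma gauged_spaceI:
  assumes "gauge M \<noteq> {}" "\<And>d. d \<in> gauge M \<Longrightarrow> pseudometric_on (carrier M) d"
  shows "gauged_space M"
  using assms unfolding gauged_space_def pseudometric_on_def by blast

lemma close_filters_filtermap2:
  assumes "eventually P F" "eventually P' F'" "eventually Q G" "eventually Q' G'"
    and "\<And>x x' y y'. P x \<Longrightarrow> P' x' \<Longrightarrow> Q y \<Longrightarrow> Q' y' \<Longrightarrow> d (h x y) (h x' y') < \<epsilon>"
  shows "\<exists>A B. eventually A (filtermap (\<lambda>(x, y). h x y) (F \<times>\<^sub>F G)) \<and>
    eventually B (filtermap (\<lambda>(x, y). h x y) (F' \<times>\<^sub>F G')) \<and> (\<forall>u v. A u \<longrightarrow> B v \<longrightarrow> d u v < \<epsilon>)"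
proof (intro exI conjI)
  show "eventually (\<lambda>z. \<exists>x y. P x \<and> Q y \<and> z = h x y) (filtermap (\<lambda>(x, y). h x y) (F \<times>\<^sub>F G))"
    "eventually (\<lambda>z. \<exists>x y. P' x \<and> Q' y \<and> z = h x y) (filtermap (\<lambda>(x, y). h x y) (F' \<times>\<^sub>F G'))"
    unfolding eventually_filtermap eventually_prod_filter using assms(1-4) by fastforce+
  show "\<forall>u v. (\<exists>x y. P x \<and> Q y \<and> u = h x y) \<longrightarrow> (\<exists>x y. P' x \<and> Q' y \<and> v = h x y) \<longrightarrow> d u v < \<epsilon>"
  proof (intro allI impI; elim exE conjE; hypsubst)
    fix x y x' y' assume "P x" "Q y" "P' x'" "Q' y'"
    thus "d (h x y) (h x' y') < \<epsilon>" by (intro assms(5))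
  qed
qed

text \<open>Closeness for the pairs \<open>(F, F)\<close> and \<open>(G, G)\<close> already contains
  the Cauchy property of the image filter.\<close>

lemma cauchy_map2I:
  assumes M: "gauged_space M"
    and closed: "\<And>x y. x \<in> carrier M \<Longrightarrow> y \<in> carrier M \<Longrightarrow> h x y \<in> carrier M"
    and cl: "\<And>F F' G G'. (F, F') \<in> cauchy_equiv M \<Longrightarrow> (G, G') \<in> cauchy_equiv M \<Longrightarrow>
      close_filters M (filtermap (\<lambda>(x, y). h x y) (F \<times>\<^sub>F G)) (filtermap (\<lambda>(x, y). h x y) (F' \<times>\<^sub>F G'))"
  shows "cauchy_map2 M h"
proof -
  interpret M: gauged_space M by fact
  let ?H = "\<lambda>F G. filtermap (\<lambda>(x, y). h x y) (F \<times>\<^sub>F G)"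
  have cauchy: "?H F G \<in> cauchy_filters M" if F: "F \<in> cauchy_filters M" and G: "G \<in> cauchy_filters M" for F G
  proof -
    note FD = M.cauchy_equivD[OF M.cauchy_equiv_refl[OF F]] and GD = M.cauchy_equivD[OF M.cauchy_equiv_refl[OF G]]
    have "?H F G \<le> principal (carrier M)"
      by (rule filtermap_carrier[OF prod_filter_carrier[OF FD(3) GD(3)]]) (auto intro: closed)
    thus ?thesis unfolding cauchy_filters_def
      using cl[OF M.cauchy_equiv_refl[OF F] M.cauchy_equiv_refl[OF G]] FD(1) GD(1)
      by (simp add: filtermap_bot_iff prod_filter_eq_bot)
  qed
  show ?thesis
    unfolding cauchy_map2_def
  proof (intro allI impI)
    fix F F' G G' assume FG: "(F, F') \<in> cauchy_equiv M" "(G, G') \<in> cauchy_equiv M"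
    note fields = cauchy_equiv_fields[OF FG(1)] cauchy_equiv_fields[OF FG(2)]
    have "?H F G \<in> cauchy_filters M" "?H F' G' \<in> cauchy_filters M"
      by (rule cauchy; use fields in blast)+
    with cl[OF FG] show "(?H F G, ?H F' G') \<in> cauchy_equiv M" unfolding cauchy_equiv_def by blast
  qed
qed

text \<open>Some set of a Cauchy filter lies within distance 1 of a fixed point. This boundedness
  takes the place of uniform continuity for the product.\<close>

lemma (in gauged_space) eventually_bounded:
  assumes F: "F \<in> cauchy_filters M" and d: "d \<in> gauge M" and z: "z \<in> carrier M"
  obtains K where "0 < K" "\<forall>\<^sub>F x in F. d x z \<le> K"
proof -
  note FD = cauchy_equivD[OF cauchy_equiv_refl[OF F]]
  from close_filtersE[OF FD(5) d zero_less_one FD(3,3)] obtain P Q where PQ: "eventually P F" "eventually Q F"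
    "\<And>x. P x \<Longrightarrow> x \<in> carrier M" "\<And>y. Q y \<Longrightarrow> y \<in> carrier M" "\<And>x y. P x \<Longrightarrow> Q y \<Longrightarrow> d x y < 1" by blast
  from eventually_happens'[OF FD(1) PQ(2)] obtain y where y: "Q y" by blast
  have "d x z \<le> 1 + d y z" if "P x" for x
    using gauge_triangle[OF d PQ(3)[OF that] PQ(4)[OF y] z] PQ(5)[OF that y] by linarith
  with PQ(1) have "\<forall>\<^sub>F x in F. d x z \<le> 1 + d y z" by (auto elim: eventually_mono)
  moreover have "0 < 1 + d y z" using gauge_nonneg[OF d PQ(4)[OF y] z] by linarith
  ultimately show ?thesis by (rule that[rotated])
qed

lemma weyl_algebra_sel [simp]:
  "carrier (weyl_algebra V R z) = symmetric_algebra V"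
  "mult (weyl_algebra V R z) = star V z"
  "one (weyl_algebra V R z) = pure V []"
  "add (weyl_algebra V R z) = (+)"
  "Module.smult (weyl_algebra V R z) = tscale"
  "gauge (weyl_algebra V R z) = {\<lambda>a b. weyl_seminorm V R p (a - b) | p. continuous_seminorm V p}"
  by (simp_all add: weyl_algebra_def)

context poisson_space
begin

lemma sym_span: "a \<in> symmetric_algebra V \<Longrightarrow> a \<in> tspan (pure V)"
  using symmetric_algebra_subset by (rule subsetD)

lemma weyl_carrier_span: "a \<in> carrier (weyl_algebra V R z) \<Longrightarrow> a \<in> tspan (pure V)"
  unfolding weyl_algebra_sel by (rule sym_span)

lemma weyl_gauge:
  "d \<in> gauge (weyl_algebra V R z) \<Longrightarrow>
    \<exists>p. continuous_seminorm V p \<and> d = (\<lambda>a b. weyl_seminorm V R p (a - b))"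
  by auto

text \<open>\<open>weyl_scale\<close> is only an inequality, so it is used with the scalar -1 in
  both directions.\<close>

lemma weyl_commute:
  assumes p: "\<And>v. 0 \<le> p v" and a: "a \<in> tspan (pure V)" and b: "b \<in> tspan (pure V)"
  shows "weyl_seminorm V R p (a - b) = weyl_seminorm V R p (b - a)"
proof -
  have "weyl_seminorm V R p (a - b) \<le> weyl_seminorm V R p (b - a)"
    if "a \<in> tspan (pure V)" "b \<in> tspan (pure V)" for a b
  proof -
    have "tscale (- 1) (b - a) = a - b" by (simp add: tscale_def fun_eq_iff)
    with weyl_scale[where p = p, OF p tensor.span_diff[OF that(2,1)], of R "- 1"] show ?thesis by simp
  qed
  from antisym[OF this[OF a b] this[OF b a]] show ?thesis .
qed

lemma weyl_triangle:
  assumes p: "\<And>v. 0 \<le> p v" and "a \<in> tspan (pure V)" "b \<in> tspan (pure V)" "c \<in> tspan (pure V)"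
  shows "weyl_seminorm V R p (a - c) \<le> weyl_seminorm V R p (a - b) + weyl_seminorm V R p (b - c)"
  using weyl_add[where p = p, OF p tensor.span_diff[OF assms(2,3)] tensor.span_diff[OF assms(3,4)], of R]
  by (simp only: diff_add_cancel add_diff_eq)

lemma gauged_space_weyl: "gauged_space (weyl_algebra V R z)"
proof (rule gauged_spaceI)
  show "gauge (weyl_algebra V R z) \<noteq> {}" using continuous_seminorm_0 by auto
  fix d assume "d \<in> gauge (weyl_algebra V R z)"
  from weyl_gauge[OF this] obtain p where p: "continuous_seminorm V p \<and> d = (\<lambda>a b. weyl_seminorm V R p (a - b))" ..
  note pn = continuous_seminormD(1)[OF conjunct1[OF p]]
  show "pseudometric_on (carrier (weyl_algebra V R z)) d"
    unfolding pseudometric_on_def conjunct2[OF p] diff_self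
    by (intro conjI ballI weyl_0[OF pn] weyl_nonneg[OF pn] weyl_commute[OF pn] weyl_triangle[OF pn]
        tensor.span_diff weyl_carrier_span; assumption)
qed

lemma cauchy_add_weyl: "cauchy_map2 (weyl_algebra V R z) (+)"
proof (rule cauchy_map2I[OF gauged_space_weyl])
  fix x y assume "x \<in> carrier (weyl_algebra V R z)" "y \<in> carrier (weyl_algebra V R z)"
  thus "x + y \<in> carrier (weyl_algebra V R z)" by (simp add: symmetric_algebra_add)
next
  interpret M: gauged_space "weyl_algebra V R z" by (rule gauged_space_weyl)
  fix F F' G G'
  assume F: "(F, F') \<in> cauchy_equiv (weyl_algebra V R z)" and G: "(G, G') \<in> cauchy_equiv (weyl_algebra V R z)"
  show "close_filters (weyl_algebra V R z) (filtermap (\<lambda>(x, y). x + y) (F \<times>\<^sub>F G))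
      (filtermap (\<lambda>(x, y). x + y) (F' \<times>\<^sub>F G'))"
  proof (rule M.close_filtersI)
    fix d and \<epsilon> :: real
    assume d: "d \<in> gauge (weyl_algebra V R z)" and e: "0 < \<epsilon>"
    from weyl_gauge[OF d] obtain p where p: "continuous_seminorm V p" and d': "d = (\<lambda>a b. weyl_seminorm V R p (a - b))"
      by (elim exE conjE)
    note pn = continuous_seminormD(1)[OF p]
    have e2: "0 < \<epsilon> / 2" using e by simp
    from M.close_filtersE[OF M.cauchy_equivD(7)[OF F] d e2 M.cauchy_equivD(3,4)[OF F]]
    obtain P P' where P: "eventually P F" "eventually P' F'" "\<And>x. P x \<Longrightarrow> x \<in> carrier (weyl_algebra V R z)"
      "\<And>x. P' x \<Longrightarrow> x \<in> carrier (weyl_algebra V R z)" "\<And>x y. P x \<Longrightarrow> P' y \<Longrightarrow> d x y < \<epsilon> / 2" by blast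
    from M.close_filtersE[OF M.cauchy_equivD(7)[OF G] d e2 M.cauchy_equivD(3,4)[OF G]]
    obtain Q Q' where Q: "eventually Q G" "eventually Q' G'" "\<And>x. Q x \<Longrightarrow> x \<in> carrier (weyl_algebra V R z)"
      "\<And>x. Q' x \<Longrightarrow> x \<in> carrier (weyl_algebra V R z)" "\<And>x y. Q x \<Longrightarrow> Q' y \<Longrightarrow> d x y < \<epsilon> / 2" by blast
    have less: "d (x + y) (x' + y') < \<epsilon>" if "P x" "P' x'" "Q y" "Q' y'" for x x' y y'
    proof -
      note c = weyl_carrier_span[OF P(3)[OF that(1)]] weyl_carrier_span[OF P(4)[OF that(2)]] weyl_carrier_span[OF Q(3)[OF that(3)]] weyl_carrier_span[OF Q(4)[OF that(4)]]
      have "(x - x') + (y - y') = (x + y) - (x' + y')" by (simp add: algebra_simps)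
      with weyl_add[where p = p, OF pn tensor.span_diff[OF c(1,2)] tensor.span_diff[OF c(3,4)], of R]
      show ?thesis using P(5)[OF that(1,2)] Q(5)[OF that(3,4)] unfolding d' by simp
    qed
    show "\<exists>A B. eventually A (filtermap (\<lambda>(x, y). x + y) (F \<times>\<^sub>F G)) \<and>
        eventually B (filtermap (\<lambda>(x, y). x + y) (F' \<times>\<^sub>F G')) \<and> (\<forall>u v. A u \<longrightarrow> B v \<longrightarrow> d u v < \<epsilon>)"
      by (rule close_filters_filtermap2[where h = "(+)" and d = d, OF P(1,2) Q(1,2) less])
  qed
qed

text \<open>Write \<open>x y - x' y' = (x - x') y + x' (y - y')\<close>. The differences become
  small while \<open>y\<close> and \<open>x'\<close> stay bounded along their Cauchy filters, all
  measured by the one seminorm \<open>q\<close> that dominates the product.\<close>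

lemma cauchy_mult_weyl:
  assumes R: "1 / 2 \<le> R"
  shows "cauchy_map2 (weyl_algebra V R z) (star V z)"
proof (rule cauchy_map2I[OF gauged_space_weyl])
  fix x y assume "x \<in> carrier (weyl_algebra V R z)" "y \<in> carrier (weyl_algebra V R z)"
  from star_symmetric[OF this[THEN weyl_carrier_span]] show "star V z x y \<in> carrier (weyl_algebra V R z)" by simp
next
  interpret M: gauged_space "weyl_algebra V R z" by (rule gauged_space_weyl)
  fix F F' G G'
  assume F: "(F, F') \<in> cauchy_equiv (weyl_algebra V R z)" and G: "(G, G') \<in> cauchy_equiv (weyl_algebra V R z)"
  show "close_filters (weyl_algebra V R z) (filtermap (\<lambda>(x, y). star V z x y) (F \<times>\<^sub>F G))
      (filtermap (\<lambda>(x, y). star V z x y) (F' \<times>\<^sub>F G'))"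
  proof (rule M.close_filtersI)
    fix d and \<epsilon> :: real
    assume d: "d \<in> gauge (weyl_algebra V R z)" and e: "0 < \<epsilon>"
    from weyl_gauge[OF d] obtain p where p: "continuous_seminorm V p" and d': "d = (\<lambda>a b. weyl_seminorm V R p (a - b))"
      by (elim exE conjE)
    from star_seminorm_bound[OF p R, of z] obtain q where q: "continuous_seminorm V q" and
      le: "\<forall>a\<in>tspan (pure V). \<forall>b\<in>tspan (pure V).
        weyl_seminorm V R p (star V z a b) \<le> weyl_seminorm V R q a * weyl_seminorm V R q b" by (elim exE conjE)
    note star_le = bspec[OF bspec[OF le]]
    note pn = continuous_seminormD(1)[OF p] and qn = continuous_seminormD(1)[OF q]
    let ?N = "weyl_seminorm V R q"
    define D where "D = (\<lambda>a b. ?N (a - b))"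
    have D: "D \<in> gauge (weyl_algebra V R z)" unfolding D_def using q by auto
    have zero: "0 \<in> carrier (weyl_algebra V R z)" by (simp add: symmetric_algebra_0)
    from cauchy_equiv_fields[OF F] cauchy_equiv_fields[OF G]
    have FG: "F' \<in> cauchy_filters (weyl_algebra V R z)" "G \<in> cauchy_filters (weyl_algebra V R z)" by simp_all
    obtain K1 where K1: "0 < K1" "\<forall>\<^sub>F x in F'. D x 0 \<le> K1" using M.eventually_bounded[OF FG(1) D zero] .
    obtain K2 where K2: "0 < K2" "\<forall>\<^sub>F x in G. D x 0 \<le> K2" using M.eventually_bounded[OF FG(2) D zero] .
    define K where "K = K1 + K2"
    have K: "0 < K" "K1 \<le> K" "K2 \<le> K" using K1(1) K2(1) by (auto simp: K_def)
    \<comment> \<open>Each of the two error terms is then at most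
      \<open>\<delta> * K = \<epsilon> / 4\<close>.\<close>
    define \<delta> where "\<delta> = \<epsilon> / (4 * K)"
    have \<delta>: "0 < \<delta>" "\<delta> * K = \<epsilon> / 4" using e K(1) by (auto simp: \<delta>_def)
    from M.close_filtersE[OF M.cauchy_equivD(7)[OF F] D \<delta>(1) M.cauchy_equivD(3,4)[OF F]]
    obtain P P' where P: "eventually P F" "eventually P' F'" "\<And>x. P x \<Longrightarrow> x \<in> carrier (weyl_algebra V R z)"
      "\<And>x. P' x \<Longrightarrow> x \<in> carrier (weyl_algebra V R z)" "\<And>x y. P x \<Longrightarrow> P' y \<Longrightarrow> D x y < \<delta>" by blast
    from M.close_filtersE[OF M.cauchy_equivD(7)[OF G] D \<delta>(1) M.cauchy_equivD(3,4)[OF G]]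
    obtain Q Q' where Q: "eventually Q G" "eventually Q' G'" "\<And>x. Q x \<Longrightarrow> x \<in> carrier (weyl_algebra V R z)"
      "\<And>x. Q' x \<Longrightarrow> x \<in> carrier (weyl_algebra V R z)" "\<And>x y. Q x \<Longrightarrow> Q' y \<Longrightarrow> D x y < \<delta>" by blast
    have less: "d (star V z x y) (star V z x' y') < \<epsilon>"
      if "P x" "P' x'" "D x' 0 \<le> K1" "Q y" "D y 0 \<le> K2" "Q' y'" for x x' y y'
    proof -
      note c = weyl_carrier_span[OF P(3)[OF that(1)]] weyl_carrier_span[OF P(4)[OF that(2)]] weyl_carrier_span[OF Q(3)[OF that(4)]] weyl_carrier_span[OF Q(4)[OF that(6)]]
      note dx = tensor.span_diff[OF c(1,2)] and dy = tensor.span_diff[OF c(3,4)]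
      have s: "star V z (x - x') y \<in> tspan (pure V)" "star V z x' (y - y') \<in> tspan (pure V)"
        by (rule sym_span[OF star_symmetric[OF dx c(3)]], rule sym_span[OF star_symmetric[OF c(2) dy]])
      have "star V z x y = star V z (x - x') y + star V z x' y"
        using star_add_left[OF dx c(2,3), of z] by (simp only: diff_add_cancel)
      moreover have "star V z x' y = star V z x' (y - y') + star V z x' y'"
        using star_add_right[OF c(2) dy c(4), of z] by (simp only: diff_add_cancel)
      ultimately have eq: "star V z x y - star V z x' y' = star V z (x - x') y + star V z x' (y - y')"
        by (simp only: add.assoc[symmetric] add_diff_cancel_right')
      have N: "?N y \<le> K" "?N x' \<le> K" "?N (x - x') \<le> \<delta>" "?N (y - y') \<le> \<delta>"
        using that(3,5) K(2,3) P(5)[OF that(1,2)] Q(5)[OF that(4,6)] unfolding D_def diff_zero by linarith+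
      have "d (star V z x y) (star V z x' y') \<le>
          weyl_seminorm V R p (star V z (x - x') y) + weyl_seminorm V R p (star V z x' (y - y'))"
        unfolding d' eq by (rule weyl_add[where p = p, OF pn s])
      also have "\<dots> \<le> ?N (x - x') * ?N y + ?N x' * ?N (y - y')"
        by (rule add_mono[OF star_le[OF dx c(3)] star_le[OF c(2) dy]])
      also have "\<dots> \<le> \<delta> * K + K * \<delta>"
        by (rule add_mono[OF mult_mono[OF N(3,1)] mult_mono[OF N(2,4)]])
          (rule less_imp_le[OF \<delta>(1)] less_imp_le[OF K(1)]
            weyl_nonneg[where p = q, OF qn c(3)] weyl_nonneg[where p = q, OF qn dy])+
      also have "\<dots> < \<epsilon>" using \<delta>(2) e by (simp add: mult.commute)
      finally show ?thesis .
    qed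
    have less': "d (star V z x y) (star V z x' y') < \<epsilon>"
      if "P x" "P' x' \<and> D x' 0 \<le> K1" "Q y \<and> D y 0 \<le> K2" "Q' y'" for x x' y y'
      using that by (intro less) blast+
    show "\<exists>A B. eventually A (filtermap (\<lambda>(x, y). star V z x y) (F \<times>\<^sub>F G)) \<and>
        eventually B (filtermap (\<lambda>(x, y). star V z x y) (F' \<times>\<^sub>F G')) \<and> (\<forall>u v. A u \<longrightarrow> B v \<longrightarrow> d u v < \<epsilon>)"
      by (rule close_filters_filtermap2[where h = "star V z" and d = d, OF P(1) eventually_conj[OF P(2) K1(2)]
            eventually_conj[OF Q(1) K2(2)] Q(2) less'])
  qed
qed

lemma cauchy_smult_weyl: "cauchy_map (weyl_algebra V R z) (weyl_algebra V R z) (tscale c)"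
proof (rule lipschitz_imp_cauchy_map[OF gauged_space_weyl gauged_space_weyl])
  show "lipschitz_map (weyl_algebra V R z) (weyl_algebra V R z) (tscale c)"
    unfolding lipschitz_map_def
  proof (intro conjI ballI)
    show "tscale c ` carrier (weyl_algebra V R z) \<subseteq> carrier (weyl_algebra V R z)"
      using symmetric_algebra_scale by auto
    fix d assume d': "d \<in> gauge (weyl_algebra V R z)"
    from weyl_gauge[OF d'] obtain p where p: "continuous_seminorm V p" and d: "d = (\<lambda>a b. weyl_seminorm V R p (a - b))"
      by (elim exE conjE)
    note pn = continuous_seminormD(1)[OF p]
    \<comment> \<open>The added 1 keeps the Lipschitz constant positive for
      \<open>c = 0\<close>.\<close>
    have "d (tscale c x) (tscale c y) \<le> (norm c + 1) * d x y"
      if "x \<in> carrier (weyl_algebra V R z)" "y \<in> carrier (weyl_algebra V R z)" for x y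
    proof -
      note xy = tensor.span_diff[OF that[THEN weyl_carrier_span]]
      have "tscale c x - tscale c y = tscale c (x - y)"
        by (simp add: tscale_def fun_eq_iff algebra_simps)
      with weyl_scale[where p = p, OF pn xy, of R c] weyl_nonneg[where p = p, OF pn xy, of R]
      show ?thesis unfolding d by (simp add: distrib_right)
    qed
    moreover have "0 < norm c + 1" by (simp add: add_nonneg_pos)
    ultimately show "\<exists>d'\<in>gauge (weyl_algebra V R z). \<exists>C>0. \<forall>x\<in>carrier (weyl_algebra V R z).
        \<forall>y\<in>carrier (weyl_algebra V R z). d (tscale c x) (tscale c y) \<le> C * d' x y"
      by (intro bexI[OF _ d'] exI[of _ "norm c + 1"] conjI ballI)
  qed
qed

lemma topological_algebra_weyl:
  assumes "1 / 2 \<le> R"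
  shows "topological_algebra (weyl_algebra V R z)"
proof (intro topological_algebra.intro topological_algebra_axioms.intro)
  show "gauged_space (weyl_algebra V R z)" by (rule gauged_space_weyl)
qed (simp_all add: pure_Nil_symmetric cauchy_mult_weyl[OF assms] cauchy_add_weyl cauchy_smult_weyl)

end

section \<open>The induced map\<close>

lemma induced_map_add: "induced_map W A (s + t) = induced_map W A s + induced_map W A t"
  and induced_map_scale: "induced_map W A (tscale c t) = tscale c (induced_map W A t)"
  and induced_map_diff: "induced_map W A (s - t) = induced_map W A s - induced_map W A t"
  and induced_map_sum: "induced_map W A (\<Sum>x\<in>X. u x) = (\<Sum>x\<in>X. induced_map W A (u x))"
  unfolding induced_map_def by (rule lin_extend_add lin_extend_scale lin_extend_diff lin_extend_sum)+

lemma span_linear_induced: "span_linear P (induced_map W A)"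
  unfolding induced_map_def by (rule span_linear_lin_extend)

text \<open>The counterpart of \<open>induced_map\<close> on the space where the contraction acts,
  so that it can be moved past \<open>contraction\<close> before multiplying.\<close>

definition induced_map2 ::
    "('k::real_normed_field, 'w::ab_group_add) graded_space \<Rightarrow> ('v \<Rightarrow> 'w) \<Rightarrow>
     ('k, 'v list \<times> 'v list) tensor \<Rightarrow> ('k, 'w list \<times> 'w list) tensor" where
  "induced_map2 W A = lin_extend (\<lambda>(xs, ys). pure2 W (map A xs) (map A ys))"

lemma induced_map2_add: "induced_map2 W A (s + t) = induced_map2 W A s + induced_map2 W A t"
  and induced_map2_scale: "induced_map2 W A (tscale c t) = tscale c (induced_map2 W A t)"
  and induced_map2_sum: "induced_map2 W A (\<Sum>x\<in>X. u x) = (\<Sum>x\<in>X. induced_map2 W A (u x))"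
  unfolding induced_map2_def by (rule lin_extend_add lin_extend_scale lin_extend_sum)+

lemma span_linearI:
  assumes "\<And>s t. \<Phi> (s + t) = \<Phi> s + \<Phi> t" "\<And>c t. \<Phi> (tscale c t) = tscale c (\<Phi> t)"
  shows "span_linear P \<Phi>"
  unfolding span_linear_def by (intro conjI ballI allI assms)

lemma omit_map: "omit k (map f xs) = map f (omit k xs)"
  by (simp add: omit_def take_map drop_map)

locale poisson_map = V: poisson_space V + W: poisson_space W
  for V :: "('k::real_normed_field, 'v::{topological_ab_group_add, t2_space}) graded_space"
    and W :: "('k, 'w::{topological_ab_group_add, t2_space}) graded_space" +
  fixes A :: "'v \<Rightarrow> 'w"
  assumes map: "continuous_poisson_map V W A"
begin

lemma A_add: "A (v + w) = A v + A w" and A_scl: "A (scl V c v) = scl W c (A v)"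
  using map unfolding continuous_poisson_map_def Vector_Spaces.linear_iff by blast+

lemma A_form: "form W (A v) (A v') = form V v v'"
  using map unfolding continuous_poisson_map_def by blast

lemma A_continuous: "continuous_on UNIV A"
  using map unfolding continuous_poisson_map_def by blast

text \<open>The images of the two parts of \<open>v\<close> are homogeneous, so
  \<open>part W e\<close> keeps one of them and kills the other.\<close>

lemma A_part: "part W e (A v) = A (part V e v)"
proof -
  have hom: "A (part V e v) \<in> homogeneous W e" for e
    using map unfolding continuous_poisson_map_def homogeneous_def[of V] by blast
  have "A v = A (part V False v) + A (part V True v)"
    unfolding A_add[symmetric] V.part_sum ..
  hence "part W e (A v) = part W e (A (part V False v)) + part W e (A (part V True v))"
    by (simp only: W.part_add)
  thus ?thesis
    unfolding W.part_homogeneous[OF hom] by (cases e) simp_all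
qed

lemma A_components: "components W d (map A xs) = map A (components V d xs)"
proof (induction xs arbitrary: d)
  case (Cons x xs)
  thus ?case by (cases d) (simp_all add: components_def A_part)
qed (simp add: components_def)

lemma multilinear_form_map:
  assumes "multilinear_form W f"
  shows "multilinear_form V (\<lambda>xs. f (map A xs))"
  unfolding multilinear_form_def
proof (intro allI)
  fix us ws
  have lin: "Vector_Spaces.linear (scl W) (*) (\<lambda>v. f (map A us @ v # map A ws))"
    using assms unfolding multilinear_form_def by blast
  have add: "f (map A us @ (v + w) # map A ws) = f (map A us @ v # map A ws) + f (map A us @ w # map A ws)" for v w
    using lin unfolding W.linear_form_iff by blast
  have scl: "f (map A us @ scl W c v # map A ws) = c * f (map A us @ v # map A ws)" for c v
    using lin unfolding W.linear_form_iff by blast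
  show "Vector_Spaces.linear (scl V) (*) (\<lambda>v. f (map A (us @ v # ws)))"
    unfolding V.linear_form_iff map_append list.map A_add A_scl by (intro conjI allI add scl)
qed

lemma induced_pure: "induced_map W A (pure V xs) = pure W (map A xs)"
  unfolding induced_map_def by (rule V.lin_extend_pure) (rule multilinear_form_map[OF W.multilinear_pure])

lemma induced_pure2: "induced_map2 W A (pure2 V xs ys) = pure2 W (map A xs) (map A ys)"
proof -
  have "multilinear_form2 V (\<lambda>u. (\<lambda>(xs, ys). pure2 W (map A xs) (map A ys)) u f)" for f
    by (rule V.multilinear_form2I; unfold prod.case)
      (rule multilinear_form_map[OF W.multilinear_pure2(1)] multilinear_form_map[OF W.multilinear_pure2(2)])+
  from V.lin_extend_pure2[where \<Phi> = "\<lambda>(xs, ys). pure2 W (map A xs) (map A ys)", OF this]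
  show ?thesis unfolding induced_map2_def by simp
qed

lemma induced_span:
  assumes "t \<in> tspan (pure V)"
  shows "induced_map W A t \<in> tspan (pure W)"
proof (rule span_linear_image[OF span_linear_induced _ assms])
  fix xs
  show "induced_map W A (pure V xs) \<in> tspan (pure W)"
    unfolding induced_pure by (rule tensor.span_base) (rule rangeI)
qed

text \<open>Permuting a list commutes with mapping over it, and the Koszul signs depend only on the
  parities, which \<open>A\<close> preserves.\<close>

lemma induced_symmetrize:
  assumes "t \<in> tspan (pure V)"
  shows "induced_map W A (symmetrize V t) = symmetrize W (induced_map W A t)"
proof (rule span_linear_eq[where P = "pure V" and \<Phi> = "\<lambda>t. induced_map W A (symmetrize V t)"
      and \<Psi> = "\<lambda>t. symmetrize W (induced_map W A t)", OF _ _ _ assms])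
  show "span_linear (pure V) (\<lambda>t. induced_map W A (symmetrize V t))"
    by (rule span_linearI) (simp_all only: induced_map_add induced_map_scale V.symmetrize_add V.symmetrize_scale)
  show "span_linear (pure V) (\<lambda>t. symmetrize W (induced_map W A t))"
    by (rule span_linearI) (simp_all only: induced_map_add induced_map_scale W.symmetrize_add W.symmetrize_scale)
  fix xs
  have perm: "induced_map W A (permute_tensor V \<sigma> xs) = permute_tensor W \<sigma> (map A xs)"
    if \<sigma>: "\<sigma> permutes {..<length xs}" for \<sigma>
    unfolding permute_tensor_def length_map induced_map_sum induced_map_scale induced_pure
  proof (rule sum.cong[OF refl])
    fix d assume "d \<in> parities (length xs)"
    hence "length (components V d xs) = length xs" by (simp add: parities_def)
    with \<sigma> have "\<sigma> permutes {..<length (components V d xs)}" by simp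
    from permute_list_map[OF this, of A]
    show "tscale (koszul_sign d \<sigma>) (pure W (map A (permute_list \<sigma> (components V d xs)))) =
        tscale (koszul_sign d \<sigma>) (pure W (permute_list \<sigma> (components W d (map A xs))))"
      by (simp only: A_components)
  qed
  show "induced_map W A (symmetrize V (pure V xs)) = symmetrize W (induced_map W A (pure V xs))"
    unfolding V.symmetrize_pure induced_pure W.symmetrize_pure length_map induced_map_scale induced_map_sum
    by (rule arg_cong[where f = "tscale (1 / fact (length xs))"], rule sum.cong[OF refl])
      (rule perm, simp)
qed

lemma induced_symmetric:
  assumes "a \<in> symmetric_algebra V"
  shows "induced_map W A a \<in> symmetric_algebra W"
proof -
  from assms obtain t where t: "t \<in> tspan (pure V)" "a = symmetrize V t"
    unfolding symmetric_algebra_def tensor_algebra_def by blast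
  show ?thesis
    unfolding t(2) induced_symmetrize[OF t(1)] symmetric_algebra_def tensor_algebra_def
    by (rule imageI[OF induced_span[OF t(1)]])
qed

text \<open>Extended one factor at a time, the left one first: linearity in the right factor is then
  used with the left one fixed in the span.\<close>

lemma induced_tensor_pair:
  assumes a: "a \<in> tspan (pure V)" and b: "b \<in> tspan (pure V)"
  shows "induced_map2 W A (tensor_pair V a b) = tensor_pair W (induced_map W A a) (induced_map W A b)"
proof -
  have pure: "induced_map2 W A (tensor_pair V a (pure V ys)) = tensor_pair W (induced_map W A a) (induced_map W A (pure V ys))" for ys
  proof (rule span_linear_eq[where P = "pure V" and \<Phi> = "\<lambda>a. induced_map2 W A (tensor_pair V a (pure V ys))"
        and \<Psi> = "\<lambda>a. tensor_pair W (induced_map W A a) (induced_map W A (pure V ys))", OF _ _ _ a])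
    show "span_linear (pure V) (\<lambda>a. induced_map2 W A (tensor_pair V a (pure V ys)))"
      by (rule span_linearI) (simp_all only: tensor_pair_def lin_extend_add lin_extend_scale induced_map2_add induced_map2_scale)
    show "span_linear (pure V) (\<lambda>a. tensor_pair W (induced_map W A a) (induced_map W A (pure V ys)))"
      by (rule span_linearI) (simp_all only: tensor_pair_def lin_extend_add lin_extend_scale induced_map_add induced_map_scale)
    fix xs
    show "induced_map2 W A (tensor_pair V (pure V xs) (pure V ys)) =
        tensor_pair W (induced_map W A (pure V xs)) (induced_map W A (pure V ys))"
      unfolding V.tensor_pair_pure induced_pure W.tensor_pair_pure by (rule induced_pure2)
  qed
  show ?thesis
  proof (rule span_linear_eq[where P = "pure V" and \<Phi> = "\<lambda>b. induced_map2 W A (tensor_pair V a b)"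
        and \<Psi> = "\<lambda>b. tensor_pair W (induced_map W A a) (induced_map W A b)", OF _ _ pure b])
    note V2 = V.span_linear_tensor_pair2[OF a, unfolded span_linear_def]
    show "span_linear (pure V) (\<lambda>b. induced_map2 W A (tensor_pair V a b))"
      unfolding span_linear_def
    proof (intro conjI ballI allI)
      fix s t assume "s \<in> tspan (pure V)" "t \<in> tspan (pure V)"
      hence "tensor_pair V a (s + t) = tensor_pair V a s + tensor_pair V a t" using V2 by blast
      thus "induced_map2 W A (tensor_pair V a (s + t)) = induced_map2 W A (tensor_pair V a s) + induced_map2 W A (tensor_pair V a t)"
        by (simp only: induced_map2_add)
    next
      fix c t assume "t \<in> tspan (pure V)"
      hence "tensor_pair V a (tscale c t) = tscale c (tensor_pair V a t)" using V2 by blast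
      thus "induced_map2 W A (tensor_pair V a (tscale c t)) = tscale c (induced_map2 W A (tensor_pair V a t))"
        by (simp only: induced_map2_scale)
    qed
    note W2 = W.span_linear_tensor_pair2[OF induced_span[OF a], unfolded span_linear_def]
    show "span_linear (pure V) (\<lambda>b. tensor_pair W (induced_map W A a) (induced_map W A b))"
      unfolding span_linear_def
    proof (intro conjI ballI allI)
      fix s t assume s: "s \<in> tspan (pure V)" and t: "t \<in> tspan (pure V)"
      from induced_span[OF s] induced_span[OF t]
      show "tensor_pair W (induced_map W A a) (induced_map W A (s + t)) =
          tensor_pair W (induced_map W A a) (induced_map W A s) + tensor_pair W (induced_map W A a) (induced_map W A t)"
        unfolding induced_map_add using W2 by blast
    next
      fix c t assume "t \<in> tspan (pure V)"
      hence "induced_map W A t \<in> tspan (pure W)" by (rule induced_span)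
      thus "tensor_pair W (induced_map W A a) (induced_map W A (tscale c t)) =
          tscale c (tensor_pair W (induced_map W A a) (induced_map W A t))"
        unfolding induced_map_scale using W2 by blast
    qed
  qed
qed

text \<open>Invariance of the form keeps the coefficients and \<open>A_components\<close> keeps the
  parity patterns and hence the signs, so both sides agree term by term on generators.\<close>

lemma induced_contraction:
  assumes "t \<in> tspan V.pure_pair"
  shows "induced_map2 W A (contraction V t) = contraction W (induced_map2 W A t)"
proof (rule span_linear_eq[where P = V.pure_pair and \<Phi> = "\<lambda>t. induced_map2 W A (contraction V t)"
      and \<Psi> = "\<lambda>t. contraction W (induced_map2 W A t)", OF _ _ _ assms])
  show "span_linear V.pure_pair (\<lambda>t. induced_map2 W A (contraction V t))"
    by (rule span_linearI) (simp_all only: contraction_def lin_extend_add lin_extend_scale induced_map2_add induced_map2_scale)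
  show "span_linear V.pure_pair (\<lambda>t. contraction W (induced_map2 W A t))"
    by (rule span_linearI) (simp_all only: contraction_def lin_extend_add lin_extend_scale induced_map2_add induced_map2_scale)
  have pure: "induced_map2 W A (contraction V (pure2 V xs ys)) = contraction W (pure2 W (map A xs) (map A ys))" for xs ys
    unfolding V.contraction_pure2 W.contraction_pure2 induced_map2_sum induced_map2_scale induced_pure2
      length_map A_components omit_map
    by (intro sum.cong refl) (simp add: A_form parities_def)
  fix u
  show "induced_map2 W A (contraction V (V.pure_pair u)) = contraction W (induced_map2 W A (V.pure_pair u))"
    by (cases u) (simp only: prod.case pure induced_pure2)
qed

lemma induced_contraction_power:
  assumes "t \<in> tspan V.pure_pair"
  shows "induced_map2 W A ((contraction V ^^ k) t) = (contraction W ^^ k) (induced_map2 W A t)"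
proof (induction k)
  case (Suc k)
  have "induced_map2 W A ((contraction V ^^ Suc k) t) = contraction W (induced_map2 W A ((contraction V ^^ k) t))"
    unfolding funpow.simps o_apply by (rule induced_contraction[OF V.contraction_power_span[OF assms]])
  thus ?case unfolding Suc.IH funpow.simps o_apply .
qed (simp only: funpow.simps id_apply)

lemma induced_sym_mult:
  assumes t: "t \<in> tspan V.pure_pair"
  shows "induced_map W A (sym_mult V t) = sym_mult W (induced_map2 W A t)"
proof -
  let ?cV = "lin_extend (\<lambda>(xs, ys). pure V (xs @ ys))" and ?cW = "lin_extend (\<lambda>(xs, ys). pure W (xs @ ys))"
  have "?cV t \<in> tspan (pure V)"
  proof (rule span_linear_image[OF span_linear_lin_extend _ t])
    fix u
    show "?cV (V.pure_pair u) \<in> tspan (pure V)"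
      by (cases u) (simp only: prod.case V.lin_extend_append_pure2 tensor.span_base rangeI)
  qed
  moreover have "induced_map W A (?cV t) = ?cW (induced_map2 W A t)"
  proof (rule span_linear_eq[where P = V.pure_pair and \<Phi> = "\<lambda>t. induced_map W A (?cV t)"
        and \<Psi> = "\<lambda>t. ?cW (induced_map2 W A t)", OF _ _ _ t])
    show "span_linear V.pure_pair (\<lambda>t. induced_map W A (?cV t))"
      by (rule span_linearI) (simp_all only: lin_extend_add lin_extend_scale induced_map_add induced_map_scale)
    show "span_linear V.pure_pair (\<lambda>t. ?cW (induced_map2 W A t))"
      by (rule span_linearI) (simp_all only: lin_extend_add lin_extend_scale induced_map2_add induced_map2_scale)
    fix u
    show "induced_map W A (?cV (V.pure_pair u)) = ?cW (induced_map2 W A (V.pure_pair u))"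
      by (cases u) (simp only: prod.case V.lin_extend_append_pure2 induced_pure induced_pure2
          W.lin_extend_append_pure2 map_append)
  qed
  ultimately show ?thesis unfolding sym_mult_def by (simp only: induced_symmetrize)
qed

text \<open>The index sets of the two \<open>star\<close> sums may differ, since a nonzero
  contraction power can be mapped to zero. Truncated at a common cut-off, the sums agree term by
  term.\<close>

lemma induced_star:
  assumes a: "a \<in> tspan (pure V)" and b: "b \<in> tspan (pure V)"
  shows "induced_map W A (star V z a b) = star W z (induced_map W A a) (induced_map W A b)"
proof -
  obtain N1 where 1: "\<And>n. N1 \<le> n \<Longrightarrow> star V z a b = V.star_sum z n (tensor_pair V a b)"
    using V.star_eq_star_sum[OF a b, of z] by blast
  obtain N2 where 2: "\<And>n. N2 \<le> n \<Longrightarrow> star W z (induced_map W A a) (induced_map W A b) =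
      W.star_sum z n (tensor_pair W (induced_map W A a) (induced_map W A b))"
    using W.star_eq_star_sum[OF induced_span[OF a] induced_span[OF b], of z] by blast
  note t = V.tensor_pair_span[OF a b]
  have "induced_map W A (V.star_sum z n (tensor_pair V a b)) =
      W.star_sum z n (tensor_pair W (induced_map W A a) (induced_map W A b))" for n
    unfolding V.star_sum_def W.star_sum_def induced_map_sum induced_map_scale
      induced_sym_mult[OF V.contraction_power_span[OF t]] induced_contraction_power[OF t] induced_tensor_pair[OF a b] ..
  thus ?thesis using 1[of "max N1 N2"] 2[of "max N1 N2"] by simp
qed

lemma seminorm_comp:
  assumes p: "continuous_seminorm W p"
  shows "continuous_seminorm V (\<lambda>v. p (A v))"
  unfolding continuous_seminorm_def
proof (intro conjI allI)
  fix v w c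
  show "0 \<le> p (A v)" by (rule W.continuous_seminormD(1)[OF p])
  show "p (A (v + w)) \<le> p (A v) + p (A w)" unfolding A_add by (rule W.continuous_seminormD(2)[OF p])
  show "p (A (scl V c v)) = norm c * p (A v)" unfolding A_scl by (rule W.continuous_seminormD(3)[OF p])
  show "continuous_on UNIV (\<lambda>v. p (A v))"
    by (rule continuous_on_compose2[OF W.continuous_seminormD(4)[OF p] A_continuous]) simp
qed

text \<open>Mapping \<open>A\<close> over the lists of a representation turns its cost for
  \<open>p \<circ> A\<close> into the same cost for \<open>p\<close>. Such representations exist for
  every \<open>r\<close> above the right side, which is enough by density.\<close>

lemma induced_weyl_seminorm_le:
  assumes p: "continuous_seminorm W p" and t: "t \<in> tspan (pure V)"
  shows "weyl_seminorm W R p (induced_map W A t) \<le> weyl_seminorm V R (\<lambda>v. p (A v)) t"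
proof (rule dense_ge)
  fix r assume r: "weyl_seminorm V R (\<lambda>v. p (A v)) t < r"
  have base: "rep_bound (pure W) (weyl_weight R p) (induced_map W A (pure V xs)) (1 * weyl_weight R (\<lambda>v. p (A v)) xs)" for xs
  proof -
    have "weyl_weight R (\<lambda>v. p (A v)) xs = weyl_weight R p (map A xs)"
      by (simp add: weyl_weight_def list_weight_def o_def)
    thus ?thesis unfolding induced_pure using rep_bound_base[of "pure W" "weyl_weight R p" "map A xs"] by simp
  qed
  have "rep_bound (pure W) (weyl_weight R p) (induced_map W A t) (1 * r)"
    by (rule rep_bound_linear[OF span_linear_induced zero_le_one base V.rep_bound_weyl[OF t r]])
  hence "rep_bound (pure W) (weyl_weight R p) (induced_map W A t) r" unfolding mult_1 .
  thus "weyl_seminorm W R p (induced_map W A t) \<le> r"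
    by (rule W.weyl_seminorm_le[rotated]) (rule W.continuous_seminormD(1)[OF p])
qed

lemma lipschitz_induced: "lipschitz_map (weyl_algebra V R z) (weyl_algebra W R z) (induced_map W A)"
  unfolding lipschitz_map_def
proof (intro conjI ballI)
  show "induced_map W A ` carrier (weyl_algebra V R z) \<subseteq> carrier (weyl_algebra W R z)"
    using induced_symmetric by auto
  fix d assume "d \<in> gauge (weyl_algebra W R z)"
  from W.weyl_gauge[OF this] obtain p where p: "continuous_seminorm W p \<and> d = (\<lambda>a b. weyl_seminorm W R p (a - b))" ..
  let ?d = "\<lambda>a b. weyl_seminorm V R (\<lambda>v. p (A v)) (a - b)"
  have "?d \<in> gauge (weyl_algebra V R z)"
    unfolding weyl_algebra_sel using seminorm_comp[OF conjunct1[OF p]] by blast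
  moreover have "d (induced_map W A x) (induced_map W A y) \<le> 1 * ?d x y"
    if "x \<in> carrier (weyl_algebra V R z)" "y \<in> carrier (weyl_algebra V R z)" for x y
    unfolding conjunct2[OF p] induced_map_diff[symmetric] mult_1
    by (rule induced_weyl_seminorm_le[OF conjunct1[OF p] tensor.span_diff[OF that[THEN V.weyl_carrier_span]]])
  ultimately show "\<exists>d'\<in>gauge (weyl_algebra V R z). \<exists>C>0. \<forall>x\<in>carrier (weyl_algebra V R z).
      \<forall>y\<in>carrier (weyl_algebra V R z). d (induced_map W A x) (induced_map W A y) \<le> C * d' x y"
    by (intro bexI[of _ ?d] exI[of _ 1] conjI ballI zero_less_one)
qed

lemma continuous_unital_hom_induced:
  "continuous_unital_hom (weyl_algebra V R z) (weyl_algebra W R z) (induced_map W A)"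
proof (rule continuous_unital_hom_lipschitz[OF V.gauged_space_weyl W.gauged_space_weyl lipschitz_induced])
  fix x y assume x: "x \<in> carrier (weyl_algebra V R z)" and y: "y \<in> carrier (weyl_algebra V R z)"
  show "induced_map W A (x \<otimes>\<^bsub>weyl_algebra V R z\<^esub> y) = induced_map W A x \<otimes>\<^bsub>weyl_algebra W R z\<^esub> induced_map W A y"
    unfolding weyl_algebra_sel by (rule induced_star[OF V.weyl_carrier_span[OF x] V.weyl_carrier_span[OF y]])
qed (simp_all add: induced_map_add induced_map_scale induced_pure)

end

section \<open>Identities and compositions\<close>

lemma (in poisson_space) poisson_map_id: "poisson_map V V id"
proof
  have "Vector_Spaces.linear (scl V) (scl V) id"
    by (simp add: Vector_Spaces.linear_iff vector_space_axioms)
  thus "continuous_poisson_map V V id" unfolding continuous_poisson_map_def by simp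
qed

lemma poisson_map_comp:
  assumes "poisson_map V W A" "poisson_map W U B"
  shows "poisson_map V U (B \<circ> A)"
proof -
  interpret A: poisson_map V W A by fact
  interpret B: poisson_map W U B by fact
  show ?thesis
  proof
    have "Vector_Spaces.linear (scl V) (scl U) (B \<circ> A)"
      by (simp add: Vector_Spaces.linear_iff A.V.vector_space_axioms B.W.vector_space_axioms
          A.A_add A.A_scl B.A_add B.A_scl)
    moreover have "(B \<circ> A) ` homogeneous V e \<subseteq> homogeneous U e" for e
      using A.map B.map unfolding continuous_poisson_map_def image_comp[symmetric]
      by (meson image_mono order_trans)
    moreover have "form U ((B \<circ> A) v) ((B \<circ> A) v') = form V v v'" for v v'
      by (simp add: A.A_form B.A_form)
    moreover have "continuous_on UNIV (B \<circ> A)"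
      by (rule continuous_on_compose[OF A.A_continuous continuous_on_subset[OF B.A_continuous]]) simp
    ultimately show "continuous_poisson_map V U (B \<circ> A)" unfolding continuous_poisson_map_def by blast
  qed
qed

text \<open>Confined to the span: a general functional may differ from its image at functions that
  are not multilinear, where pure tensors vanish.\<close>

lemma (in poisson_space) induced_id:
  assumes "a \<in> tspan (pure V)"
  shows "induced_map V id a = a"
proof -
  interpret poisson_map V V id by (rule poisson_map_id)
  show ?thesis
  proof (rule span_linear_eq[where P = "pure V" and \<Phi> = "induced_map V id" and \<Psi> = "\<lambda>t. t", OF span_linear_induced _ _ assms])
    show "span_linear (pure V) (\<lambda>t. t)" by (rule span_linearI) simp_all
  qed (simp add: induced_pure)
qed

lemma induced_comp:
  assumes A: "poisson_map V W A" and B: "poisson_map W U B" and a: "a \<in> tspan (pure V)"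
  shows "induced_map U (B \<circ> A) a = induced_map U B (induced_map W A a)"
proof -
  interpret A: poisson_map V W A by fact
  interpret B: poisson_map W U B by fact
  interpret C: poisson_map V U "B \<circ> A" by (rule poisson_map_comp[OF A B])
  show ?thesis
  proof (rule span_linear_eq[where P = "pure V" and \<Phi> = "induced_map U (B \<circ> A)"
        and \<Psi> = "\<lambda>a. induced_map U B (induced_map W A a)", OF span_linear_induced _ _ a])
    show "span_linear (pure V) (\<lambda>a. induced_map U B (induced_map W A a))"
      by (rule span_linearI) (simp_all only: induced_map_add induced_map_scale)
    fix xs
    show "induced_map U (B \<circ> A) (pure V xs) = induced_map U B (induced_map W A (pure V xs))"
      unfolding A.induced_pure B.induced_pure C.induced_pure by simp
  qed
qed

text \<open>The first two conjuncts identify \<open>induced_map W A\<close> as the extension of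
  \<open>A\<close> that is multiplicative for the undeformed product, and the one with
  \<open>completion_embed\<close> ties the completed map to it; the remaining claims thus concern
  the intended maps.\<close>

theorem proposition5p2:
  fixes V :: "('k::real_normed_field, 'v::{topological_ab_group_add, t2_space}) graded_space"
    and W :: "('k, 'w::{topological_ab_group_add, t2_space}) graded_space"
    and U :: "('k, 'u::{topological_ab_group_add, t2_space}) graded_space"
    and A :: "'v \<Rightarrow> 'w" and B :: "'w \<Rightarrow> 'u" and R :: real and z :: 'k
  assumes "poisson_space V" and "poisson_space W" and "poisson_space U"
    and "continuous_poisson_map V W A" and "continuous_poisson_map W U B"
    and "R \<ge> 1 / 2"
  shows
    "(\<forall>v. induced_map W A (pure V [v]) = pure W [A v]) \<and>
     (\<forall>a\<in>symmetric_algebra V. \<forall>b\<in>symmetric_algebra V.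
        induced_map W A (sym_mult V (tensor_pair V a b)) =
        sym_mult W (tensor_pair W (induced_map W A a) (induced_map W A b))) \<and>
     continuous_unital_hom (weyl_algebra V R z) (weyl_algebra W R z) (induced_map W A) \<and>
     continuous_unital_hom (gauge_completion (weyl_algebra V R z)) (gauge_completion (weyl_algebra W R z))
       (completion_map (weyl_algebra W R z) (induced_map W A)) \<and>
     (\<forall>a\<in>symmetric_algebra V.
        completion_map (weyl_algebra W R z) (induced_map W A)
          (completion_embed (weyl_algebra V R z) a) =
        completion_embed (weyl_algebra W R z) (induced_map W A a)) \<and>
     (\<forall>a\<in>symmetric_algebra V. induced_map V id a = a) \<and>
     (\<forall>x\<in>carrier (gauge_completion (weyl_algebra V R z)).
        completion_map (weyl_algebra V R z) (induced_map V id) x = x) \<and>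
     (\<forall>a\<in>symmetric_algebra V.
        induced_map U (B \<circ> A) a = induced_map U B (induced_map W A a)) \<and>
     (\<forall>x\<in>carrier (gauge_completion (weyl_algebra V R z)).
        completion_map (weyl_algebra U R z) (induced_map U (B \<circ> A)) x =
        completion_map (weyl_algebra U R z) (induced_map U B)
          (completion_map (weyl_algebra W R z) (induced_map W A) x))"
proof -
  interpret VW: poisson_map V W A
    by (intro poisson_map.intro poisson_map_axioms.intro assms)
  interpret WU: poisson_map W U B
    by (intro poisson_map.intro poisson_map_axioms.intro assms)
  interpret VU: poisson_map V U "B \<circ> A"
    by (rule poisson_map_comp[OF VW.poisson_map_axioms WU.poisson_map_axioms])
  interpret VV: poisson_map V V id by (rule VW.V.poisson_map_id)
  have gV: "gauged_space (weyl_algebra V R z)" by (rule VW.V.gauged_space_weyl)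
  have gW: "gauged_space (weyl_algebra W R z)" by (rule VW.W.gauged_space_weyl)
  have gU: "gauged_space (weyl_algebra U R z)" by (rule WU.W.gauged_space_weyl)
  have cA: "cauchy_map (weyl_algebra V R z) (weyl_algebra W R z) (induced_map W A)"
    by (rule lipschitz_imp_cauchy_map[OF gV gW VW.lipschitz_induced])
  have cB: "cauchy_map (weyl_algebra W R z) (weyl_algebra U R z) (induced_map U B)"
    by (rule lipschitz_imp_cauchy_map[OF gW gU WU.lipschitz_induced])
  have cBA: "cauchy_map (weyl_algebra V R z) (weyl_algebra U R z) (induced_map U (B \<circ> A))"
    by (rule lipschitz_imp_cauchy_map[OF gV gU VU.lipschitz_induced])
  have cid: "cauchy_map (weyl_algebra V R z) (weyl_algebra V R z) (induced_map V id)"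
    by (rule lipschitz_imp_cauchy_map[OF gV gV VV.lipschitz_induced])
  have R: "1 / 2 \<le> R" using assms(6) .
  note comp = induced_comp[OF VW.poisson_map_axioms WU.poisson_map_axioms]
  show ?thesis
  proof (intro conjI allI ballI)
    fix v
    show "induced_map W A (pure V [v]) = pure W [A v]" by (simp add: VW.induced_pure)
  next
    fix a b assume a: "a \<in> symmetric_algebra V" and b: "b \<in> symmetric_algebra V"
    note ab = VW.V.sym_span[OF a] VW.V.sym_span[OF b]
    show "induced_map W A (sym_mult V (tensor_pair V a b)) =
        sym_mult W (tensor_pair W (induced_map W A a) (induced_map W A b))"
      by (simp only: VW.induced_sym_mult[OF VW.V.tensor_pair_span[OF ab]] VW.induced_tensor_pair[OF ab])
  next
    show "continuous_unital_hom (weyl_algebra V R z) (weyl_algebra W R z) (induced_map W A)"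
      by (rule VW.continuous_unital_hom_induced)
  next
    show "continuous_unital_hom (gauge_completion (weyl_algebra V R z)) (gauge_completion (weyl_algebra W R z))
       (completion_map (weyl_algebra W R z) (induced_map W A))"
      by (rule continuous_unital_hom_completion[OF VW.V.topological_algebra_weyl[OF R]
            VW.W.topological_algebra_weyl[OF R] VW.lipschitz_induced VW.continuous_unital_hom_induced])
  next
    fix a assume a: "a \<in> symmetric_algebra V"
    show "completion_map (weyl_algebra W R z) (induced_map W A) (completion_embed (weyl_algebra V R z) a) =
        completion_embed (weyl_algebra W R z) (induced_map W A a)"
      by (rule completion_map_embed[OF gV gW cA]) (simp only: weyl_algebra_sel a)
  next
    fix a assume a: "a \<in> symmetric_algebra V"
    show "induced_map V id a = a" by (rule VW.V.induced_id[OF VW.V.sym_span[OF a]])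
  next
    fix x assume x: "x \<in> carrier (gauge_completion (weyl_algebra V R z))"
    show "completion_map (weyl_algebra V R z) (induced_map V id) x = x"
      by (rule completion_map_ident[OF gV cid _ x]) (rule VW.V.induced_id[OF VW.V.weyl_carrier_span])
  next
    fix a assume a: "a \<in> symmetric_algebra V"
    show "induced_map U (B \<circ> A) a = induced_map U B (induced_map W A a)"
      by (rule comp[OF VW.V.sym_span[OF a]])
  next
    fix x assume x: "x \<in> carrier (gauge_completion (weyl_algebra V R z))"
    show "completion_map (weyl_algebra U R z) (induced_map U (B \<circ> A)) x =
        completion_map (weyl_algebra U R z) (induced_map U B)
          (completion_map (weyl_algebra W R z) (induced_map W A) x)"
      by (rule completion_map_comp[OF gV gW gU cA cB cBA _ x]) (rule comp[OF VW.V.weyl_carrier_span])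
  qed
qed

end
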